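(* For every integer $d>1$ there exist both (i) a naturally reductive geodesic orbit Lorentz nilmanifold $(N,ds^2)$, with $N$ nilpotent of step $\ge d$, of dimension $2d+4$; and (ii) a geodesic orbit Lorentz nilmanifold of the form $(N_1,ds_1^2)\times(N_2,ds_2^2)$, of dimension $2d+10$, which is $d'$-step nilpotent with $d'\ge d$.
   Context: A pseudo-Riemannian nilmanifold is a pseudo-Riemannian manifold admitting a transitive nilpotent Lie group of isometries; it is Lorentz if the metric has Lorentz signature (exactly one negative direction). Here the nilmanifold is a connected nilpotent Lie group $N$ with a left-invariant metric $ds^2$, determined by a nondegenerate symmetric bilinear form $\langle\cdot,\cdot\rangle$ on its Lie algebra $\mathfrak n$. In (ii) the transitive nilpotent group is $N_1\times N_2$ and the metric is the product metric. The nilpotency step is that of the transitive nilpotent group (equivalently, of its Lie algebra). The geodesic orbit and naturally reductive properties are understood relative to the group $G=N\rtimes H$, where $H$ is the full group of isometric automorphisms of $(N,ds^2)$ (with $N=N_1\times N_2$ in (ii)), so that $N=G/H$. Let $\mathfrak g$ and $\mathfrak h$ be the Lie algebras of $G$ and $H$; then $\mathfrak g=\mathfrak h\oplus\mathfrak n$. Geodesic orbit (GO): every geodesic is an orbit of a $1$-parameter subgroup of $G$ (up to reparametrization, which matters only for null geodesics). Naturally reductive: there is a reductive decomposition $\mathfrak g=\mathfrak h\oplus\mathfrak m$ (vector space direct sum with $[\mathfrak h,\mathfrak m]\subset\mathfrak m$; $\mathfrak m$ need not equal $\mathfrak n$) such that $\langle[T',T]_{\mathfrak m},T\rangle=0$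 for all $T,T'\in\mathfrak m$, where $\mathfrak m$ carries the inner product obtained from its identification with the tangent space of $G/H$ at the base point, and the subscript $\mathfrak m$ denotes the $\mathfrak m$-component in $\mathfrak g=\mathfrak h\oplus\mathfrak m$. *)

theory Defs
  imports "HOL-Analysis.Analysis" "HOL-Algebra.Generated_Groups"
begin

section \<open>Smooth manifolds\<close>

text \<open>
  Points of \<open>R^n\<close> are the points of the library space \<^const>\<open>Euclidean_space\<close> \<open>n\<close>, that is, sequences
  vanishing from index \<open>n\<close> on. A function on an open subset \<open>S\<close> of it is \<open>C^k\<close> if all its iterated
  partial derivatives up to order \<open>k\<close> exist and are continuous on \<open>S\<close>.
\<close>

definition partial_deriv :: "nat \<Rightarrow> ((nat \<Rightarrow> real) \<Rightarrow> real) \<Rightarrow> (nat \<Rightarrow> real) \<Rightarrow> real" where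
  "partial_deriv i f x = deriv (\<lambda>t. f (x(i := t))) (x i)"

primrec Ck_on :: "nat \<Rightarrow> (nat \<Rightarrow> real) set \<Rightarrow> nat \<Rightarrow> ((nat \<Rightarrow> real) \<Rightarrow> real) \<Rightarrow> bool" where
  "Ck_on n S 0 f \<longleftrightarrow> continuous_map (subtopology (Euclidean_space n) S) euclideanreal f"
| "Ck_on n S (Suc k) f \<longleftrightarrow>
     continuous_map (subtopology (Euclidean_space n) S) euclideanreal f \<and>
     (\<forall>i<n. (\<forall>x\<in>S. (\<lambda>t. f (x(i := t))) differentiable (at (x i))) \<and> Ck_on n S k (partial_deriv i f))"

definition smooth_on :: "nat \<Rightarrow> (nat \<Rightarrow> real) set \<Rightarrow> ((nat \<Rightarrow> real) \<Rightarrow> real) \<Rightarrow> bool" where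
  "smooth_on n S f \<longleftrightarrow> (\<forall>k. Ck_on n S k f)"

type_synonym 'a chart = "'a set \<times> ('a \<Rightarrow> nat \<Rightarrow> real)"

record 'a manifold =
  mtop :: "'a topology"
  mdim :: nat
  atlas :: "'a chart set"

definition smooth_manifold :: "'a manifold \<Rightarrow> bool" where
  "smooth_manifold M \<longleftrightarrow>
     Hausdorff_space (mtop M) \<and> second_countable (mtop M) \<and>
     \<Union>(fst ` atlas M) = topspace (mtop M) \<and>
     (\<forall>(U, \<phi>) \<in> atlas M.
        openin (mtop M) U \<and> openin (Euclidean_space (mdim M)) (\<phi> ` U) \<and>
        homeomorphic_map (subtopology (mtop M) U) (subtopology (Euclidean_space (mdim M)) (\<phi> ` U)) \<phi>) \<and>
     (\<forall>(U, \<phi>) \<in> atlas M. \<forall>(V, \<psi>) \<in> atlas M. \<forall>k<mdim M.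
        smooth_on (mdim M) (\<phi> ` (U \<inter> V)) (\<lambda>x. \<psi> (inv_into U \<phi> x) k))"

definition smooth_map :: "'a manifold \<Rightarrow> 'b manifold \<Rightarrow> ('a \<Rightarrow> 'b) \<Rightarrow> bool" where
  "smooth_map M M' f \<longleftrightarrow>
     continuous_map (mtop M) (mtop M') f \<and>
     (\<forall>(U, \<phi>) \<in> atlas M. \<forall>(V, \<psi>) \<in> atlas M'. \<forall>k<mdim M'.
        smooth_on (mdim M) (\<phi> ` {p \<in> U. f p \<in> V}) (\<lambda>x. \<psi> (f (inv_into U \<phi> x)) k))"

definition prod_chart :: "nat \<Rightarrow> 'a chart \<Rightarrow> 'b chart \<Rightarrow> ('a \<times> 'b) chart" where
  "prod_chart m c c' =
     (fst c \<times> fst c', \<lambda>(p, q) i. if i < m then snd c p i else snd c' q (i - m))"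

definition prod_manifold :: "'a manifold \<Rightarrow> 'b manifold \<Rightarrow> ('a \<times> 'b) manifold" where
  "prod_manifold M M' =
     \<lparr>mtop = prod_topology (mtop M) (mtop M'), mdim = mdim M + mdim M',
      atlas = {prod_chart (mdim M) c c' | c c'. c \<in> atlas M \<and> c' \<in> atlas M'}\<rparr>"

definition line_manifold :: "real set \<Rightarrow> real manifold" where
  "line_manifold I =
     \<lparr>mtop = top_of_set I, mdim = 1, atlas = {(I, \<lambda>t i. if i = 0 then t else 0)}\<rparr>"

definition smooth_curve :: "'a manifold \<Rightarrow> real set \<Rightarrow> (real \<Rightarrow> 'a) \<Rightarrow> bool" where
  "smooth_curve M I \<gamma> \<longleftrightarrow> smooth_map (line_manifold I) M \<gamma>"

text \<open>The curve with constant velocity \<open>u\<close>, in the coordinates of the chart, through the point with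
  coordinates \<open>x\<close>; only its germ at parameter 0 is meaningful.\<close>

definition coord_line :: "'a chart \<Rightarrow> (nat \<Rightarrow> real) \<Rightarrow> (nat \<Rightarrow> real) \<Rightarrow> real \<Rightarrow> 'a" where
  "coord_line c x u = (\<lambda>s. inv_into (fst c) (snd c) (\<lambda>k. x k + s * u k))"

definition unit_coord :: "nat \<Rightarrow> nat \<Rightarrow> real" where
  "unit_coord i = (\<lambda>k. if k = i then 1 else 0)"


section \<open>Pseudo-Riemannian metrics and geodesics\<close>

text \<open>
  Tangent vectors at \<open>p\<close> are represented by smooth curves through \<open>p\<close> at parameter 0. A metric is thus
  a function of two such curves with a common base point; \<open>pseudo_riemannian_metric\<close> says that in
  every chart it is \<open>\<Sum> g\<^sub>i\<^sub>j dx\<^sub>i dx\<^sub>j\<close> with \<open>(g\<^sub>i\<^sub>j)\<close> smooth, symmetric and nondegenerate. In particular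
  its value depends only on the velocities of the two curves, bilinearly.
\<close>

type_synonym 'a metric_field = "(real \<Rightarrow> 'a) \<Rightarrow> (real \<Rightarrow> 'a) \<Rightarrow> real"

definition tangent_curves :: "'a manifold \<Rightarrow> 'a \<Rightarrow> (real \<Rightarrow> 'a) set" where
  "tangent_curves M p = {\<alpha>. \<alpha> 0 = p \<and> (\<exists>\<epsilon>>0. smooth_curve M {-\<epsilon><..<\<epsilon>} \<alpha>)}"

definition metric_comp :: "'a metric_field \<Rightarrow> 'a chart \<Rightarrow> nat \<Rightarrow> nat \<Rightarrow> (nat \<Rightarrow> real) \<Rightarrow> real" where
  "metric_comp g c i j x = g (coord_line c x (unit_coord i)) (coord_line c x (unit_coord j))"

definition pseudo_riemannian_metric :: "'a manifold \<Rightarrow> 'a metric_field \<Rightarrow> bool" where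
  "pseudo_riemannian_metric M g \<longleftrightarrow>
     (\<forall>(U, \<phi>) \<in> atlas M.
        (\<forall>i<mdim M. \<forall>j<mdim M. smooth_on (mdim M) (\<phi> ` U) (metric_comp g (U, \<phi>) i j)) \<and>
        (\<forall>x \<in> \<phi> ` U.
           (\<forall>i<mdim M. \<forall>j<mdim M. metric_comp g (U, \<phi>) i j x = metric_comp g (U, \<phi>) j i x) \<and>
           (\<forall>u \<in> topspace (Euclidean_space (mdim M)).
              (\<forall>v \<in> topspace (Euclidean_space (mdim M)).
                 (\<Sum>i<mdim M. \<Sum>j<mdim M. metric_comp g (U, \<phi>) i j x * u i * v j) = 0)
              \<longrightarrow> u = (\<lambda>_. 0))) \<and>
        (\<forall>p\<in>U. \<forall>\<alpha> \<in> tangent_curves M p. \<forall>\<beta> \<in> tangent_curves M p.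
           g \<alpha> \<beta> = (\<Sum>i<mdim M. \<Sum>j<mdim M. metric_comp g (U, \<phi>) i j (\<phi> p) *
                      deriv (\<lambda>t. \<phi> (\<alpha> t) i) 0 * deriv (\<lambda>t. \<phi> (\<beta> t) j) 0)))"

text \<open>Lorentz signature: at each point there is a pseudo-orthonormal basis with exactly one negative
  vector.\<close>

definition lorentzian :: "'a manifold \<Rightarrow> 'a metric_field \<Rightarrow> bool" where
  "lorentzian M g \<longleftrightarrow> 0 < mdim M \<and>
     (\<forall>p \<in> topspace (mtop M). \<exists>E. (\<forall>i<mdim M. E i \<in> tangent_curves M p) \<and>
        (\<forall>i<mdim M. \<forall>j<mdim M. g (E i) (E j) = (if i \<noteq> j then 0 else if i = 0 then -1 else 1)))"

definition isometry :: "'a manifold \<Rightarrow> 'a metric_field \<Rightarrow> ('a \<Rightarrow> 'a) \<Rightarrow> bool" where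
  "isometry M g F \<longleftrightarrow>
     bij_betw F (topspace (mtop M)) (topspace (mtop M)) \<and>
     smooth_map M M F \<and> smooth_map M M (inv_into (topspace (mtop M)) F) \<and>
     (\<forall>p \<in> topspace (mtop M). \<forall>\<alpha> \<in> tangent_curves M p. \<forall>\<beta> \<in> tangent_curves M p.
        g (F \<circ> \<alpha>) (F \<circ> \<beta>) = g \<alpha> \<beta>)"

definition product_metric :: "'a metric_field \<Rightarrow> 'b metric_field \<Rightarrow> ('a \<times> 'b) metric_field" where
  "product_metric g g' = (\<lambda>\<alpha> \<beta>. g (fst \<circ> \<alpha>) (fst \<circ> \<beta>) + g' (snd \<circ> \<alpha>) (snd \<circ> \<beta>))"

text \<open>Christoffel symbols of the first kind of the Levi-Civita connection; the geodesic equation below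
  is the usual one with its free index lowered.\<close>

definition christoffel1 :: "'a metric_field \<Rightarrow> 'a chart \<Rightarrow> nat \<Rightarrow> nat \<Rightarrow> nat \<Rightarrow> (nat \<Rightarrow> real) \<Rightarrow> real" where
  "christoffel1 g c k i j x =
     (partial_deriv i (metric_comp g c k j) x + partial_deriv j (metric_comp g c k i) x
        - partial_deriv k (metric_comp g c i j) x) / 2"

definition geodesic :: "'a manifold \<Rightarrow> 'a metric_field \<Rightarrow> real set \<Rightarrow> (real \<Rightarrow> 'a) \<Rightarrow> bool" where
  "geodesic M g I \<gamma> \<longleftrightarrow>
     open I \<and> is_interval I \<and> smooth_curve M I \<gamma> \<and>
     (\<forall>(U, \<phi>) \<in> atlas M. \<forall>t\<in>I. \<gamma> t \<in> U \<longrightarrow> (\<forall>k<mdim M.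
        (\<Sum>l<mdim M. metric_comp g (U, \<phi>) k l (\<phi> (\<gamma> t)) * deriv (deriv (\<lambda>s. \<phi> (\<gamma> s) l)) t)
        + (\<Sum>i<mdim M. \<Sum>j<mdim M. christoffel1 g (U, \<phi>) k i j (\<phi> (\<gamma> t)) *
             deriv (\<lambda>s. \<phi> (\<gamma> s) i) t * deriv (\<lambda>s. \<phi> (\<gamma> s) j) t) = 0))"


section \<open>Lie groups with left-invariant metrics\<close>

definition lie_group :: "'a monoid \<Rightarrow> 'a manifold \<Rightarrow> bool" where
  "lie_group N M \<longleftrightarrow>
     group N \<and> smooth_manifold M \<and> carrier N = topspace (mtop M) \<and>
     smooth_map (prod_manifold M M) M (\<lambda>(x, y). x \<otimes>\<^bsub>N\<^esub> y) \<and>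
     smooth_map M M (\<lambda>x. inv\<^bsub>N\<^esub> x)"

primrec lower_central :: "'a monoid \<Rightarrow> nat \<Rightarrow> 'a set" where
  "lower_central N 0 = carrier N"
| "lower_central N (Suc k) = generate N
     {x \<otimes>\<^bsub>N\<^esub> y \<otimes>\<^bsub>N\<^esub> inv\<^bsub>N\<^esub> x \<otimes>\<^bsub>N\<^esub> inv\<^bsub>N\<^esub> y | x y. x \<in> lower_central N k \<and> y \<in> carrier N}"

definition nilpotent_of_step :: "'a monoid \<Rightarrow> nat \<Rightarrow> bool" where
  "nilpotent_of_step N s \<longleftrightarrow>
     lower_central N s = {\<one>\<^bsub>N\<^esub>} \<and> (\<forall>k<s. lower_central N k \<noteq> {\<one>\<^bsub>N\<^esub>})"

definition left_invariant :: "'a monoid \<Rightarrow> 'a manifold \<Rightarrow> 'a metric_field \<Rightarrow> bool" where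
  "left_invariant N M g \<longleftrightarrow> (\<forall>a \<in> carrier N. isometry M g (\<lambda>x. a \<otimes>\<^bsub>N\<^esub> x))"

definition pseudo_riemannian_nilmanifold :: "'a monoid \<Rightarrow> 'a manifold \<Rightarrow> 'a metric_field \<Rightarrow> bool" where
  "pseudo_riemannian_nilmanifold N M g \<longleftrightarrow>
     lie_group N M \<and> connected_space (mtop M) \<and> (\<exists>s. nilpotent_of_step N s) \<and>
     pseudo_riemannian_metric M g \<and> left_invariant N M g"

definition lorentz_nilmanifold :: "'a monoid \<Rightarrow> 'a manifold \<Rightarrow> 'a metric_field \<Rightarrow> bool" where
  "lorentz_nilmanifold N M g \<longleftrightarrow> pseudo_riemannian_nilmanifold N M g \<and> lorentzian M g"

definition isometric_automorphisms :: "'a monoid \<Rightarrow> 'a manifold \<Rightarrow> 'a metric_field \<Rightarrow> ('a \<Rightarrow> 'a) set" where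
  "isometric_automorphisms N M g = {\<theta>. \<theta> \<in> iso N N \<and> isometry M g \<theta>}"

text \<open>The group \<open>N \<rtimes> H\<close>, with \<open>H\<close> the group of all isometric automorphisms, acts effectively on \<open>N\<close> by
  \<open>(a, \<theta>) \<cdot> x = a \<theta>(x)\<close>; it is represented by its transformations. A one-parameter subgroup of a group
  of transformations is a smooth flow by elements of the group.\<close>

definition semidirect_transformations :: "'a monoid \<Rightarrow> 'a manifold \<Rightarrow> 'a metric_field \<Rightarrow> ('a \<Rightarrow> 'a) set" where
  "semidirect_transformations N M g =
     {F. \<exists>a \<in> carrier N. \<exists>\<theta> \<in> isometric_automorphisms N M g. \<forall>x \<in> carrier N. F x = a \<otimes>\<^bsub>N\<^esub> \<theta> x}"

definition one_param_subgroup :: "'a manifold \<Rightarrow> ('a \<Rightarrow> 'a) set \<Rightarrow> (real \<Rightarrow> 'a \<Rightarrow> 'a) \<Rightarrow> bool" where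
  "one_param_subgroup M \<G> \<Phi> \<longleftrightarrow>
     (\<forall>t. \<Phi> t \<in> \<G>) \<and>
     (\<forall>s t. \<forall>x \<in> topspace (mtop M). \<Phi> (s + t) x = \<Phi> s (\<Phi> t x)) \<and>
     smooth_map (prod_manifold (line_manifold UNIV) M) M (\<lambda>(t, x). \<Phi> t x)"

definition geodesic_orbit :: "'a monoid \<Rightarrow> 'a manifold \<Rightarrow> 'a metric_field \<Rightarrow> bool" where
  "geodesic_orbit N M g \<longleftrightarrow>
     (\<forall>I \<gamma>. geodesic M g I \<gamma> \<longrightarrow>
        (\<exists>\<Phi> p \<rho>. one_param_subgroup M (semidirect_transformations N M g) \<Phi> \<and>
           p \<in> topspace (mtop M) \<and>
           smooth_curve (line_manifold UNIV) I \<rho> \<and> (\<forall>t\<in>I. deriv \<rho> t \<noteq> 0) \<and>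
           (\<forall>t\<in>I. \<gamma> t = \<Phi> (\<rho> t) p)))"


section \<open>Lie algebras and natural reductivity\<close>

text \<open>
  Throughout, \<open>c\<close> is a chart around the identity of \<open>N\<close>, and the Lie algebra of \<open>N\<close>, the tangent space
  at the identity, is identified with \<open>R^n\<close> by the coordinates of \<open>c\<close>. Its bracket is that of
  left-invariant vector fields, \<open>[X, Y]f = X(Yf) - Y(Xf)\<close>, evaluated at the identity on the coordinate
  functions.
\<close>

definition lie_space :: "'a manifold \<Rightarrow> (nat \<Rightarrow> real) set" where
  "lie_space M = topspace (Euclidean_space (mdim M))"

definition lie_ray :: "'a monoid \<Rightarrow> 'a chart \<Rightarrow> (nat \<Rightarrow> real) \<Rightarrow> real \<Rightarrow> 'a" where
  "lie_ray N c u = coord_line c (snd c \<one>\<^bsub>N\<^esub>) u"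

definition left_field :: "'a monoid \<Rightarrow> 'a chart \<Rightarrow> (nat \<Rightarrow> real) \<Rightarrow> ('a \<Rightarrow> real) \<Rightarrow> 'a \<Rightarrow> real" where
  "left_field N c u f p = deriv (\<lambda>s. f (p \<otimes>\<^bsub>N\<^esub> lie_ray N c u s)) 0"

definition lie_bracket ::
  "'a monoid \<Rightarrow> 'a chart \<Rightarrow> (nat \<Rightarrow> real) \<Rightarrow> (nat \<Rightarrow> real) \<Rightarrow> nat \<Rightarrow> real" where
  "lie_bracket N c u v = (\<lambda>k.
     left_field N c u (left_field N c v (\<lambda>p. snd c p k)) \<one>\<^bsub>N\<^esub> -
     left_field N c v (left_field N c u (\<lambda>p. snd c p k)) \<one>\<^bsub>N\<^esub>)"

definition lie_form :: "'a monoid \<Rightarrow> 'a metric_field \<Rightarrow> 'a chart \<Rightarrow> (nat \<Rightarrow> real) \<Rightarrow> (nat \<Rightarrow> real) \<Rightarrow> real" where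
  "lie_form N g c u v = g (lie_ray N c u) (lie_ray N c v)"

definition differential_at_one ::
  "'a monoid \<Rightarrow> 'a chart \<Rightarrow> ('a \<Rightarrow> 'a) \<Rightarrow> (nat \<Rightarrow> real) \<Rightarrow> nat \<Rightarrow> real" where
  "differential_at_one N c \<theta> u = (\<lambda>k. deriv (\<lambda>s. snd c (\<theta> (lie_ray N c u s)) k) 0)"

text \<open>The Lie algebra \<open>h\<close> of \<open>H\<close>, as endomorphisms of the Lie algebra of \<open>N\<close>: the velocities at 0 of the
  differentials of one-parameter subgroups of \<open>H\<close>. Endomorphisms are extended by 0 outside \<open>R^n\<close>.\<close>

definition isotropy_algebra ::
  "'a monoid \<Rightarrow> 'a manifold \<Rightarrow> 'a metric_field \<Rightarrow> 'a chart \<Rightarrow> ((nat \<Rightarrow> real) \<Rightarrow> nat \<Rightarrow> real) set" where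
  "isotropy_algebra N M g c =
     {(\<lambda>u k. if u \<in> lie_space M then deriv (\<lambda>t. differential_at_one N c (\<Theta> t) u k) 0 else 0) | \<Theta>.
        one_param_subgroup M (isometric_automorphisms N M g) \<Theta>}"

text \<open>The Lie algebra of \<open>N \<rtimes> H\<close> is the semidirect sum: pairs \<open>(A, u)\<close> with \<open>A\<close> in \<open>h\<close> and \<open>u\<close> in the
  Lie algebra of \<open>N\<close>.\<close>

type_synonym semidirect_elem = "((nat \<Rightarrow> real) \<Rightarrow> nat \<Rightarrow> real) \<times> (nat \<Rightarrow> real)"

definition sd_zero :: semidirect_elem where
  "sd_zero = (\<lambda>_ _. 0, \<lambda>_. 0)"

definition sd_add :: "semidirect_elem \<Rightarrow> semidirect_elem \<Rightarrow> semidirect_elem" where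
  "sd_add X Y = (\<lambda>w k. fst X w k + fst Y w k, \<lambda>k. snd X k + snd Y k)"

definition sd_scale :: "real \<Rightarrow> semidirect_elem \<Rightarrow> semidirect_elem" where
  "sd_scale r X = (\<lambda>w k. r * fst X w k, \<lambda>k. r * snd X k)"

definition sd_bracket :: "'a monoid \<Rightarrow> 'a chart \<Rightarrow> semidirect_elem \<Rightarrow> semidirect_elem \<Rightarrow> semidirect_elem" where
  "sd_bracket N c X Y =
     (\<lambda>w k. fst X (fst Y w) k - fst Y (fst X w) k,
      \<lambda>k. fst X (snd Y) k - fst Y (snd X) k + lie_bracket N c (snd X) (snd Y) k)"

definition semidirect_algebra ::
  "'a monoid \<Rightarrow> 'a manifold \<Rightarrow> 'a metric_field \<Rightarrow> 'a chart \<Rightarrow> semidirect_elem set" where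
  "semidirect_algebra N M g c = isotropy_algebra N M g c \<times> lie_space M"

definition isotropy_subalgebra ::
  "'a monoid \<Rightarrow> 'a manifold \<Rightarrow> 'a metric_field \<Rightarrow> 'a chart \<Rightarrow> semidirect_elem set" where
  "isotropy_subalgebra N M g c = isotropy_algebra N M g c \<times> {\<lambda>_. 0}"

definition sd_subspace :: "semidirect_elem set \<Rightarrow> bool" where
  "sd_subspace W \<longleftrightarrow> sd_zero \<in> W \<and> (\<forall>X\<in>W. \<forall>Y\<in>W. sd_add X Y \<in> W) \<and> (\<forall>r. \<forall>X\<in>W. sd_scale r X \<in> W)"

definition reductive_complement ::
  "'a monoid \<Rightarrow> 'a manifold \<Rightarrow> 'a metric_field \<Rightarrow> 'a chart \<Rightarrow> semidirect_elem set \<Rightarrow> bool" where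
  "reductive_complement N M g c \<mm> \<longleftrightarrow>
     \<mm> \<subseteq> semidirect_algebra N M g c \<and> sd_subspace \<mm> \<and>
     isotropy_subalgebra N M g c \<inter> \<mm> = {sd_zero} \<and>
     (\<forall>X \<in> semidirect_algebra N M g c. \<exists>Z \<in> isotropy_subalgebra N M g c. \<exists>T \<in> \<mm>. X = sd_add Z T) \<and>
     (\<forall>Z \<in> isotropy_subalgebra N M g c. \<forall>T \<in> \<mm>. sd_bracket N c Z T \<in> \<mm>)"

text \<open>The identification of \<open>m\<close> with the tangent space of \<open>G/H = N\<close> at the base point sends \<open>(A, u)\<close>
  to \<open>u\<close>, as \<open>H\<close> fixes the identity.\<close>

definition sd_form :: "'a monoid \<Rightarrow> 'a metric_field \<Rightarrow> 'a chart \<Rightarrow> semidirect_elem \<Rightarrow> semidirect_elem \<Rightarrow> real" where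
  "sd_form N g c X Y = lie_form N g c (snd X) (snd Y)"

text \<open>Below, \<open>Y\<close> is the \<open>m\<close>-component of \<open>[T', T]\<close>; it is unique since the sum of \<open>h\<close> and \<open>m\<close> is
  direct.\<close>

definition naturally_reductive :: "'a monoid \<Rightarrow> 'a manifold \<Rightarrow> 'a metric_field \<Rightarrow> bool" where
  "naturally_reductive N M g \<longleftrightarrow>
     (\<forall>c \<in> atlas M. \<one>\<^bsub>N\<^esub> \<in> fst c \<longrightarrow>
        (\<exists>\<mm>. reductive_complement N M g c \<mm> \<and>
           (\<forall>T' \<in> \<mm>. \<forall>T \<in> \<mm>. \<exists>Z \<in> isotropy_subalgebra N M g c. \<exists>Y \<in> \<mm>.
              sd_bracket N c T' T = sd_add Z Y \<and> sd_form N g c Y T = 0)))"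

end

theory Submission
  imports Defs "HOL-Library.Function_Algebras"
begin

text \<open>
  Both parts come from one family of Lie algebras. Let \<open>V\<close> be a Euclidean space with linear maps
  \<open>D\<close>, \<open>J\<close>, where \<open>J\<close> is skew, and put \<open>\<nn> = \<real> f \<oplus> V \<oplus> \<real> e\<close> with \<open>[f, v] = D v\<close> and
  \<open>[v, w] = \<langle>J v, w\<rangle> e\<close>, where \<open>e\<close> and \<open>f\<close> are null vectors orthogonal to \<open>V\<close> with \<open>\<langle>e, f\<rangle> = 1\<close>.
  The Jacobi identity is \<open>J D + D\<^sup>T J = 0\<close>, the scalar product is Lorentzian, and \<open>\<nn>\<close> is nilpotent
  as soon as \<open>D\<close> is. The lower central series contains the images of the powers of \<open>D\<close>, so its length
  exceeds every \<open>q\<close> with \<open>D\<^sup>q \<noteq> 0\<close> (\<open>nilpotent_step\<close>).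

  The decisive condition is \<open>S\<^sup>2 = 0\<close> for \<open>S = J + D\<^sup>T\<close>. For \<open>a \<in> V\<close> let the null rotation \<open>A\<^sub>a\<close> be the
  skew map \<open>f \<mapsto> a\<close>, \<open>v \<mapsto> - \<langle>a, v\<rangle> e\<close>, \<open>e \<mapsto> 0\<close>. It is a derivation of \<open>\<nn>\<close> exactly if \<open>S a = 0\<close>, so
  \<open>S\<^sup>2 = 0\<close> makes \<open>A\<^bsub>S v\<^esub>\<close> a skew derivation for every \<open>v\<close>. For \<open>T = x f + v + y e\<close> the element
  \<open>A\<^bsub>S v\<^esub> + T\<close> of the semidirect product satisfies \<open>\<langle>[A\<^bsub>S v\<^esub> + T, T'], T\<rangle> = 0\<close> for all \<open>T'\<close>; by the
  geodesic lemma the geodesic with initial velocity \<open>T\<close> is the orbit of its one-parameter group.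
  Moreover \<open>A\<^bsub>S v\<^esub>\<close> depends linearly on \<open>T\<close>. If the isotropy algebra consists of null rotations \<open>A\<^sub>a\<close>
  with \<open>S a = 0\<close>, then the graph of \<open>T \<mapsto> A\<^bsub>S v\<^esub>\<close> is a complement of it that is invariant under it,
  because \<open>A\<^sub>a\<close> maps \<open>\<nn>\<close> into the kernel of \<open>T \<mapsto> A\<^bsub>S v\<^esub>\<close>. As null rotations are skew, the equation
  \<open>\<langle>[A\<^bsub>S v\<^esub> + T, T'], T\<rangle> = 0\<close> says that this complement is naturally reductive (\<open>naturally_reductive_N\<close>).

  The group is realized on the coordinates \<open>(x, y, v)\<close>. Its metric is
  \<open>2 dx (dy - \<langle>J v, dv + D v dx\<rangle> / 2) + |dv + D v dx|\<^sup>2\<close>, a homogeneous plane wave, and everything is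
  polynomial in the coordinates. The isometries of the semidirect product that matter translate
  \<open>x\<close> and shift \<open>v\<close> by a solution of \<open>h' = a - D h\<close> with \<open>S a = 0\<close> (\<open>isoF_isometric\<close>,
  \<open>isoF_semidirect\<close>). Instead of the geodesic lemma, the proof solves the geodesic equation
  (\<open>geodesic_velocity\<close>) and compares its solutions with explicit one-parameter groups of such
  isometries (\<open>geodesic_is_orbit\<close>). That nothing but null rotations occurs in the isotropy algebra
  (\<open>isotropy_is_null_rotation\<close>) reduces to a rigidity property of the pair \<open>D\<close>, \<open>J\<close>: no nonzero skew map
  commutes with both up to a common scalar multiple
  (\<open>skew_derivation_is_null_rotation\<close>).

  It remains to find nilpotent \<open>D\<close> with \<open>D\<^sup>d \<noteq> 0\<close>. With \<open>n = d + 1\<close>, take \<open>V = \<real>\<^sup>n \<oplus> \<real>\<^sup>n\<close>, let \<open>A\<close> be the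
  nilpotent shift on \<open>\<real>\<^sup>n\<close>, and put
  \<open>D (u, w) = ((A - A\<^sup>T) u + A w, A\<^sup>T u)\<close> and \<open>J (u, w) = ((A - A\<^sup>T) u + A w, - A\<^sup>T u)\<close>, so that
  \<open>S (u, w) = (2 A w, 0)\<close>. The sum \<open>u + w\<close> is mapped by \<open>D\<close> to \<open>A (u + w)\<close>, and on the subspace
  \<open>u + w = 0\<close> the map \<open>D\<close> acts on \<open>u\<close> as \<open>- A\<^sup>T\<close>. Hence \<open>D\<close> is nilpotent although its upper left block is
  skew, and \<open>D\<^sup>d \<noteq> 0\<close> (\<open>Dn_nilpotent\<close>, \<open>Dn_power_nonzero\<close>); rigidity is \<open>block_matrix_rigid\<close>. The dimension is
  \<open>2 n + 2 = 2 d + 4\<close>. For the second part, the product with the flat \<open>\<real>\<^sup>6\<close> is again a member of the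
  family, with \<open>D\<close> and \<open>J\<close> extended by zero to \<open>V \<oplus> \<real>\<^sup>6\<close> (\<open>product_model\<close>).
\<close>

section \<open>Polynomial functions and smoothness\<close>

abbreviation coord_space :: "nat \<Rightarrow> (nat \<Rightarrow> real) set" where
  "coord_space n \<equiv> topspace (Euclidean_space n)"

lemma coord_space_iff: "x \<in> coord_space n \<longleftrightarrow> (\<forall>i\<ge>n. x i = 0)"
  by (simp add: topspace_Euclidean_space)

lemma Euclidean_space_eq: "Euclidean_space n = top_of_set (coord_space n)"
  by (simp add: Euclidean_space_def euclidean_product_topology)

lemma coord_space_upd: "x \<in> coord_space n \<Longrightarrow> i < n \<Longrightarrow> x(i := t) \<in> coord_space n"
  by (simp add: coord_space_iff)

text \<open>Group operations, isometries and metric coefficients below are polynomial in global coordinates. This class is closed under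
  partial derivatives, so smoothness needs no computation of derivatives.\<close>

inductive polynomial_fun :: "((nat \<Rightarrow> real) \<Rightarrow> real) \<Rightarrow> bool" where
  polynomial_const: "polynomial_fun (\<lambda>x. c)"
| polynomial_coord: "polynomial_fun (\<lambda>x. x i)"
| polynomial_add: "polynomial_fun f \<Longrightarrow> polynomial_fun g \<Longrightarrow> polynomial_fun (\<lambda>x. f x + g x)"
| polynomial_mult: "polynomial_fun f \<Longrightarrow> polynomial_fun g \<Longrightarrow> polynomial_fun (\<lambda>x. f x * g x)"

lemma polynomial_uminus: "polynomial_fun f \<Longrightarrow> polynomial_fun (\<lambda>x. - f x)"
  using polynomial_mult[OF polynomial_const[of "-1"]] by simp

lemma polynomial_diff:
  "polynomial_fun f \<Longrightarrow> polynomial_fun g \<Longrightarrow> polynomial_fun (\<lambda>x. f x - g x)"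
  using polynomial_add[OF _ polynomial_uminus] by simp

lemma polynomial_divide_const: "polynomial_fun f \<Longrightarrow> polynomial_fun (\<lambda>x. f x / c)"
  using polynomial_mult[OF _ polynomial_const[of "1/c"]] by simp

lemma polynomial_power: "polynomial_fun f \<Longrightarrow> polynomial_fun (\<lambda>x. f x ^ k)"
  by (induction k) (auto intro: polynomial_const polynomial_mult)

lemma polynomial_sum:
  "(\<And>i. i \<in> A \<Longrightarrow> polynomial_fun (f i)) \<Longrightarrow> polynomial_fun (\<lambda>x. \<Sum>i\<in>A. f i x)"
  by (induction A rule: infinite_finite_induct) (auto intro: polynomial_const polynomial_add)

lemma polynomial_if:
  "polynomial_fun f \<Longrightarrow> polynomial_fun g \<Longrightarrow> polynomial_fun (\<lambda>x. if P then f x else g x)"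
  by (cases P) simp_all

lemmas polynomial_intros = polynomial_const polynomial_coord polynomial_add polynomial_mult
  polynomial_uminus polynomial_diff polynomial_divide_const polynomial_power polynomial_sum polynomial_if

lemma polynomial_has_partial_deriv:
  assumes "polynomial_fun f"
  shows "\<exists>f'. polynomial_fun f' \<and> (\<forall>x. ((\<lambda>t. f (x(i := t))) has_real_derivative f' x) (at (x i)))"
  using assms
proof induction
  case (polynomial_const c)
  show ?case by (rule exI[of _ "\<lambda>x. 0"]) (auto intro: polynomial_intros)
next
  case (polynomial_coord j)
  show ?case
    by (rule exI[of _ "\<lambda>x. if i = j then 1 else 0"])
      (auto intro!: polynomial_intros derivative_eq_intros)
next
  case (polynomial_add f g)
  then obtain f' g' where "polynomial_fun f'" "polynomial_fun g'"
    "\<And>x. ((\<lambda>t. f (x(i := t))) has_real_derivative f' x) (at (x i))"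
    "\<And>x. ((\<lambda>t. g (x(i := t))) has_real_derivative g' x) (at (x i))" by blast
  then show ?case
    by (intro exI[of _ "\<lambda>x. f' x + g' x"] conjI allI DERIV_add polynomial_fun.polynomial_add) blast+
next
  case (polynomial_mult f g)
  then obtain f' g' where d: "polynomial_fun f'" "polynomial_fun g'"
    "\<And>x. ((\<lambda>t. f (x(i := t))) has_real_derivative f' x) (at (x i))"
    "\<And>x. ((\<lambda>t. g (x(i := t))) has_real_derivative g' x) (at (x i))" by blast
  have "((\<lambda>t. f (x(i := t)) * g (x(i := t))) has_real_derivative f x * g' x + f' x * g x) (at (x i))" for x
    using DERIV_mult'[OF d(3)[of x] d(4)[of x]] by simp
  then show ?case using d(1,2) polynomial_mult.hyps
    by (intro exI[of _ "\<lambda>x. f x * g' x + f' x * g x"] conjI allI polynomial_fun.polynomial_add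
        polynomial_fun.polynomial_mult)
qed

lemma polynomial_partial_deriv:
  assumes "polynomial_fun f"
  shows "polynomial_fun (partial_deriv i f)"
    and "(\<lambda>t. f (x(i := t))) differentiable (at (x i))"
proof -
  obtain f' where f': "polynomial_fun f'"
    "\<And>x. ((\<lambda>t. f (x(i := t))) has_real_derivative f' x) (at (x i))"
    using polynomial_has_partial_deriv[OF assms] by blast
  have "partial_deriv i f = f'"
    unfolding partial_deriv_def using f'(2) by (intro ext DERIV_imp_deriv) auto
  then show "polynomial_fun (partial_deriv i f)" using f'(1) by simp
  show "(\<lambda>t. f (x(i := t))) differentiable (at (x i))"
    using f'(2) real_differentiable_def by blast
qed

lemma polynomial_continuous_on: "polynomial_fun f \<Longrightarrow> continuous_on S f"
proof (induction rule: polynomial_fun.induct)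
  case (polynomial_coord i)
  show ?case by (rule continuous_on_subset[OF continuous_on_product_coordinates]) simp
qed (auto intro: continuous_on_const continuous_on_add continuous_on_mult)

lemma continuous_map_Euclidean_sub:
  "continuous_map (subtopology (Euclidean_space n) S) euclideanreal f
     \<longleftrightarrow> continuous_on (coord_space n \<inter> S) f"
  by (subst Euclidean_space_eq)
    (simp only: subtopology_subtopology continuous_map_iff_continuous)

lemma polynomial_smooth_on:
  assumes "polynomial_fun f" shows "smooth_on n S f"
proof -
  have "Ck_on n S k f" for k
    using assms
  proof (induction k arbitrary: f)
    case 0
    then show ?case by (simp add: continuous_map_Euclidean_sub polynomial_continuous_on)
  next
    case (Suc k)
    then show ?case
      unfolding Ck_on.simps continuous_map_Euclidean_sub
      using polynomial_partial_deriv[OF Suc.prems] polynomial_continuous_on[OF Suc.prems] by blast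
  qed
  then show ?thesis by (simp add: smooth_on_def)
qed

lemma eventually_upd_in_openin:
  assumes "openin (Euclidean_space n) S" "x \<in> S" "i < n"
  shows "eventually (\<lambda>t. x(i := t) \<in> S) (nhds (x i))"
proof -
  obtain T where T: "open T" "S = coord_space n \<inter> T"
    using assms(1) by (subst (asm) Euclidean_space_eq) (auto simp only: openin_open)
  have "continuous_on UNIV (\<lambda>t. x(i := t))"
  proof (rule continuous_on_coordinatewise_then_product)
    fix j show "continuous_on UNIV (\<lambda>t. (x(i := t)) j)" by (cases "j = i") simp_all
  qed
  then have "open ((\<lambda>t. x(i := t)) -` T)"
    using T(1) by (simp add: continuous_on_open_vimage[OF open_UNIV])
  moreover have "x i \<in> (\<lambda>t. x(i := t)) -` T" using T assms by simp
  ultimately have "eventually (\<lambda>t. t \<in> (\<lambda>t. x(i := t)) -` T) (nhds (x i))"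
    by (rule eventually_nhds_in_open)
  moreover have "x(i := t) \<in> coord_space n" for t
    using T(2) assms(2,3) coord_space_upd by blast
  ultimately show ?thesis using T(2) by (auto elim: eventually_mono)
qed

text \<open>Partial derivatives at a point of \<open>S\<close> read \<open>f\<close> along a coordinate line; as \<open>S\<close> is open, the line
  stays in \<open>S\<close> near the point, so the values outside \<open>S\<close>, which are default values of inverse charts, do not matter.\<close>

lemma Ck_on_cong:
  assumes "openin (Euclidean_space n) S" "\<And>x. x \<in> S \<Longrightarrow> f x = g x" "Ck_on n S k f"
  shows "Ck_on n S k g"
  using assms(2,3)
proof (induction k arbitrary: f g)
  case 0
  then show ?case by (auto simp: continuous_map_Euclidean_sub elim: continuous_on_eq)
next
  case (Suc k)
  have ev: "eventually (\<lambda>t. f (x(i := t)) = g (x(i := t))) (nhds (x i))" if "x \<in> S" "i < n" for x i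
    using eventually_upd_in_openin[OF assms(1) that] by (rule eventually_mono) (rule Suc.prems(1))
  have "partial_deriv i f x = partial_deriv i g x" if "x \<in> S" "i < n" for x i
    unfolding partial_deriv_def by (rule deriv_cong_ev[OF ev[OF that] refl])
  moreover have "(\<lambda>t. g (x(i := t))) differentiable (at (x i))" if "x \<in> S" "i < n" for x i
  proof -
    have "(\<lambda>t. f (x(i := t))) differentiable (at (x i))" using Suc.prems(2) that by simp
    then obtain D where "((\<lambda>t. f (x(i := t))) has_real_derivative D) (at (x i))"
      using real_differentiable_def by blast
    then have "((\<lambda>t. g (x(i := t))) has_real_derivative D) (at (x i))"
      using DERIV_cong_ev[OF refl ev[OF that] refl] by blast
    then show ?thesis using real_differentiable_def by blast
  qed
  moreover have "continuous_on (coord_space n \<inter> S) g"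
    using Suc.prems by (auto simp: continuous_map_Euclidean_sub elim: continuous_on_eq)
  moreover have "Ck_on n S k (partial_deriv i g)" if "i < n" for i
    by (rule Suc.IH[of "partial_deriv i f"]) (use calculation(1) Suc.prems(2) that in \<open>auto simp only: Ck_on.simps\<close>)
  ultimately show ?case unfolding Ck_on.simps continuous_map_Euclidean_sub by blast
qed

lemma smooth_on_cong:
  "openin (Euclidean_space n) S \<Longrightarrow> (\<And>x. x \<in> S \<Longrightarrow> f x = g x) \<Longrightarrow> smooth_on n S f \<Longrightarrow> smooth_on n S g"
  unfolding smooth_on_def using Ck_on_cong by blast

lemma polynomial_smooth_on_eq:
  assumes "openin (Euclidean_space n) S" "polynomial_fun P" "\<And>x. x \<in> S \<Longrightarrow> f x = P x"
  shows "smooth_on n S f"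
  using smooth_on_cong[OF assms(1) _ polynomial_smooth_on[OF assms(2)], of f] assms(3) by simp

lemma tendsto_fun_componentwise:
  fixes f :: "'b \<Rightarrow> nat \<Rightarrow> real"
  assumes "\<And>i. ((\<lambda>t. f t i) \<longlongrightarrow> l i) F"
  shows "(f \<longlongrightarrow> l) F"
proof -
  have "limitin (product_topology (\<lambda>i. euclidean) UNIV) f l F"
    using assms by (simp add: limitin_componentwise)
  then show ?thesis by (simp add: euclidean_product_topology)
qed

text \<open>The chain rule along a curve. The increment of \<open>f\<close> is telescoped over the coordinates, and
  the mean value theorem in one coordinate at a time replaces a Frechet derivative, which the
  sequence space does not offer.\<close>

lemma chain_rule_curve:
  assumes C1: "Ck_on n (coord_space n) (Suc 0) f"
    and c: "\<And>t. c t \<in> coord_space n"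
    and c': "\<And>i. i < n \<Longrightarrow> ((\<lambda>t. c t i) has_real_derivative c' i) (at t0)"
  shows "((\<lambda>t. f (c t)) has_real_derivative (\<Sum>i<n. partial_deriv i f (c t0) * c' i)) (at t0)"
proof -
  define a where "a = c t0"
  have a: "a \<in> coord_space n" using c a_def by simp
  have cont: "continuous_on (coord_space n) (partial_deriv i f)" if "i < n" for i
    using C1 that continuous_map_Euclidean_space_iff by auto
  have der: "((\<lambda>t. f (x(i := t))) has_real_derivative partial_deriv i f (x(i := s))) (at s)"
    if "x \<in> coord_space n" "i < n" for x i s
  proof -
    define y where "y = x(i := s)"
    have "y \<in> coord_space n" using coord_space_upd[OF that] y_def by simp
    then have "(\<lambda>t. f (y(i := t))) differentiable (at (y i))"
      using C1 that unfolding Ck_on.simps by blast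
    then have "((\<lambda>t. f (y(i := t))) has_real_derivative partial_deriv i f y) (at (y i))"
      unfolding partial_deriv_def by (simp only: DERIV_deriv_iff_real_differentiable)
    then show ?thesis by (simp add: y_def)
  qed
  \<comment> \<open>\<open>mix k b\<close> has the first \<open>k\<close> coordinates of \<open>b\<close> and the others of \<open>a\<close>: the corners of a path from
  \<open>a\<close> to \<open>b\<close> parallel to the axes.\<close>
  define mix where "mix k b = (\<lambda>i. if i < k then b i else a i)" for k and b :: "nat \<Rightarrow> real"
  have mix_in: "mix k b \<in> coord_space n" if "b \<in> coord_space n" for k b
    using that a by (simp add: mix_def coord_space_iff)
  have mvt: "\<exists>\<xi>. \<bar>\<xi> - a k\<bar> \<le> \<bar>b k - a k\<bar> \<and>
      f (mix (Suc k) b) - f (mix k b) = (b k - a k) * partial_deriv k f ((mix k b)(k := \<xi>))"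
    if "b \<in> coord_space n" "k < n" for b k
  proof -
    have m1: "mix (Suc k) b = (mix k b)(k := b k)" and m0: "mix k b = (mix k b)(k := a k)"
      by (auto simp: mix_def)
    note D = der[OF mix_in[OF that(1)] that(2)]
    consider "a k < b k" | "b k < a k" | "a k = b k" by linarith
    then show ?thesis
    proof cases
      case 1
      from MVT2[OF 1 D] obtain z where "a k < z" "z < b k"
        "f ((mix k b)(k := b k)) - f ((mix k b)(k := a k))
           = (b k - a k) * partial_deriv k f ((mix k b)(k := z))" by blast
      then show ?thesis using m1 m0 by (intro exI[of _ z]) auto
    next
      case 2
      from MVT2[OF 2 D] obtain z where "b k < z" "z < a k"
        "f ((mix k b)(k := a k)) - f ((mix k b)(k := b k))
           = (a k - b k) * partial_deriv k f ((mix k b)(k := z))" by blast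
      then show ?thesis using m1 m0 by (intro exI[of _ z]) (auto simp: algebra_simps)
    next
      case 3
      then show ?thesis using m1 m0 by (intro exI[of _ "a k"]) auto
    qed
  qed
  define \<xi> where "\<xi> b k = (SOME z. \<bar>z - a k\<bar> \<le> \<bar>b k - a k\<bar> \<and>
      f (mix (Suc k) b) - f (mix k b) = (b k - a k) * partial_deriv k f ((mix k b)(k := z)))" for b k
  have \<xi>: "\<bar>\<xi> b k - a k\<bar> \<le> \<bar>b k - a k\<bar>"
    "f (mix (Suc k) b) - f (mix k b) = (b k - a k) * partial_deriv k f ((mix k b)(k := \<xi> b k))"
    if "b \<in> coord_space n" "k < n" for b k
    using someI_ex[OF mvt[OF that]] unfolding \<xi>_def by blast+
  have tel: "f b - f a = (\<Sum>k<n. (b k - a k) * partial_deriv k f ((mix k b)(k := \<xi> b k)))"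
    if "b \<in> coord_space n" for b
  proof -
    have "mix n b = b" using that a by (auto simp: mix_def coord_space_iff)
    moreover have "mix 0 b = a" by (simp add: mix_def)
    moreover have "(\<Sum>k<n. f (mix (Suc k) b) - f (mix k b)) = f (mix n b) - f (mix 0 b)"
      by (rule sum_lessThan_telescope)
    ultimately show ?thesis using \<xi>(2)[OF that] by (metis (no_types, lifting) lessThan_iff sum.cong)
  qed
  have lim_c: "((\<lambda>t. c t i) \<longlongrightarrow> a i) (at t0)" for i
  proof (cases "i < n")
    case True
    then show ?thesis using DERIV_isCont[OF c'] by (simp add: isCont_def a_def)
  next
    case False
    then have "\<And>t. c t i = 0" using c by (simp add: coord_space_iff)
    then show ?thesis by (simp add: a_def)
  qed
  have lim_xi: "((\<lambda>t. \<xi> (c t) k) \<longlongrightarrow> a k) (at t0)" if "k < n" for k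
  proof (rule Lim_transform[of "\<lambda>t. a k", rotated])
    show "((\<lambda>t. \<xi> (c t) k - a k) \<longlongrightarrow> 0) (at t0)"
    proof (rule Lim_null_comparison)
      show "eventually (\<lambda>t. norm (\<xi> (c t) k - a k) \<le> \<bar>c t k - a k\<bar>) (at t0)"
        using \<xi>(1)[OF c that] by simp
      show "((\<lambda>t. \<bar>c t k - a k\<bar>) \<longlongrightarrow> 0) (at t0)"
        using lim_c[of k] by (simp add: LIM_zero tendsto_rabs_zero)
    qed
  qed simp
  have lim_pt: "((\<lambda>t. (mix k (c t))(k := \<xi> (c t) k)) \<longlongrightarrow> a) (at t0)" if "k < n" for k
  proof (rule tendsto_fun_componentwise)
    fix i show "((\<lambda>t. ((mix k (c t))(k := \<xi> (c t) k)) i) \<longlongrightarrow> a i) (at t0)"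
      using lim_c[of i] lim_xi[OF that] by (cases "i = k"; cases "i < k") (simp_all add: mix_def)
  qed
  have lim_d: "((\<lambda>t. partial_deriv k f ((mix k (c t))(k := \<xi> (c t) k))) \<longlongrightarrow> partial_deriv k f a) (at t0)"
    if "k < n" for k
    by (rule continuous_on_tendsto_compose[OF cont[OF that] lim_pt[OF that] a])
      (auto intro!: always_eventually coord_space_upd mix_in c that)
  have "((\<lambda>t. \<Sum>k<n. partial_deriv k f ((mix k (c t))(k := \<xi> (c t) k)) * ((c t k - a k) / (t - t0)))
      \<longlongrightarrow> (\<Sum>k<n. partial_deriv k f a * c' k)) (at t0)"
    using c' lim_d by (intro tendsto_sum tendsto_mult) (auto simp: has_field_derivative_iff a_def)
  moreover have "(\<Sum>k<n. partial_deriv k f ((mix k (c t))(k := \<xi> (c t) k)) * ((c t k - a k) / (t - t0)))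
      = (f (c t) - f (c t0)) / (t - t0)" for t
    unfolding a_def[symmetric] tel[OF c] sum_divide_distrib by (auto intro!: sum.cong)
  ultimately show ?thesis by (simp add: has_field_derivative_iff a_def)
qed

section \<open>Manifolds with a single chart\<close>

abbreviation points :: "'a manifold \<Rightarrow> 'a set" where
  "points M \<equiv> topspace (mtop M)"

definition single_chart :: "'a manifold \<Rightarrow> ('a \<Rightarrow> nat \<Rightarrow> real) \<Rightarrow> bool" where
  "single_chart M \<phi> \<longleftrightarrow> atlas M = {(points M, \<phi>)} \<and>
     openin (Euclidean_space (mdim M)) (\<phi> ` points M) \<and>
     homeomorphic_map (mtop M) (subtopology (Euclidean_space (mdim M)) (\<phi> ` points M)) \<phi>"

lemma single_chart_image_subset: "single_chart M \<phi> \<Longrightarrow> \<phi> ` points M \<subseteq> coord_space (mdim M)"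
  unfolding single_chart_def using openin_subset by blast

lemma single_chart_inj: "single_chart M \<phi> \<Longrightarrow> inj_on \<phi> (points M)"
  unfolding single_chart_def homeomorphic_eq_everything_map by blast

lemma single_chart_inv: "single_chart M \<phi> \<Longrightarrow> p \<in> points M \<Longrightarrow> inv_into (points M) \<phi> (\<phi> p) = p"
  by (simp add: single_chart_inj inv_into_f_f)

lemma continuous_map_coord: "continuous_map (Euclidean_space n) euclideanreal (\<lambda>z. z i)"
  unfolding continuous_map_Euclidean_space_iff
  by (rule continuous_on_subset[OF continuous_on_product_coordinates]) simp

lemma single_chart_continuous:
  assumes "single_chart M \<phi>"
  shows "continuous_map (mtop M) (Euclidean_space (mdim M)) \<phi>"
    and "continuous_map (mtop M) euclideanreal (\<lambda>p. \<phi> p i)"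
proof -
  show 1: "continuous_map (mtop M) (Euclidean_space (mdim M)) \<phi>"
    using assms unfolding single_chart_def homeomorphic_eq_everything_map continuous_map_in_subtopology
    by blast
  show "continuous_map (mtop M) euclideanreal (\<lambda>p. \<phi> p i)"
    using continuous_map_compose[OF 1 continuous_map_coord] by (simp add: o_def)
qed

lemma smooth_map_polynomial:
  assumes M: "single_chart M \<phi>" and M': "single_chart M' \<phi>'"
    and f: "\<And>p. p \<in> points M \<Longrightarrow> f p \<in> points M'"
    and P: "\<And>k. k < mdim M' \<Longrightarrow> polynomial_fun (P k)"
    and eq: "\<And>p k. p \<in> points M \<Longrightarrow> k < mdim M' \<Longrightarrow> \<phi>' (f p) k = P k (\<phi> p)"
  shows "smooth_map M M' f"
proof -
  let ?E' = "Euclidean_space (mdim M')"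
  define g where "g = (\<lambda>p i. if i < mdim M' then P i (\<phi> p) else 0)"
  have "continuous_map (Euclidean_space (mdim M)) euclideanreal (P i)" if "i < mdim M'" for i
    unfolding continuous_map_Euclidean_space_iff by (rule polynomial_continuous_on[OF P[OF that]])
  then have "continuous_map (mtop M) euclideanreal (\<lambda>p. P i (\<phi> p))" if "i < mdim M'" for i
    using continuous_map_compose[OF single_chart_continuous(1)[OF M]] that by (force simp: o_def)
  then have g: "continuous_map (mtop M) ?E' g"
    unfolding g_def continuous_map_componentwise_Euclidean_space by blast
  have gf: "g p = \<phi>' (f p)" if "p \<in> points M" for p
  proof -
    have "\<phi>' (f p) \<in> coord_space (mdim M')" using single_chart_image_subset[OF M'] f[OF that] by blast
    then show ?thesis using eq[OF that] by (auto simp: g_def coord_space_iff)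
  qed
  obtain \<psi> where \<psi>: "homeomorphic_maps (mtop M') (subtopology ?E' (\<phi>' ` points M')) \<phi>' \<psi>"
    using M' unfolding single_chart_def homeomorphic_map_maps by blast
  have "continuous_map (mtop M) (subtopology ?E' (\<phi>' ` points M')) g"
    unfolding continuous_map_in_subtopology using g gf f by auto
  moreover have "continuous_map (subtopology ?E' (\<phi>' ` points M')) (mtop M') \<psi>"
    using \<psi> homeomorphic_maps_def by blast
  ultimately have "continuous_map (mtop M) (mtop M') (\<psi> \<circ> g)" by (rule continuous_map_compose)
  moreover have "(\<psi> \<circ> g) p = f p" if "p \<in> points M" for p
    using \<psi> f[OF that] gf[OF that] by (simp add: homeomorphic_maps_def)
  ultimately have cont: "continuous_map (mtop M) (mtop M') f" by (rule continuous_map_eq)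
  have "\<phi> ` {p \<in> points M. f p \<in> points M'} = \<phi> ` points M" using f by auto
  moreover have "smooth_on (mdim M) (\<phi> ` points M) (\<lambda>x. \<phi>' (f (inv_into (points M) \<phi> x)) k)"
    if "k < mdim M'" for k
    by (rule polynomial_smooth_on_eq[OF _ P[OF that]])
      (use M that eq single_chart_inv[OF M] in \<open>auto simp: single_chart_def\<close>)
  ultimately show ?thesis
    using cont M M' by (simp add: smooth_map_def single_chart_def)
qed

lemma smooth_map_coord:
  assumes M: "single_chart M \<phi>" and M': "single_chart M' \<phi>'" and f: "smooth_map M M' f"
    and k: "k < mdim M'"
  shows "smooth_on (mdim M) (\<phi> ` points M) (\<lambda>x. \<phi>' (f (inv_into (points M) \<phi> x)) k)"
proof -
  have "f ` points M \<subseteq> points M'"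
    using f unfolding smooth_map_def by (blast dest: continuous_map_image_subset_topspace)
  then have "{p \<in> points M. f p \<in> points M'} = points M" by blast
  then show ?thesis using f k M M' by (simp add: smooth_map_def single_chart_def)
qed

lemma second_countable_euclidean_fun: "second_countable (euclidean :: (nat \<Rightarrow> real) topology)"
proof -
  obtain B :: "(nat \<Rightarrow> real) set set" where B: "countable B" "topological_basis B"
    using ex_countable_basis by blast
  have "\<exists>V\<in>B. x \<in> V \<and> V \<subseteq> U" if "open U" "x \<in> U" for U x
    using topological_basisE[OF B(2) that] by metis
  moreover have "open V" if "V \<in> B" for V using topological_basis_open[OF B(2) that] .
  ultimately show ?thesis unfolding second_countable_def using B(1)
    by (intro exI[of _ B]) simp
qed

lemma smooth_manifold_single_chart:
  assumes M: "single_chart M \<phi>" shows "smooth_manifold M"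
proof -
  let ?S = "subtopology (Euclidean_space (mdim M)) (\<phi> ` points M)"
  have hom: "mtop M homeomorphic_space ?S"
    using M homeomorphic_map_imp_homeomorphic_space unfolding single_chart_def by blast
  have "second_countable (Euclidean_space (mdim M))"
    by (subst Euclidean_space_eq) (rule second_countable_subtopology[OF second_countable_euclidean_fun])
  then have "second_countable (mtop M)"
    using homeomorphic_space_second_countability[OF hom] second_countable_subtopology by blast
  moreover have "Hausdorff_space (mtop M)"
    using homeomorphic_Hausdorff_space[OF hom] Hausdorff_space_subtopology Hausdorff_Euclidean_space
    by blast
  moreover have "smooth_on (mdim M) (\<phi> ` points M) (\<lambda>x. \<phi> (inv_into (points M) \<phi> x) k)" for k
    by (rule polynomial_smooth_on_eq[OF _ polynomial_coord])
      (use M single_chart_inv[OF M] in \<open>auto simp: single_chart_def\<close>)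
  ultimately show ?thesis
    using M by (simp add: smooth_manifold_def single_chart_def)
qed

definition chart_pair :: "nat \<Rightarrow> ('a \<Rightarrow> nat \<Rightarrow> real) \<Rightarrow> ('b \<Rightarrow> nat \<Rightarrow> real) \<Rightarrow> 'a \<times> 'b \<Rightarrow> nat \<Rightarrow> real" where
  "chart_pair m \<phi> \<psi> = (\<lambda>(p, q) i. if i < m then \<phi> p i else \<psi> q (i - m))"

lemma chart_pair_image:
  assumes "S \<subseteq> coord_space m" "S' \<subseteq> coord_space m'" "\<phi> ` U = S" "\<psi> ` V = S'"
  shows "chart_pair m \<phi> \<psi> ` (U \<times> V) =
    {z \<in> coord_space (m + m'). (\<lambda>i. if i < m then z i else 0) \<in> S \<and>
       (\<lambda>i. if i < m' then z (i + m) else 0) \<in> S'}" (is "_ = ?W")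
proof (intro equalityI subsetI)
  fix z assume "z \<in> chart_pair m \<phi> \<psi> ` (U \<times> V)"
  then obtain p q where pq: "p \<in> U" "q \<in> V" "z = chart_pair m \<phi> \<psi> (p, q)" by auto
  then have s: "\<phi> p \<in> S" "\<psi> q \<in> S'" "\<phi> p \<in> coord_space m" "\<psi> q \<in> coord_space m'" using assms by auto
  have z: "z i = (if i < m then \<phi> p i else \<psi> q (i - m))" for i by (simp add: pq chart_pair_def)
  have "(if i < m then z i else 0) = \<phi> p i" "(if i < m' then z (i + m) else 0) = \<psi> q i" for i
    using s(3,4) by (simp_all add: z coord_space_iff)
  then have "(\<lambda>i. if i < m then z i else 0) = \<phi> p" "(\<lambda>i. if i < m' then z (i + m) else 0) = \<psi> q"
    by blast+
  moreover have "z \<in> coord_space (m + m')" using s(4) by (simp add: z coord_space_iff)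
  ultimately show "z \<in> ?W" using s by simp
next
  fix z assume z: "z \<in> ?W"
  then have "(\<lambda>i. if i < m then z i else 0) \<in> \<phi> ` U" "(\<lambda>i. if i < m' then z (i + m) else 0) \<in> \<psi> ` V"
    unfolding assms(3,4) by simp_all
  then obtain p q where pq: "p \<in> U" "q \<in> V" "(\<lambda>i. if i < m then z i else 0) = \<phi> p"
    "(\<lambda>i. if i < m' then z (i + m) else 0) = \<psi> q" by (elim imageE) simp
  have "z i = chart_pair m \<phi> \<psi> (p, q) i" for i
  proof (cases "i < m")
    case True
    then show ?thesis using fun_cong[OF pq(3), of i] by (simp add: chart_pair_def)
  next
    case False
    then have "i - m + m = i" "i - m < m' \<longleftrightarrow> i < m + m'" by auto
    then show ?thesis using False z fun_cong[OF pq(4), of "i - m"]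
      by (cases "i < m + m'") (auto simp: chart_pair_def coord_space_iff)
  qed
  then have "z = chart_pair m \<phi> \<psi> (p, q)" by blast
  then show "z \<in> chart_pair m \<phi> \<psi> ` (U \<times> V)" using pq by blast
qed

text \<open>The chart of a product has only concatenated coordinates, so openness of its image and continuity of
  its inverse are checked on the two truncations of a coordinate vector.\<close>

lemma single_chart_prod:
  assumes M: "single_chart M \<phi>" and M': "single_chart M' \<psi>"
  shows "single_chart (prod_manifold M M') (chart_pair (mdim M) \<phi> \<psi>)"
proof -
  let ?m = "mdim M" and ?m' = "mdim M'" and ?U = "points M" and ?V = "points M'"
  let ?E = "Euclidean_space (?m + ?m')" and ?S = "\<phi> ` ?U" and ?S' = "\<psi> ` ?V"
  let ?c = "chart_pair ?m \<phi> \<psi>"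
  define a where "a = (\<lambda>(z::nat\<Rightarrow>real) i. if i < ?m then z i else 0)"
  define b where "b = (\<lambda>(z::nat\<Rightarrow>real) i. if i < ?m' then z (i + ?m) else 0)"
  have img: "?c ` (?U \<times> ?V) = {z \<in> coord_space (?m + ?m'). a z \<in> ?S \<and> b z \<in> ?S'}"
    unfolding a_def b_def
    using chart_pair_image[OF single_chart_image_subset[OF M] single_chart_image_subset[OF M'] refl refl] .
  have ca: "continuous_map ?E (Euclidean_space ?m) a" and cb: "continuous_map ?E (Euclidean_space ?m') b"
    unfolding a_def b_def continuous_map_componentwise_Euclidean_space
    by (auto intro: continuous_map_coord)
  have "openin ?E {z \<in> topspace ?E. a z \<in> ?S}" "openin ?E {z \<in> topspace ?E. b z \<in> ?S'}"
    using openin_continuous_map_preimage[OF ca] openin_continuous_map_preimage[OF cb] M M'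
    unfolding single_chart_def by blast+
  then have "openin ?E ({z \<in> topspace ?E. a z \<in> ?S} \<inter> {z \<in> topspace ?E. b z \<in> ?S'})"
    by (rule openin_Int)
  moreover have "{z \<in> topspace ?E. a z \<in> ?S} \<inter> {z \<in> topspace ?E. b z \<in> ?S'} = ?c ` (?U \<times> ?V)"
    unfolding img by blast
  ultimately have op: "openin ?E (?c ` (?U \<times> ?V))" by simp
  obtain \<phi>i where \<phi>i: "homeomorphic_maps (mtop M) (subtopology (Euclidean_space ?m) ?S) \<phi> \<phi>i"
    using M unfolding single_chart_def homeomorphic_map_maps by blast
  obtain \<psi>i where \<psi>i: "homeomorphic_maps (mtop M') (subtopology (Euclidean_space ?m') ?S') \<psi> \<psi>i"
    using M' unfolding single_chart_def homeomorphic_map_maps by blast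
  let ?P = "prod_topology (mtop M) (mtop M')"
  have "continuous_map ?P ?E (\<lambda>r i. if i < ?m + ?m' then ?c r i else 0)"
    unfolding continuous_map_componentwise_Euclidean_space
  proof (intro allI impI)
    fix i assume "i < ?m + ?m'"
    have "continuous_map ?P euclideanreal (\<lambda>r. \<phi> (fst r) i)"
      "continuous_map ?P euclideanreal (\<lambda>r. \<psi> (snd r) (i - ?m))"
      using continuous_map_compose[OF continuous_map_fst single_chart_continuous(2)[OF M]]
        continuous_map_compose[OF continuous_map_snd single_chart_continuous(2)[OF M']]
      by (simp_all add: o_def)
    then show "continuous_map ?P euclideanreal (\<lambda>r. ?c r i)"
      by (cases "i < ?m") (simp_all add: chart_pair_def case_prod_beta)
  qed
  moreover have "(if i < ?m + ?m' then ?c r i else 0) = ?c r i" if "r \<in> topspace ?P" for r i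
  proof -
    have "?c r \<in> coord_space (?m + ?m')" using that img by auto
    then show ?thesis by (simp add: coord_space_iff)
  qed
  ultimately have "continuous_map ?P ?E ?c" by (auto elim!: continuous_map_eq)
  then have cc: "continuous_map ?P (subtopology ?E (?c ` (?U \<times> ?V))) ?c"
    by (simp add: continuous_map_in_subtopology)
  have "continuous_map (subtopology ?E (?c ` (?U \<times> ?V))) (subtopology (Euclidean_space ?m) ?S) a"
    "continuous_map (subtopology ?E (?c ` (?U \<times> ?V))) (subtopology (Euclidean_space ?m') ?S') b"
    unfolding continuous_map_in_subtopology
    using continuous_map_from_subtopology[OF ca] continuous_map_from_subtopology[OF cb] img by auto
  then have "continuous_map (subtopology ?E (?c ` (?U \<times> ?V))) (mtop M) (\<phi>i \<circ> a)"
    "continuous_map (subtopology ?E (?c ` (?U \<times> ?V))) (mtop M') (\<psi>i \<circ> b)"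
    using \<phi>i \<psi>i continuous_map_compose unfolding homeomorphic_maps_def by blast+
  then have ci: "continuous_map (subtopology ?E (?c ` (?U \<times> ?V))) ?P (\<lambda>z. (\<phi>i (a z), \<psi>i (b z)))"
    by (simp add: continuous_map_pairwise o_def)
  have left: "(\<phi>i (a (?c r)), \<psi>i (b (?c r))) = r" if rP: "r \<in> topspace ?P" for r
  proof -
    obtain p q where r: "r = (p, q)" "p \<in> ?U" "q \<in> ?V" 
      using rP by (cases r) simp
    have "\<phi> p \<in> coord_space ?m" "\<psi> q \<in> coord_space ?m'"
      using single_chart_image_subset[OF M] single_chart_image_subset[OF M'] r by auto
    then have "a (?c r) = \<phi> p" "b (?c r) = \<psi> q"
      by (auto simp: a_def b_def r chart_pair_def coord_space_iff)
    then show ?thesis using \<phi>i \<psi>i r by (simp add: homeomorphic_maps_def)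
  qed
  have right: "?c (\<phi>i (a z), \<psi>i (b z)) = z" if "z \<in> ?c ` (?U \<times> ?V)" for z
    using that left by fastforce
  have "homeomorphic_maps ?P (subtopology ?E (?c ` (?U \<times> ?V))) ?c (\<lambda>z. (\<phi>i (a z), \<psi>i (b z)))"
    unfolding homeomorphic_maps_def using cc ci left right by simp
  then have "homeomorphic_map ?P (subtopology ?E (?c ` (?U \<times> ?V))) ?c"
    using homeomorphic_map_maps by blast
  moreover have "prod_chart ?m (?U, \<phi>) (?V, \<psi>) = (?U \<times> ?V, ?c)"
    unfolding prod_chart_def chart_pair_def fst_conv snd_conv ..
  ultimately show ?thesis using op M M'
    by (simp add: single_chart_def prod_manifold_def)
qed

definition line_coord :: "real \<Rightarrow> nat \<Rightarrow> real" where
  "line_coord = (\<lambda>t i. if i = 0 then t else 0)"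

lemma points_line [simp]: "points (line_manifold I) = I"
  and mdim_line [simp]: "mdim (line_manifold I) = 1"
  by (simp_all add: line_manifold_def)

lemma single_chart_line:
  assumes "open I" shows "single_chart (line_manifold I) line_coord"
proof -
  let ?E = "Euclidean_space 1"
  have img: "line_coord ` I = {z \<in> topspace ?E. z 0 \<in> I}"
  proof (intro equalityI subsetI)
    fix z assume z: "z \<in> {z \<in> topspace ?E. z 0 \<in> I}"
    then have "z = line_coord (z 0)" by (auto simp: line_coord_def coord_space_iff)
    then show "z \<in> line_coord ` I" using z by blast
  qed (auto simp: line_coord_def coord_space_iff)
  have op: "openin ?E (line_coord ` I)"
    unfolding img by (rule openin_continuous_map_preimage[OF continuous_map_coord]) (use assms in simp)
  have "continuous_map (top_of_set I) ?E (\<lambda>t i. if i < 1 then t else 0)"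
    unfolding continuous_map_componentwise_Euclidean_space by simp
  moreover have "(\<lambda>t i. if i < 1 then t else 0) = line_coord" by (auto simp: line_coord_def)
  ultimately have "continuous_map (top_of_set I) ?E line_coord" by simp
  then have c: "continuous_map (top_of_set I) (subtopology ?E (line_coord ` I)) line_coord"
    by (simp add: continuous_map_in_subtopology)
  have "continuous_map (subtopology ?E (line_coord ` I)) euclideanreal (\<lambda>z. z 0)"
    by (rule continuous_map_from_subtopology[OF continuous_map_coord])
  then have ci: "continuous_map (subtopology ?E (line_coord ` I)) (top_of_set I) (\<lambda>z. z 0)"
    unfolding continuous_map_in_subtopology by (auto simp: line_coord_def)
  have "homeomorphic_maps (top_of_set I) (subtopology ?E (line_coord ` I)) line_coord (\<lambda>z. z 0)"
    unfolding homeomorphic_maps_def using c ci by (auto simp: line_coord_def)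
  then have "homeomorphic_map (top_of_set I) (subtopology ?E (line_coord ` I)) line_coord"
    using homeomorphic_map_maps by blast
  then show ?thesis using op by (simp add: single_chart_def line_manifold_def line_coord_def)
qed

text \<open>Smoothness of a curve is stated through the chart of the parameter interval; here it is turned into
  ordinary differentiability, to the second order that the geodesic equation needs.\<close>

lemma smooth_curve_differentiable:
  assumes M: "single_chart M \<phi>" and I: "open I" and \<gamma>: "smooth_curve M I \<gamma>"
    and t: "t \<in> I" and k: "k < mdim M"
  shows "(\<lambda>s. \<phi> (\<gamma> s) k) differentiable (at t)"
    and "deriv (\<lambda>s. \<phi> (\<gamma> s) k) differentiable (at t)"
proof -
  define f where "f = (\<lambda>x. \<phi> (\<gamma> (inv_into I line_coord x)) k)"
  have "smooth_on 1 (line_coord ` I) f"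
    using smooth_map_coord[OF single_chart_line[OF I] M _ k] \<gamma> by (simp add: smooth_curve_def f_def)
  then have C: "Ck_on 1 (line_coord ` I) (Suc (Suc 0)) f" unfolding smooth_on_def by blast
  have upd: "(line_coord t)(0 := s) = line_coord s" and [simp]: "line_coord s 0 = s" for s t
    by (auto simp: line_coord_def)
  have fl: "f (line_coord s) = \<phi> (\<gamma> s) k" if "s \<in> I" for s
    using that single_chart_inv[OF single_chart_line[OF I]] by (simp add: f_def)
  have ev: "eventually (\<lambda>s. s \<in> I) (nhds t)" if "t \<in> I" for t
    using I that eventually_nhds_in_open by blast
  have d1: "(\<lambda>s. f (line_coord s)) differentiable (at t)"
    and d2: "(\<lambda>s. partial_deriv 0 f (line_coord s)) differentiable (at t)" if "t \<in> I" for t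
  proof -
    have "(\<lambda>s. f ((line_coord t)(0 := s))) differentiable (at (line_coord t 0))"
      "(\<lambda>s. partial_deriv 0 f ((line_coord t)(0 := s))) differentiable (at (line_coord t 0))"
      using C that unfolding Ck_on.simps by blast+
    then show "(\<lambda>s. f (line_coord s)) differentiable (at t)"
      "(\<lambda>s. partial_deriv 0 f (line_coord s)) differentiable (at t)"
      unfolding upd by simp_all
  qed
  have e1: "eventually (\<lambda>s. f (line_coord s) = \<phi> (\<gamma> s) k) (nhds t)" if "t \<in> I" for t
    using ev[OF that] by (rule eventually_mono) (rule fl)
  have "partial_deriv 0 f (line_coord t) = deriv (\<lambda>s. \<phi> (\<gamma> s) k) t" if "t \<in> I" for t
    unfolding partial_deriv_def upd by (simp add: deriv_cong_ev[OF e1[OF that] refl])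
  then have e2: "eventually (\<lambda>s. partial_deriv 0 f (line_coord s) = deriv (\<lambda>s. \<phi> (\<gamma> s) k) s) (nhds t)"
    using ev[OF t] by (auto elim: eventually_mono)
  show "(\<lambda>s. \<phi> (\<gamma> s) k) differentiable (at t)" "deriv (\<lambda>s. \<phi> (\<gamma> s) k) differentiable (at t)"
    using d1[OF t] d2[OF t] DERIV_cong_ev[OF refl e1[OF t] refl] DERIV_cong_ev[OF refl e2 refl]
    unfolding real_differentiable_def by blast+
qed

subsection \<open>Global coordinates\<close>

definition global_chart :: "'a manifold \<Rightarrow> ('a \<Rightarrow> nat \<Rightarrow> real) \<Rightarrow> bool" where
  "global_chart M \<phi> \<longleftrightarrow> single_chart M \<phi> \<and> \<phi> ` points M = coord_space (mdim M)"

lemma global_chart_single: "global_chart M \<phi> \<Longrightarrow> single_chart M \<phi>"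
  by (simp add: global_chart_def)

lemma global_chart_in: "global_chart M \<phi> \<Longrightarrow> p \<in> points M \<Longrightarrow> \<phi> p \<in> coord_space (mdim M)"
  by (auto simp: global_chart_def)

lemma global_chart_inv:
  assumes "global_chart M \<phi>" "x \<in> coord_space (mdim M)"
  shows "inv_into (points M) \<phi> x \<in> points M" "\<phi> (inv_into (points M) \<phi> x) = x"
  using assms by (metis global_chart_def inv_into_into, metis global_chart_def f_inv_into_f)

lemma global_chart_eqI:
  "global_chart M \<phi> \<Longrightarrow> p \<in> points M \<Longrightarrow> q \<in> points M \<Longrightarrow> \<phi> p = \<phi> q \<Longrightarrow> p = q"
  by (meson global_chart_single single_chart_inj inj_onD)

lemma global_chart_prod:
  assumes "global_chart M \<phi>" "global_chart M' \<psi>"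
  shows "global_chart (prod_manifold M M') (chart_pair (mdim M) \<phi> \<psi>)"
proof -
  have "chart_pair (mdim M) \<phi> \<psi> ` (points M \<times> points M') = coord_space (mdim M + mdim M')"
    using assms unfolding global_chart_def
    by (subst chart_pair_image[of "coord_space (mdim M)" _ "coord_space (mdim M')"])
      (auto simp: coord_space_iff)
  then show ?thesis
    using assms single_chart_prod unfolding global_chart_def by (force simp: prod_manifold_def)
qed

definition chart_velocity :: "('a \<Rightarrow> nat \<Rightarrow> real) \<Rightarrow> (real \<Rightarrow> 'a) \<Rightarrow> nat \<Rightarrow> real" where
  "chart_velocity \<phi> \<alpha> = (\<lambda>k. deriv (\<lambda>t. \<phi> (\<alpha> t) k) 0)"

lemma coord_line_chart:
  assumes "global_chart M \<phi>" "x \<in> coord_space (mdim M)" "u \<in> coord_space (mdim M)"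
  shows "coord_line (points M, \<phi>) x u s \<in> points M"
    and "\<phi> (coord_line (points M, \<phi>) x u s) = (\<lambda>k. x k + s * u k)"
proof -
  have "(\<lambda>k. x k + s * u k) \<in> coord_space (mdim M)" using assms by (simp add: coord_space_iff)
  then show "coord_line (points M, \<phi>) x u s \<in> points M"
    "\<phi> (coord_line (points M, \<phi>) x u s) = (\<lambda>k. x k + s * u k)"
    using global_chart_inv[OF assms(1)] by (simp_all add: coord_line_def)
qed

lemma coord_line_velocity:
  assumes "global_chart M \<phi>" "x \<in> coord_space (mdim M)" "u \<in> coord_space (mdim M)"
  shows "chart_velocity \<phi> (coord_line (points M, \<phi>) x u) = u"
proof
  fix k
  have "((\<lambda>s. x k + s * u k) has_real_derivative u k) (at 0)"
    by (auto intro!: derivative_eq_intros)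
  then show "chart_velocity \<phi> (coord_line (points M, \<phi>) x u) k = u k"
    unfolding chart_velocity_def coord_line_chart(2)[OF assms] by (rule DERIV_imp_deriv)
qed

lemma coord_line_tangent:
  assumes M: "global_chart M \<phi>" and x: "x \<in> coord_space (mdim M)" and u: "u \<in> coord_space (mdim M)"
    and p: "p \<in> points M" "\<phi> p = x"
  shows "coord_line (points M, \<phi>) x u \<in> tangent_curves M p"
proof -
  note c = coord_line_chart[OF M x u]
  have "coord_line (points M, \<phi>) x u 0 = p"
    by (rule global_chart_eqI[OF M c(1) p(1)]) (simp add: c(2) p(2))
  moreover have "smooth_curve M {-1<..<1} (coord_line (points M, \<phi>) x u)"
    unfolding smooth_curve_def
    by (rule smooth_map_polynomial[OF single_chart_line global_chart_single[OF M],
          where P = "\<lambda>k z. x k + z 0 * u k"])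
      (auto simp: c line_coord_def intro!: polynomial_intros)
  ultimately show ?thesis unfolding tangent_curves_def by (auto intro!: exI[of _ 1])
qed

lemma tangent_curve_differentiable:
  assumes M: "global_chart M \<phi>" and \<alpha>: "\<alpha> \<in> tangent_curves M p" and k: "k < mdim M"
  shows "((\<lambda>t. \<phi> (\<alpha> t) k) has_real_derivative chart_velocity \<phi> \<alpha> k) (at 0)"
    and "eventually (\<lambda>t. \<alpha> t \<in> points M) (nhds 0)"
proof -
  obtain \<epsilon> where e: "\<epsilon> > 0" "smooth_curve M {-\<epsilon><..<\<epsilon>} \<alpha>" using \<alpha> unfolding tangent_curves_def by blast
  have "(\<lambda>t. \<phi> (\<alpha> t) k) differentiable (at 0)"
    by (rule smooth_curve_differentiable(1)[OF global_chart_single[OF M] _ e(2) _ k]) (use e in auto)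
  then show "((\<lambda>t. \<phi> (\<alpha> t) k) has_real_derivative chart_velocity \<phi> \<alpha> k) (at 0)"
    unfolding chart_velocity_def by (simp add: DERIV_deriv_iff_real_differentiable)
  have "\<alpha> ` {-\<epsilon><..<\<epsilon>} \<subseteq> points M"
    using e(2) continuous_map_image_subset_topspace
    unfolding smooth_curve_def smooth_map_def by force
  moreover have "eventually (\<lambda>t. t \<in> {-\<epsilon><..<\<epsilon>}) (nhds (0::real))"
    using e by (intro eventually_nhds_in_open) auto
  ultimately show "eventually (\<lambda>t. \<alpha> t \<in> points M) (nhds 0)"
    by (auto elim!: eventually_mono)
qed

lemma unit_coord_in: "i < n \<Longrightarrow> unit_coord i \<in> coord_space n"
  by (auto simp: unit_coord_def coord_space_iff)

text \<open>An explicit polynomial inverse saves all arguments about inverse functions.\<close>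

lemma isometryI:
  assumes M: "global_chart M \<phi>"
    and F: "\<And>p. p \<in> points M \<Longrightarrow> F p \<in> points M \<and> F' p \<in> points M \<and> F' (F p) = p \<and> F (F' p) = p"
    and P: "\<And>k. k < mdim M \<Longrightarrow> polynomial_fun (P k)" "\<And>k. k < mdim M \<Longrightarrow> polynomial_fun (P' k)"
    and FP: "\<And>p k. p \<in> points M \<Longrightarrow> k < mdim M \<Longrightarrow> \<phi> (F p) k = P k (\<phi> p)"
      "\<And>p k. p \<in> points M \<Longrightarrow> k < mdim M \<Longrightarrow> \<phi> (F' p) k = P' k (\<phi> p)"
    and g: "\<And>p \<alpha> \<beta>. p \<in> points M \<Longrightarrow> \<alpha> \<in> tangent_curves M p \<Longrightarrow> \<beta> \<in> tangent_curves M p \<Longrightarrow>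
      g (F \<circ> \<alpha>) (F \<circ> \<beta>) = g \<alpha> \<beta>"
  shows "isometry M g F"
proof -
  have bij: "bij_betw F (points M) (points M)" by (rule bij_betw_byWitness[of _ F']) (use F in auto)
  have inv: "inv_into (points M) F p = F' p" if "p \<in> points M" for p
    using F[OF that] bij by (metis bij_betw_imp_inj_on inv_into_f_f)
  note S = global_chart_single[OF M]
  have "smooth_map M M F" by (rule smooth_map_polynomial[OF S S _ P(1) FP(1)]) (use F in auto)
  moreover have "smooth_map M M (inv_into (points M) F)"
    by (rule smooth_map_polynomial[OF S S _ P(2)]) (use F inv FP(2) in auto)
  ultimately show ?thesis using bij g unfolding isometry_def by blast
qed

lemma lie_groupI:
  assumes M: "global_chart M \<phi>" and N: "group N" "carrier N = points M"
    and P: "\<And>k. k < mdim M \<Longrightarrow> polynomial_fun (P k)"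
      "\<And>x y k. x \<in> points M \<Longrightarrow> y \<in> points M \<Longrightarrow> k < mdim M \<Longrightarrow>
        \<phi> (x \<otimes>\<^bsub>N\<^esub> y) k = P k (chart_pair (mdim M) \<phi> \<phi> (x, y))"
    and Q: "\<And>k. k < mdim M \<Longrightarrow> polynomial_fun (Q k)"
      "\<And>x k. x \<in> points M \<Longrightarrow> k < mdim M \<Longrightarrow> \<phi> (inv\<^bsub>N\<^esub> x) k = Q k (\<phi> x)"
  shows "lie_group N M"
proof -
  interpret group N by fact
  note S = global_chart_single[OF M]
  have pts: "points (prod_manifold M M) = points M \<times> points M" by (simp add: prod_manifold_def)
  have "smooth_map (prod_manifold M M) M (\<lambda>(x, y). x \<otimes>\<^bsub>N\<^esub> y)"
    by (rule smooth_map_polynomial[OF single_chart_prod[OF S S] S _ P(1)])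
      (use N(2) m_closed P(2) in \<open>auto simp: pts\<close>)
  moreover have "smooth_map M M (\<lambda>x. inv\<^bsub>N\<^esub> x)"
    by (rule smooth_map_polynomial[OF S S _ Q(1)]) (use N(2) inv_closed Q(2) in auto)
  ultimately show ?thesis
    using N smooth_manifold_single_chart[OF S] unfolding lie_group_def by blast
qed

lemma connected_global_chart: "global_chart M \<phi> \<Longrightarrow> connected_space (mtop M)"
  unfolding global_chart_def single_chart_def
  using homeomorphic_map_imp_homeomorphic_space homeomorphic_connected_space connected_Euclidean_space
  by (metis subtopology_topspace)

lemma metric_comp_global:
  assumes M: "global_chart M \<phi>"
    and g: "\<And>\<alpha> \<beta>. \<alpha> 0 \<in> points M \<Longrightarrow> g \<alpha> \<beta> = \<Gamma> (\<phi> (\<alpha> 0)) (chart_velocity \<phi> \<alpha>) (chart_velocity \<phi> \<beta>)"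
    and x: "x \<in> coord_space (mdim M)" and ij: "i < mdim M" "j < mdim M"
  shows "metric_comp g (points M, \<phi>) i j x = \<Gamma> x (unit_coord i) (unit_coord j)"
  unfolding metric_comp_def
  using g coord_line_chart[OF M x unit_coord_in[OF ij(1)]]
    coord_line_velocity[OF M x unit_coord_in[OF ij(1)]] coord_line_velocity[OF M x unit_coord_in[OF ij(2)]]
  by simp

text \<open>In a global chart a metric is a family \<open>\<Gamma>\<close> of bilinear forms on \<open>\<real>\<^sup>n\<close>, evaluated at velocities.\<close>

lemma pseudo_riemannian_metricI:
  assumes M: "global_chart M \<phi>"
    and g: "\<And>\<alpha> \<beta>. \<alpha> 0 \<in> points M \<Longrightarrow> g \<alpha> \<beta> = \<Gamma> (\<phi> (\<alpha> 0)) (chart_velocity \<phi> \<alpha>) (chart_velocity \<phi> \<beta>)"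
    and bil: "\<And>x u v. x \<in> coord_space (mdim M) \<Longrightarrow>
      \<Gamma> x u v = (\<Sum>i<mdim M. \<Sum>j<mdim M. \<Gamma> x (unit_coord i) (unit_coord j) * u i * v j)"
    and poly: "\<And>i j. polynomial_fun (\<lambda>x. \<Gamma> x (unit_coord i) (unit_coord j))"
    and sym: "\<And>x u v. \<Gamma> x u v = \<Gamma> x v u"
    and nondeg: "\<And>x u. x \<in> coord_space (mdim M) \<Longrightarrow> u \<in> coord_space (mdim M) \<Longrightarrow>
      (\<And>v. v \<in> coord_space (mdim M) \<Longrightarrow> \<Gamma> x u v = 0) \<Longrightarrow> u = (\<lambda>_. 0)"
  shows "pseudo_riemannian_metric M g"
proof -
  have mc: "metric_comp g (points M, \<phi>) i j x = \<Gamma> x (unit_coord i) (unit_coord j)"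
    if "x \<in> coord_space (mdim M)" "i < mdim M" "j < mdim M" for x i j
    by (rule metric_comp_global[of M \<phi> g \<Gamma>]) (use M g that in auto)
  have S: "\<phi> ` points M = coord_space (mdim M)" and A: "atlas M = {(points M, \<phi>)}"
    using M by (auto simp: global_chart_def single_chart_def)
  have sum: "(\<Sum>i<mdim M. \<Sum>j<mdim M. metric_comp g (points M, \<phi>) i j x * u i * v j) = \<Gamma> x u v"
    if "x \<in> coord_space (mdim M)" for x u v
    unfolding bil[OF that, of u v] by (intro sum.cong) (simp_all add: mc that)
  have r1: "smooth_on (mdim M) (coord_space (mdim M)) (metric_comp g (points M, \<phi>) i j)"
    if "i < mdim M" "j < mdim M" for i j
    by (rule polynomial_smooth_on_eq[OF _ poly]) (use that mc in auto)
  have r2: "g \<alpha> \<beta> = (\<Sum>i<mdim M. \<Sum>j<mdim M. metric_comp g (points M, \<phi>) i j (\<phi> p) *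
       deriv (\<lambda>t. \<phi> (\<alpha> t) i) 0 * deriv (\<lambda>t. \<phi> (\<beta> t) j) 0)"
    if "p \<in> points M" "\<alpha> \<in> tangent_curves M p" for p \<alpha> \<beta>
    using that sum[OF global_chart_in[OF M that(1)], of "chart_velocity \<phi> \<alpha>" "chart_velocity \<phi> \<beta>"] g
    by (simp add: tangent_curves_def chart_velocity_def)
  have r3: "metric_comp g (points M, \<phi>) i j x = metric_comp g (points M, \<phi>) j i x"
    if "x \<in> coord_space (mdim M)" "i < mdim M" "j < mdim M" for x i j
    using mc that sym by simp
  have r4: "u = (\<lambda>_. 0)" if "x \<in> coord_space (mdim M)" "u \<in> coord_space (mdim M)"
      "\<forall>v\<in>coord_space (mdim M).
        (\<Sum>i<mdim M. \<Sum>j<mdim M. metric_comp g (points M, \<phi>) i j x * u i * v j) = 0" for x u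
    using nondeg[OF that(1,2)] that(3) unfolding sum[OF that(1)] by blast
  show ?thesis
    unfolding pseudo_riemannian_metric_def A
    by (intro ballI, elim singletonE) (simp only: prod.case S, intro conjI ballI allI impI; (rule r1 r2 r3 r4; assumption))
qed

section \<open>Vectors, matrices and exponentials of nilpotent matrices\<close>

type_synonym vec = "nat \<Rightarrow> real"

text \<open>Vectors are sequences, which carry the pointwise group structure of function spaces but no
  scalar multiplication. The scalar product \<open>ip m\<close> and the matrix action \<open>ap m\<close> read only the first \<open>m\<close>
  coordinates, so the dimension stays an ordinary number.\<close>

definition scl :: "real \<Rightarrow> vec \<Rightarrow> vec" where
  "scl c v = (\<lambda>i. c * v i)"

lemma scl_apply [simp]: "scl c v i = c * v i" by (simp add: scl_def)

lemma scl_simps [simp]: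
  "scl 0 v = 0" "scl 1 v = v" "scl c 0 = 0" "scl c (scl d v) = scl (c * d) v"
  "scl (- c) v = - scl c v" "scl c (- v) = - scl c v"
  by (auto simp: scl_def fun_eq_iff)

lemma scl_add: "scl c (v + w) = scl c v + scl c w" "scl (c + d) v = scl c v + scl d v"
  "scl c (v - w) = scl c v - scl c w" "scl (c - d) v = scl c v - scl d v"
  by (auto simp: fun_eq_iff algebra_simps)

definition ip :: "nat \<Rightarrow> vec \<Rightarrow> vec \<Rightarrow> real" where
  "ip m v w = (\<Sum>i<m. v i * w i)"

definition ap :: "nat \<Rightarrow> (nat \<Rightarrow> nat \<Rightarrow> real) \<Rightarrow> vec \<Rightarrow> vec" where
  "ap m A v = (\<lambda>i. \<Sum>j<m. A i j * v j)"

lemma ip_add [simp]: "ip m (u + v) w = ip m u w + ip m v w" "ip m w (u + v) = ip m w u + ip m w v"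
  by (simp_all add: ip_def distrib_left distrib_right sum.distrib)

lemma ip_diff [simp]: "ip m (u - v) w = ip m u w - ip m v w" "ip m w (u - v) = ip m w u - ip m w v"
  by (simp_all add: ip_def left_diff_distrib right_diff_distrib sum_subtractf)

lemma ip_uminus [simp]: "ip m (- u) w = - ip m u w" "ip m w (- u) = - ip m w u"
  by (simp_all add: ip_def sum_negf)

lemma ip_scl [simp]: "ip m (scl c u) w = c * ip m u w" "ip m w (scl c u) = c * ip m w u"
  by (simp_all add: ip_def sum_distrib_left mult_ac)

lemma ip_zero [simp]: "ip m 0 w = 0" "ip m w 0 = 0"
  by (simp_all add: ip_def)

lemma ip_commute: "ip m v w = ip m w v"
  by (simp add: ip_def mult.commute)

lemma ap_add [simp]: "ap m A (u + v) = ap m A u + ap m A v"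
  by (simp add: ap_def fun_eq_iff distrib_left sum.distrib)

lemma ap_diff [simp]: "ap m A (u - v) = ap m A u - ap m A v"
  by (simp add: ap_def fun_eq_iff right_diff_distrib sum_subtractf)

lemma ap_uminus [simp]: "ap m A (- u) = - ap m A u"
  by (simp add: ap_def fun_eq_iff sum_negf)

lemma ap_scl [simp]: "ap m A (scl c u) = scl c (ap m A u)"
  by (simp add: ap_def fun_eq_iff sum_distrib_left mult_ac)

lemma ap_zero [simp]: "ap m A 0 = 0"
  by (simp add: ap_def fun_eq_iff)

lemma ip_transpose: "ip m (ap m A v) w = ip m v (ap m (\<lambda>i j. A j i) w)"
proof -
  have "ip m (ap m A v) w = (\<Sum>i<m. \<Sum>j<m. A i j * v j * w i)"
    by (simp add: ip_def ap_def sum_distrib_right)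
  also have "\<dots> = (\<Sum>j<m. \<Sum>i<m. A i j * v j * w i)" by (rule sum.swap)
  also have "\<dots> = ip m v (ap m (\<lambda>i j. A j i) w)"
    by (simp add: ip_def ap_def sum_distrib_left mult_ac)
  finally show ?thesis .
qed

lemma ip_unit: "k < m \<Longrightarrow> ip m v (unit_coord k) = v k"
proof -
  assume "k < m"
  then have "(\<Sum>i<m. v i * unit_coord k i) = (\<Sum>i<m. if i = k then v i else 0)"
    by (intro sum.cong) (auto simp: unit_coord_def)
  then show ?thesis using \<open>k < m\<close> by (simp add: ip_def)
qed

lemma vec_eq_ipI:
  assumes "v \<in> coord_space m" "w \<in> coord_space m" "\<And>u. u \<in> coord_space m \<Longrightarrow> ip m v u = ip m w u"
  shows "v = w"
proof
  fix k
  show "v k = w k"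
  proof (cases "k < m")
    case True
    then show ?thesis using assms(3)[OF unit_coord_in] by (simp add: ip_unit)
  qed (use assms in \<open>simp add: coord_space_iff\<close>)
qed

lemma ip_self_zero: "v \<in> coord_space m \<Longrightarrow> ip m v v = 0 \<Longrightarrow> v = 0"
proof
  fix i assume v: "v \<in> coord_space m" "ip m v v = 0"
  then have "\<forall>i\<in>{..<m}. v i * v i = 0"
    unfolding ip_def by (subst (asm) sum_nonneg_eq_0_iff) auto
  then show "v i = 0 i" using v(1) by (cases "i < m") (auto simp: coord_space_iff)
qed

text \<open>On sequences, linearity alone does not give an expansion in unit vectors; \<open>dep\<close> confines the
  functional to finitely many coordinates.\<close>

lemma linear_functional_expand:
  fixes f :: "vec \<Rightarrow> real"
  assumes add: "\<And>u v. f (u + v) = f u + f v" and scl: "\<And>c v. f (scl c v) = c * f v"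
    and dep: "\<And>u. f u = f (\<lambda>i. if i < n then u i else 0)"
  shows "f u = (\<Sum>i<n. u i * f (unit_coord i))"
proof -
  have "f (\<lambda>i. if i < k then u i else 0) = (\<Sum>i<k. u i * f (unit_coord i))" for k
  proof (induction k)
    case 0
    show ?case using scl[of 0 0] by (simp add: zero_fun_def)
  next
    case (Suc k)
    have "(\<lambda>i. if i < Suc k then u i else 0) = (\<lambda>i. if i < k then u i else 0) + scl (u k) (unit_coord k)"
      by (auto simp: fun_eq_iff unit_coord_def less_Suc_eq)
    then show ?case using Suc by (simp add: add scl)
  qed
  then show ?thesis using dep by metis
qed

subsection \<open>Differentiation and polynomiality of vector functions\<close>

text \<open>Derivatives of vector functions are taken coordinatewise: the space of sequences is not normed.\<close>

definition vder :: "(real \<Rightarrow> vec) \<Rightarrow> vec \<Rightarrow> real \<Rightarrow> bool" where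
  "vder f f' t \<longleftrightarrow> (\<forall>i. ((\<lambda>s. f s i) has_real_derivative f' i) (at t))"

lemma vder_const: "vder (\<lambda>s. c) 0 t" by (simp add: vder_def)

lemma vder_add: "vder f f' t \<Longrightarrow> vder g g' t \<Longrightarrow> vder (\<lambda>s. f s + g s) (f' + g') t"
  by (auto simp: vder_def intro!: DERIV_add)

lemma vder_diff: "vder f f' t \<Longrightarrow> vder g g' t \<Longrightarrow> vder (\<lambda>s. f s - g s) (f' - g') t"
  by (auto simp: vder_def intro!: DERIV_diff)

lemma vder_scl: "(c has_real_derivative c') (at t) \<Longrightarrow> vder f f' t \<Longrightarrow>
    vder (\<lambda>s. scl (c s) (f s)) (scl c' (f t) + scl (c t) f') t"
  by (auto simp: vder_def intro!: derivative_eq_intros)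

lemma vder_ap: "vder f f' t \<Longrightarrow> vder (\<lambda>s. ap m A (f s)) (ap m A f') t"
  by (auto simp: vder_def ap_def mult.commute intro!: derivative_eq_intros)

lemma vder_ip: "vder f f' t \<Longrightarrow> vder g g' t \<Longrightarrow>
    ((\<lambda>s. ip m (f s) (g s)) has_real_derivative ip m f' (g t) + ip m (f t) g') (at t)"
  unfolding vder_def ip_def
  by (rule derivative_eq_intros refl | blast)+ (simp add: sum.distrib mult_ac)

lemma vder_cong_eq: "vder f f' t \<Longrightarrow> f' = g' \<Longrightarrow> vder f g' t" by simp

lemma vder_chain:
  assumes "vder f f' (c t)" "(c has_real_derivative c') (at t)"
  shows "vder (\<lambda>s. f (c s)) (scl c' f') t"
  unfolding vder_def scl_apply
proof
  fix i
  have "((\<lambda>s. f s i) has_real_derivative f' i) (at (c t))" using assms(1) by (simp add: vder_def)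
  from DERIV_chain2[OF this assms(2)]
  show "((\<lambda>s. f (c s) i) has_real_derivative c' * f' i) (at t)" by (simp add: mult.commute)
qed

definition vpoly :: "(vec \<Rightarrow> vec) \<Rightarrow> bool" where
  "vpoly f \<longleftrightarrow> (\<forall>i. polynomial_fun (\<lambda>z. f z i))"

lemma vpoly_const: "vpoly (\<lambda>z. c)" and vpoly_id: "vpoly (\<lambda>z. z)"
  by (auto simp: vpoly_def intro: polynomial_intros)

lemma vpoly_add: "vpoly f \<Longrightarrow> vpoly g \<Longrightarrow> vpoly (\<lambda>z. f z + g z)"
  and vpoly_diff: "vpoly f \<Longrightarrow> vpoly g \<Longrightarrow> vpoly (\<lambda>z. f z - g z)"
  and vpoly_uminus: "vpoly f \<Longrightarrow> vpoly (\<lambda>z. - f z)"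
  and vpoly_scl: "polynomial_fun c \<Longrightarrow> vpoly f \<Longrightarrow> vpoly (\<lambda>z. scl (c z) (f z))"
  and vpoly_ap: "vpoly f \<Longrightarrow> vpoly (\<lambda>z. ap m A (f z))"
  by (auto simp: vpoly_def ap_def intro!: polynomial_intros)

lemma polynomial_ip: "vpoly f \<Longrightarrow> vpoly g \<Longrightarrow> polynomial_fun (\<lambda>z. ip m (f z) (g z))"
  by (auto simp: vpoly_def ip_def intro!: polynomial_intros)

lemmas vpoly_intros = vpoly_const vpoly_id vpoly_add vpoly_diff vpoly_uminus vpoly_scl vpoly_ap

subsection \<open>The data of the construction\<close>

text \<open>The matrices of \<open>D\<close> and \<open>J\<close> on \<open>V = \<real>\<^sup>m\<close>. The assumption \<open>JD\<close> is the Jacobi identity, \<open>SS\<close> says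
  \<open>S\<^sup>2 = 0\<close> for \<open>S = J + D\<^sup>T\<close>, which provides enough isometries, and \<open>D_nil\<close> makes the Lie algebra
  nilpotent. The bound \<open>r\<close> on the nilpotency index truncates exponential series.\<close>

locale nil_data =
  fixes m :: nat and Dm Jm :: "nat \<Rightarrow> nat \<Rightarrow> real" and r :: nat
  assumes Dm_zero: "\<And>i j. m \<le> i \<Longrightarrow> Dm i j = 0" "\<And>i j. m \<le> j \<Longrightarrow> Dm i j = 0"
    and Jm_zero: "\<And>i j. m \<le> i \<Longrightarrow> Jm i j = 0"
    and Jm_skew: "\<And>i j. Jm i j = - Jm j i"
    and JD: "\<And>v. ap m Jm (ap m Dm v) = - ap m (\<lambda>i j. Dm j i) (ap m Jm v)"
    and SS: "\<And>v w. w = ap m Jm v + ap m (\<lambda>i j. Dm j i) v \<Longrightarrow> ap m Jm w + ap m (\<lambda>i j. Dm j i) w = 0"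
    and D_nil: "\<And>v. (ap m Dm ^^ r) v = 0"
begin

abbreviation inner :: "vec \<Rightarrow> vec \<Rightarrow> real" (infix "\<cdot>" 70) where "v \<cdot> w \<equiv> ip m v w"
abbreviation D :: "vec \<Rightarrow> vec" where "D \<equiv> ap m Dm"
abbreviation J :: "vec \<Rightarrow> vec" where "J \<equiv> ap m Jm"
abbreviation Dt :: "vec \<Rightarrow> vec" where "Dt \<equiv> ap m (\<lambda>i j. Dm j i)"

definition S :: "vec \<Rightarrow> vec" where "S v = J v + Dt v"

lemma S_linear [simp]: "S (u + v) = S u + S v" "S (u - v) = S u - S v" "S (scl c v) = scl c (S v)"
    "S (- v) = - S v" "S 0 = 0"
  by (simp_all add: S_def scl_add)

lemma S_S [simp]: "S (S v) = 0"
  using SS[OF S_def] by (simp add: S_def)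

lemma in_space [simp]: "D v \<in> coord_space m" "J v \<in> coord_space m" "Dt v \<in> coord_space m" "S v \<in> coord_space m"
  by (auto simp: coord_space_iff ap_def Dm_zero Jm_zero S_def)

lemma D_adj: "D v \<cdot> w = v \<cdot> Dt w" by (rule ip_transpose)

lemma J_skew: "J v \<cdot> w = - (J w \<cdot> v)"
proof -
  have 1: "(\<lambda>i j. Jm j i) = (\<lambda>i j. - Jm i j)" using Jm_skew by (intro ext)
  have "ap m (\<lambda>i j. - Jm i j) w = - J w"
    by (simp add: ap_def fun_eq_iff sum_negf)
  then show ?thesis unfolding ip_transpose[of m Jm v w] 1 by (simp add: ip_commute)
qed

lemma J_self [simp]: "J v \<cdot> v = 0" using J_skew[of v v] by simp

lemma J_D: "J (D v) = - Dt (J v)" by (rule JD)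

text \<open>Equivalently, the derivation \<open>D\<close> annihilates the two-form \<open>\<langle>J v, w\<rangle>\<close>, so its exponential preserves it.\<close>

lemma JD_ip: "J (D v) \<cdot> w = - (J v \<cdot> D w)"
  by (simp add: J_D) (metis D_adj ip_commute)

lemma r_pos: "0 < r"
proof (rule ccontr)
  assume "\<not> 0 < r"
  then show False using fun_cong[OF D_nil[of "\<lambda>_. 1"], of 0] by simp
qed

subsection \<open>The exponential of \<open>-x D\<close> and its iterated integrals\<close>

text \<open>\<open>ex 0 x = exp (- x D)\<close>, a finite sum as \<open>D\<close> is nilpotent, and \<open>ex (j + 1)\<close> is the integral of \<open>ex j\<close> from
  \<open>0\<close> to \<open>x\<close>. The integrals solve the inhomogeneous equations \<open>h' = a x\<^sup>j / j! - D h\<close>; they replace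
  \<open>(1 - exp (- x D)) / D\<close> and its analogues, which make no sense because \<open>D\<close> is not invertible.\<close>

definition ex :: "nat \<Rightarrow> real \<Rightarrow> vec \<Rightarrow> vec" where
  "ex j x v = (\<lambda>i. \<Sum>k<r. (-1) ^ k * (x ^ (k + j) / fact (k + j)) * (D ^^ k) v i)"

abbreviation E :: "real \<Rightarrow> vec \<Rightarrow> vec" where "E \<equiv> ex 0"

lemma Dpow_linear: "(D ^^ k) (u + v) = (D ^^ k) u + (D ^^ k) v" "(D ^^ k) (u - v) = (D ^^ k) u - (D ^^ k) v"
    "(D ^^ k) (scl c v) = scl c ((D ^^ k) v)" "(D ^^ k) (- v) = - (D ^^ k) v" "(D ^^ k) 0 = 0"
  by (induction k) simp_all

lemma ex_linear [simp]: "ex j x (u + v) = ex j x u + ex j x v" "ex j x (u - v) = ex j x u - ex j x v"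
    "ex j x (scl c v) = scl c (ex j x v)" "ex j x (- v) = - ex j x v" "ex j x 0 = 0"
  by (simp_all add: ex_def fun_eq_iff Dpow_linear sum.distrib sum_subtractf sum_negf sum_distrib_left
      distrib_left right_diff_distrib add_divide_distrib diff_divide_distrib mult_ac)

lemma Dpow_in: "v \<in> coord_space m \<Longrightarrow> (D ^^ k) v \<in> coord_space m"
  by (cases k) simp_all

lemma ex_in [simp]: "v \<in> coord_space m \<Longrightarrow> ex j x v \<in> coord_space m"
  using Dpow_in by (simp add: ex_def coord_space_iff)

lemma D_ex: "D (ex j x v) = (\<lambda>i. \<Sum>k<r. (-1) ^ k * (x ^ (k + j) / fact (k + j)) * (D ^^ Suc k) v i)"
proof
  fix i
  have "D (ex j x v) i = (\<Sum>a<m. \<Sum>k<r. (-1) ^ k * (x ^ (k + j) / fact (k + j)) * (Dm i a * (D ^^ k) v a))"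
    by (simp add: ap_def ex_def sum_distrib_left mult_ac)
  also have "\<dots> = (\<Sum>k<r. \<Sum>a<m. (-1) ^ k * (x ^ (k + j) / fact (k + j)) * (Dm i a * (D ^^ k) v a))"
    by (rule sum.swap)
  finally show "D (ex j x v) i = (\<Sum>k<r. (-1) ^ k * (x ^ (k + j) / fact (k + j)) * (D ^^ Suc k) v i)"
    by (simp add: ap_def sum_distrib_left)
qed

text \<open>Applying \<open>D\<close> moves the series by one index; only the term with the lowest power of \<open>x\<close> is lost.\<close>

lemma D_ex_Suc: "D (ex (Suc j) x v) = scl (x ^ j / fact j) v - ex j x v"
proof
  fix i
  define f where "f k = (-1) ^ k * (x ^ (k + j) / fact (k + j)) * (D ^^ k) v i" for k
  have "D (ex (Suc j) x v) i = (\<Sum>k<r. - f (Suc k))"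
    by (simp add: D_ex f_def sum_negf)
  also have "\<dots> = f 0 - (\<Sum>k<Suc r. f k)"
    by (subst sum.lessThan_Suc_shift) (simp add: sum_negf)
  also have "\<dots> = f 0 - (\<Sum>k<r. f k)" by (simp add: f_def D_nil)
  finally show "D (ex (Suc j) x v) i = (scl (x ^ j / fact j) v - ex j x v) i"
    by (simp add: f_def ex_def)
qed

lemma D_ex1: "D (ex (Suc 0) x v) = v - E x v"
  using D_ex_Suc[of 0 x v] by simp

lemma Dpow_Suc: "(D ^^ Suc k) v = D ((D ^^ k) v)" "(D ^^ Suc k) v = (D ^^ k) (D v)"
  by (simp, metis funpow_Suc_right o_apply)

lemma E_D: "ex j x (D v) = D (ex j x v)"
  unfolding D_ex by (simp only: ex_def Dpow_Suc(2))

lemma ex_0: "E 0 v = v" "ex (Suc j) 0 v = 0"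
proof -
  have "E 0 v i = (\<Sum>k<r. if k = 0 then v i else 0)" for i
    unfolding ex_def by (rule sum.cong) auto
  then show "E 0 v = v" using r_pos by (simp add: fun_eq_iff)
  show "ex (Suc j) 0 v = 0" by (simp add: ex_def fun_eq_iff)
qed

lemma power_fact_deriv:
  "((\<lambda>x::real. x ^ n / fact n) has_real_derivative (if n = 0 then 0 else x ^ (n - 1) / fact (n - 1))) (at x)"
proof (cases n)
  case (Suc k)
  have "((\<lambda>x::real. x ^ n / fact n) has_real_derivative (real n * x ^ (n - 1)) / fact n) (at x)"
    using DERIV_cdivide[OF DERIV_pow[of n x]] by simp
  then show ?thesis by (simp add: Suc fact_Suc del: of_nat_Suc)
qed simp

lemma ex_deriv_term:
  assumes x: "(x has_real_derivative x') (at t)" and v: "vder v v' t"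
  shows "((\<lambda>s. ex j (x s) (v s) i) has_real_derivative
     (\<Sum>k<r. (-1) ^ k * (if k + j = 0 then 0 else x t ^ (k + j - 1) / fact (k + j - 1)) * (D ^^ k) (v t) i) * x'
       + ex j (x t) v' i) (at t)"
proof -
  have Dv: "vder (\<lambda>s. (D ^^ k) (v s)) ((D ^^ k) v') t" for k
    using v by (induction k) (auto intro: vder_ap)
  have *: "((\<lambda>s. (-1) ^ k * (x s ^ (k + j) / fact (k + j)) * (D ^^ k) (v s) i) has_real_derivative
     ((-1) ^ k * (if k + j = 0 then 0 else x t ^ (k + j - 1) / fact (k + j - 1)) * (D ^^ k) (v t) i) * x'
       + (-1) ^ k * (x t ^ (k + j) / fact (k + j)) * (D ^^ k) v' i) (at t)" for k
  proof -
    note 1 = DERIV_chain2[OF power_fact_deriv x, of "k + j"]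
    have 2: "((\<lambda>s. (D ^^ k) (v s) i) has_real_derivative (D ^^ k) v' i) (at t)" using Dv unfolding vder_def by blast
    show ?thesis
      unfolding mult.assoc
      by (rule DERIV_cong[OF DERIV_cmult[OF DERIV_mult[OF 1 2], of "(-1) ^ k", unfolded mult.assoc]])
        (simp add: algebra_simps)
  qed
  have "((\<lambda>s. \<Sum>k<r. (-1) ^ k * (x s ^ (k + j) / fact (k + j)) * (D ^^ k) (v s) i) has_real_derivative
     (\<Sum>k<r. ((-1) ^ k * (if k + j = 0 then 0 else x t ^ (k + j - 1) / fact (k + j - 1)) * (D ^^ k) (v t) i) * x'
       + (-1) ^ k * (x t ^ (k + j) / fact (k + j)) * (D ^^ k) v' i)) (at t)"
    by (rule DERIV_sum) (rule *)
  then show ?thesis unfolding ex_def sum.distrib sum_distrib_right .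
qed

lemma vder_ex_Suc:
  assumes "(x has_real_derivative x') (at t)" "vder v v' t"
  shows "vder (\<lambda>s. ex (Suc j) (x s) (v s)) (scl x' (ex j (x t) (v t)) + ex (Suc j) (x t) v') t"
  unfolding vder_def
  using ex_deriv_term[OF assms, of "Suc j"] by (simp add: ex_def mult.commute)

lemma vder_E:
  assumes "(x has_real_derivative x') (at t)" "vder v v' t"
  shows "vder (\<lambda>s. E (x s) (v s)) (E (x t) v' - scl x' (D (E (x t) (v t)))) t"
  unfolding vder_def
proof
  fix i
  obtain r' where r: "r = Suc r'" using r_pos by (cases r) auto
  define f where "f k = (-1) ^ k * (if k = 0 then 0 else x t ^ (k - 1) / fact (k - 1)) * (D ^^ k) (v t) i" for k
  have fS: "f (Suc k) = - ((-1) ^ k * (x t ^ k / fact k) * (D ^^ Suc k) (v t) i)" for k by (simp add: f_def)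
  have "f r = 0" by (simp add: f_def D_nil)
  then have "(\<Sum>k<r. f k) = (\<Sum>k<Suc r. f k)" by simp
  also have "\<dots> = (\<Sum>k<r. f (Suc k))" by (subst sum.lessThan_Suc_shift) (simp add: f_def)
  also have "\<dots> = - D (E (x t) (v t)) i" unfolding fS D_ex by (simp add: sum_negf)
  finally have "(\<Sum>k<r. f k) = - D (E (x t) (v t)) i" .
  then show "((\<lambda>s. E (x s) (v s) i) has_real_derivative (E (x t) v' - scl x' (D (E (x t) (v t)))) i) (at t)"
    unfolding f_def
    by (intro DERIV_cong[OF ex_deriv_term[OF assms, of 0 i, unfolded add_0_right]]) simp
qed

lemma vder_E': "vder (\<lambda>s. E s v) (- D (E t v)) t"
  using vder_E[OF DERIV_ident vder_const] by simp

lemma vder_ex_Suc': "vder (\<lambda>s. ex (Suc j) s v) (ex j t v) t"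
  using vder_ex_Suc[OF DERIV_ident vder_const] by simp

lemma vpoly_ex: "polynomial_fun x \<Longrightarrow> vpoly v \<Longrightarrow> vpoly (\<lambda>z. ex j (x z) (v z))"
proof -
  assume x: "polynomial_fun x" and v: "vpoly v"
  have "vpoly (\<lambda>z. (D ^^ k) (v z))" for k
    using v by (induction k) (auto intro: vpoly_ap)
  then show ?thesis using x unfolding vpoly_def ex_def by (auto intro!: polynomial_intros)
qed

text \<open>Since \<open>D\<close> is nilpotent, the linear equation \<open>f' = c D f\<close> has unique solutions for an elementary
  reason: the derivative of the highest non-vanishing \<open>D ^ k f\<close> is zero.\<close>

lemma linear_ode_unique:
  assumes I: "is_interval I" "open I" "t0 \<in> I" and f0: "f t0 = 0"
    and der: "\<And>t. t \<in> I \<Longrightarrow> vder f (scl c (D (f t))) t" and t: "t \<in> I"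
  shows "f t = 0"
proof -
  have "\<forall>t\<in>I. (D ^^ (r - k)) (f t) = 0" if "k \<le> r" for k
    using that
  proof (induction k)
    case 0
    then show ?case by (simp add: D_nil)
  next
    case (Suc k)
    let ?g = "\<lambda>t. (D ^^ (r - Suc k)) (f t)"
    have vd: "vder (\<lambda>s. (D ^^ j) (f s)) ((D ^^ j) w) t" if "vder f w t" for j w t
      using that by (induction j) (auto intro: vder_ap)
    have "vder ?g 0 t" if "t \<in> I" for t
    proof -
      have "(D ^^ (r - Suc k)) (scl c (D (f t))) = scl c ((D ^^ Suc (r - Suc k)) (f t))"
        by (simp only: Dpow_linear Dpow_Suc(2))
      also have "Suc (r - Suc k) = r - k" using Suc.prems by simp
      also have "(D ^^ (r - k)) (f t) = 0" using Suc.IH[OF Suc_leD[OF Suc.prems]] that by blast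
      also have "scl c 0 = 0" by simp
      finally have eq: "(D ^^ (r - Suc k)) (scl c (D (f t))) = 0" .
      show ?thesis by (rule vder_cong_eq[OF vd[OF der[OF that]] eq])
    qed
    then have "((\<lambda>t. ?g t i) has_field_derivative 0) (at t within I)" if "t \<in> I" for t i
      using that DERIV_subset unfolding vder_def by force
    then have "\<exists>d. \<forall>t\<in>I. ?g t i = d" for i
      using has_field_derivative_zero_constant[of I "\<lambda>t. ?g t i"] I(1) is_interval_convex by blast
    then have "?g t i = ?g t0 i" if "t \<in> I" for t i using that I(3) by metis
    then show ?case using f0 by (auto simp: fun_eq_iff Dpow_linear)
  qed
  from this[of r] t show ?thesis by simp
qed

lemma E_add: "E (x + y) v = E x (E y v)"
proof -
  define f where "f t = E (t + y) v - E t (E y v)" for t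
  have "f x = 0"
  proof (rule linear_ode_unique[of UNIV 0])
    show "f 0 = 0" by (simp add: f_def ex_0)
    fix t
    have "((\<lambda>s. s + y) has_real_derivative 1) (at t)" by (auto intro!: derivative_eq_intros)
    from vder_diff[OF vder_chain[OF vder_E' this, of v] vder_E', of "E y v"]
    show "vder f (scl (-1) (D (f t))) t"
      unfolding f_def by (rule vder_cong_eq) (simp add: fun_eq_iff)
  qed auto
  then show ?thesis by (simp add: f_def)
qed

lemma E_inverse [simp]: "E x (E (- x) v) = v" "E (- x) (E x v) = v"
  by (simp_all add: E_add[symmetric] ex_0)

lemma scalar_const:
  assumes "\<And>t. (f has_real_derivative 0) (at t)" shows "f (s::real) = f (t::real)"
  using DERIV_isconst_all assms by blast

lemma E_symplectic: "J (E x v) \<cdot> E x w = J v \<cdot> w"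
proof -
  let ?f = "\<lambda>x. J (E x v) \<cdot> E x w"
  have "(?f has_real_derivative 0) (at t)" for t
    using vder_ip[OF vder_ap[OF vder_E'[of v t], of m Jm] vder_E'[of w t], of m]
    by (simp add: JD_ip)
  then have "?f x = ?f 0" by (rule scalar_const)
  then show ?thesis by (simp add: ex_0)
qed

text \<open>Splitting the integral of \<open>exp (- s D)\<close> over \<open>[0, x + y]\<close> at \<open>y\<close>.\<close>

lemma ex1_add: "ex (Suc 0) (x + y) v = ex (Suc 0) y v + E y (ex (Suc 0) x v)"
proof -
  define f where "f t = ex (Suc 0) (t + y) v - E y (ex (Suc 0) t v)" for t
  have "f x i = f 0 i" for i
  proof (rule scalar_const[of "\<lambda>t. f t i"])
    fix t
    have 1: "((\<lambda>s. s + y) has_real_derivative 1) (at t)" by (auto intro!: derivative_eq_intros)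
    have "vder (\<lambda>s. E y (ex (Suc 0) s v)) (E y (E t v)) t"
      using vder_E[OF DERIV_const vder_ex_Suc'] by simp
    from vder_diff[OF vder_chain[OF vder_ex_Suc' 1] this]
    have "vder f (scl 1 (E (t + y) v) - E y (E t v)) t" unfolding f_def .
    then show "((\<lambda>t. f t i) has_real_derivative 0) (at t)"
      by (simp add: vder_def add.commute[of t y] E_add)
  qed
  then show ?thesis by (simp add: f_def ex_0 fun_eq_iff diff_eq_eq add.commute)
qed

text \<open>For \<open>a\<close> in the kernel of \<open>S\<close>, that is \<open>J a = - D\<^sup>T a\<close>, the two-form \<open>J\<close> sees the integral of the
  exponential only through boundary terms.\<close>

lemma ex1_kernel:
  assumes a: "S a = 0"
  shows "J (ex (Suc 0) x a) \<cdot> E x w = a \<cdot> E x w - a \<cdot> w"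
proof -
  have Ja: "J a = - Dt a" using a by (simp add: S_def add_eq_0_iff2)
  let ?f = "\<lambda>x. J (ex (Suc 0) x a) \<cdot> E x w - a \<cdot> E x w"
  have "(?f has_real_derivative 0) (at t)" for t
  proof -
    have "J (E t a) \<cdot> E t w + J (ex (Suc 0) t a) \<cdot> (- D (E t w)) - a \<cdot> (- D (E t w)) = 0"
    proof -
      have "J (ex (Suc 0) t a) \<cdot> D (E t w) = - (J (a - E t a) \<cdot> E t w)"
        using JD_ip[of "ex (Suc 0) t a" "E t w"] by (simp add: D_ex1)
      moreover have "a \<cdot> D (E t w) = - (J a \<cdot> E t w)"
        using D_adj[of "E t w" a] by (simp add: Ja ip_commute)
      ultimately show ?thesis by simp
    qed
    then show ?thesis
      using DERIV_diff[OF vder_ip[OF vder_ap[OF vder_ex_Suc'[of 0 a t], of m Jm] vder_E'[of w t], of m]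
        vder_ip[OF vder_const[of a] vder_E'[of w t], of m]] by simp
  qed
  then have "?f x = ?f 0" by (rule scalar_const)
  then show ?thesis by (simp add: ex_0)
qed

end

section \<open>The group law, the isometries and the metric in coordinates\<close>

text \<open>Points and tangent vectors \<open>(x, y, v)\<close>, that is \<open>x f + y e + v\<close>: coordinate \<open>0\<close> is \<open>x\<close>, coordinate \<open>1\<close>
  is \<open>y\<close>, and the coordinates of \<open>v\<close> follow.\<close>

definition mk :: "real \<Rightarrow> real \<Rightarrow> vec \<Rightarrow> vec" where
  "mk x y v = (\<lambda>i. if i = 0 then x else if i = 1 then y else v (i - 2))"

definition pv :: "vec \<Rightarrow> vec" where "pv p = (\<lambda>i. p (i + 2))"

lemma mk_simps [simp]: "mk x y v 0 = x" "mk x y v (Suc 0) = y" "pv (mk x y v) = v"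
  by (simp_all add: mk_def pv_def)

lemma mk_collapse [simp]: "mk (p 0) (p (Suc 0)) (pv p) = p"
proof
  fix i
  show "mk (p 0) (p (Suc 0)) (pv p) i = p i"
    by (cases i rule: nat.exhaust; cases "i - 1") (auto simp: mk_def pv_def numeral_2_eq_2)
qed

lemma mk_eqI: "p 0 = q 0 \<Longrightarrow> p (Suc 0) = q (Suc 0) \<Longrightarrow> pv p = pv q \<Longrightarrow> p = q"
  using mk_collapse by metis

lemma pv_simps [simp]: "pv (p + q) = pv p + pv q" "pv (p - q) = pv p - pv q" "pv (- p) = - pv p"
    "pv 0 = 0" "pv (scl c p) = scl c (pv p)"
  by (simp_all add: pv_def fun_eq_iff)

lemma mk_zero: "mk 0 0 0 = 0"
  by (simp add: mk_def fun_eq_iff)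

lemma mk_in [simp]: "mk x y v \<in> coord_space (Suc (Suc m)) \<longleftrightarrow> v \<in> coord_space m"
proof
  assume l: "mk x y v \<in> coord_space (Suc (Suc m))"
  have "v i = 0" if "m \<le> i" for i
    using l that by (auto simp: coord_space_iff mk_def dest!: spec[of _ "i + 2"])
  then show "v \<in> coord_space m" by (simp add: coord_space_iff)
qed (auto simp: coord_space_iff mk_def)

lemma pv_in [simp]: "p \<in> coord_space (Suc (Suc m)) \<Longrightarrow> pv p \<in> coord_space m"
  by (simp add: coord_space_iff pv_def)

lemma coord_space_closed [simp]:
  "v \<in> coord_space k \<Longrightarrow> w \<in> coord_space k \<Longrightarrow> v + w \<in> coord_space k"
  "v \<in> coord_space k \<Longrightarrow> w \<in> coord_space k \<Longrightarrow> v - w \<in> coord_space k"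
  "v \<in> coord_space k \<Longrightarrow> - v \<in> coord_space k" "0 \<in> coord_space k"
  "v \<in> coord_space k \<Longrightarrow> scl c v \<in> coord_space k"
  by (simp_all add: coord_space_iff)

lemma vder_pv: "vder p X t \<Longrightarrow> vder (\<lambda>s. pv (p s)) (pv X) t"
  by (simp add: vder_def pv_def)

lemma vder_comp: "vder p X t \<Longrightarrow> ((\<lambda>s. p s i) has_real_derivative X i) (at t)"
  by (simp add: vder_def)

lemma vder_mk:
  "(x has_real_derivative x') (at t) \<Longrightarrow> (y has_real_derivative y') (at t) \<Longrightarrow> vder v v' t \<Longrightarrow>
    vder (\<lambda>s. mk (x s) (y s) (v s)) (mk x' y' v') t"
  by (simp add: vder_def mk_def)

lemma vpoly_mk:
  "polynomial_fun x \<Longrightarrow> polynomial_fun y \<Longrightarrow> vpoly v \<Longrightarrow> vpoly (\<lambda>z. mk (x z) (y z) (v z))"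
  unfolding vpoly_def
proof
  fix i assume "polynomial_fun x" "polynomial_fun y" "\<forall>i. polynomial_fun (\<lambda>z. v z i)"
  then show "polynomial_fun (\<lambda>z. mk (x z) (y z) (v z) i)"
    by (cases "i = 0"; cases "i = 1") (simp_all add: mk_def)
qed

lemma vpoly_pv: "vpoly p \<Longrightarrow> vpoly (\<lambda>z. pv (p z))"
  and vpoly_comp: "vpoly p \<Longrightarrow> polynomial_fun (\<lambda>z. p z i)"
  by (simp_all add: vpoly_def pv_def)

context nil_data
begin

abbreviation coords :: "vec set" where "coords \<equiv> coord_space (Suc (Suc m))"

text \<open>The semidirect product of \<open>\<real>\<close> and \<open>H = V \<times> \<real>\<close>, where \<open>H\<close> has the Heisenberg type law \<open>(v, y) (w, z) = (v + w, y + z + \<langle>J v, w\<rangle> / 2)\<close>.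
  A point stands for \<open>exp (x f) (v, y)\<close>. Moving the second factor \<open>exp (x' f)\<close> to the left past \<open>(v, y)\<close>
  applies \<open>exp (- x' D)\<close> to \<open>v\<close>.\<close>

definition pmul :: "vec \<Rightarrow> vec \<Rightarrow> vec" where
  "pmul p q = mk (p 0 + q 0) (p 1 + q 1 + (J (E (q 0) (pv p)) \<cdot> pv q) / 2) (pv q + E (q 0) (pv p))"

definition pinv :: "vec \<Rightarrow> vec" where
  "pinv p = mk (- p 0) (- p 1) (- E (- p 0) (pv p))"

lemma pmul_simps [simp]:
  "pmul p q 0 = p 0 + q 0" "pmul p q (Suc 0) = p 1 + q 1 + (J (E (q 0) (pv p)) \<cdot> pv q) / 2"
  "pv (pmul p q) = pv q + E (q 0) (pv p)"
  by (simp_all add: pmul_def)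

lemma pinv_simps [simp]:
  "pinv p 0 = - p 0" "pinv p (Suc 0) = - p 1" "pv (pinv p) = - E (- p 0) (pv p)"
  by (simp_all add: pinv_def)

lemma pmul_in [simp]: "p \<in> coords \<Longrightarrow> q \<in> coords \<Longrightarrow> pmul p q \<in> coords"
  unfolding pmul_def by simp

lemma pinv_in [simp]: "p \<in> coords \<Longrightarrow> pinv p \<in> coords"
  unfolding pinv_def by simp

lemma pmul_assoc: "pmul (pmul p q) s = pmul p (pmul q s)"
proof (rule mk_eqI)
  have ea: "E (q 0 + s 0) w = E (s 0) (E (q 0) w)" for w by (simp add: E_add[symmetric] add.commute)
  \<comment> \<open>Associativity is the statement that \<open>exp (- x D)\<close> is an automorphism of the Heisenberg type group.\<close>
  have "J (E (s 0) (E (q 0) (pv p))) \<cdot> E (s 0) (pv q) = J (E (q 0) (pv p)) \<cdot> pv q"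
    by (rule E_symplectic)
  then show "pmul (pmul p q) s (Suc 0) = pmul p (pmul q s) (Suc 0)"
    by (simp add: ea add_divide_distrib)
  show "pv (pmul (pmul p q) s) = pv (pmul p (pmul q s))" by (simp add: ea add.assoc)
qed simp

lemma pmul_one [simp]: "pmul 0 p = p" "pmul p 0 = p"
  by (rule mk_eqI; simp add: ex_0)+

lemma pmul_pinv [simp]: "pmul (pinv p) p = 0" "pmul p (pinv p) = 0"
proof -
  show "pmul (pinv p) p = 0" by (rule mk_eqI) simp_all
  have "J (E (- p 0) (pv p)) \<cdot> E (- p 0) (pv p) = 0" by simp
  then show "pmul p (pinv p) = 0" by - (rule mk_eqI, simp_all)
qed

lemma vpoly_pmul: "vpoly p \<Longrightarrow> vpoly q \<Longrightarrow> vpoly (\<lambda>z. pmul (p z) (q z))"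
  unfolding pmul_def
  by (assumption | rule vpoly_mk vpoly_intros polynomial_intros vpoly_ex vpoly_pv polynomial_ip vpoly_comp)+

lemma vpoly_pinv: "vpoly p \<Longrightarrow> vpoly (\<lambda>z. pinv (p z))"
  unfolding pinv_def
  by (assumption | rule vpoly_mk vpoly_intros polynomial_intros vpoly_ex vpoly_pv vpoly_comp)+

subsection \<open>Isometries\<close>

text \<open>The solution of \<open>h' = a - D h\<close> with \<open>h 0 = h0\<close>. Along it \<open>h' + D h\<close> is the constant \<open>a\<close>, so adding \<open>h x\<close>
  to \<open>v\<close> changes the form \<open>dv + D v dx\<close> by \<open>a dx\<close> only.\<close>

definition v_shift :: "vec \<Rightarrow> vec \<Rightarrow> real \<Rightarrow> vec" where
  "v_shift h0 a x = E x h0 + ex (Suc 0) x a"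

text \<open>Translation of \<open>x\<close> by \<open>c\<close> and shift of \<open>v\<close> by \<open>h x\<close>. The shift turns the transversal part of the metric into
  \<open>|\<theta> + a dx|\<^sup>2\<close>; the change of \<open>y\<close> is the one that compensates \<open>2 \<langle>a, \<theta>\<rangle> dx + |a|\<^sup>2 dx\<^sup>2\<close>, which is
  possible when \<open>S a = 0\<close>. Left translations are the case \<open>a = 0\<close>, and the case \<open>c = 0\<close>, \<open>h 0 = 0\<close>,
  abbreviated \<open>Th a\<close>, fixes the identity.\<close>

definition isoF :: "real \<Rightarrow> vec \<Rightarrow> vec \<Rightarrow> real \<Rightarrow> vec \<Rightarrow> vec" where
  "isoF c h0 a k p = mk (p 0 + c)
     (p 1 + k - a \<cdot> (pv p + scl (1/2) (v_shift h0 a (p 0))) + (J (v_shift h0 a (p 0)) \<cdot> pv p) / 2)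
     (pv p + v_shift h0 a (p 0))"

lemma isoF_simps [simp]:
  "isoF c h0 a k p 0 = p 0 + c"
  "isoF c h0 a k p (Suc 0) =
     p 1 + k - a \<cdot> (pv p + scl (1/2) (v_shift h0 a (p 0))) + (J (v_shift h0 a (p 0)) \<cdot> pv p) / 2"
  "pv (isoF c h0 a k p) = pv p + v_shift h0 a (p 0)"
  by (simp_all add: isoF_def)

lemma v_shift_in [simp]: "h0 \<in> coord_space m \<Longrightarrow> a \<in> coord_space m \<Longrightarrow> v_shift h0 a x \<in> coord_space m"
  by (simp add: v_shift_def)

lemma isoF_in [simp]: "p \<in> coords \<Longrightarrow> h0 \<in> coord_space m \<Longrightarrow> a \<in> coord_space m \<Longrightarrow>
    isoF c h0 a k p \<in> coords"
  unfolding isoF_def by simp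

lemma left_translation_isoF: "pmul b p = isoF (b 0) (pv b) 0 (b 1) p"
  by (rule mk_eqI) (simp_all add: v_shift_def)

abbreviation Th :: "vec \<Rightarrow> vec \<Rightarrow> vec" where "Th a \<equiv> isoF 0 0 a 0"

text \<open>For \<open>S a = 0\<close> such a map is a left translation after an automorphism, hence lies in the semidirect product.\<close>

lemma isoF_decomp:
  assumes "S a = 0"
  shows "isoF c h0 a k p = pmul (mk c (k - (a \<cdot> h0) / 2) h0) (Th a p)"
proof (rule mk_eqI)
  have "J (E (p 0) h0) \<cdot> ex (Suc 0) (p 0) a = - (a \<cdot> E (p 0) h0 - a \<cdot> h0)"
    using ex1_kernel[OF assms, of "p 0" h0] J_skew[of "E (p 0) h0" "ex (Suc 0) (p 0) a"] by simp
  then show "isoF c h0 a k p (Suc 0) = pmul (mk c (k - (a \<cdot> h0) / 2) h0) (Th a p) (Suc 0)"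
    by (simp add: v_shift_def field_simps)
qed (simp_all add: v_shift_def add_ac)

text \<open>As \<open>S a = 0\<close>, the linear term \<open>\<langle>a, v\<rangle>\<close> in the change of \<open>y\<close> is balanced by the two-form term
  (\<open>ex1_kernel\<close>). Quadratic terms cancel by skewness and \<open>E_symplectic\<close>.\<close>

lemma Th_hom:
  assumes "S a = 0"
  shows "Th a (pmul p q) = pmul (Th a p) (Th a q)"
proof (rule mk_eqI)
  define v w e f where "v = pv p" and "w = pv q" and "e = ex (Suc 0) (p 0) a" and "f = ex (Suc 0) (q 0) a"
  have k: "J f \<cdot> E (q 0) u = a \<cdot> E (q 0) u - a \<cdot> u" for u
    unfolding f_def by (rule ex1_kernel[OF assms])
  have 1: "ex (Suc 0) (p 0 + q 0) a = f + E (q 0) e" by (simp add: ex1_add f_def e_def)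
  have 2: "J (E (q 0) e) \<cdot> E (q 0) v = J e \<cdot> v" by (rule E_symplectic)
  have 3: "J (E (q 0) v) \<cdot> f = - (J f \<cdot> E (q 0) v)" "J (E (q 0) e) \<cdot> f = - (J f \<cdot> E (q 0) e)"
    by (rule J_skew)+
  show "Th a (pmul p q) (Suc 0) = pmul (Th a p) (Th a q) (Suc 0)"
    by (simp add: v_shift_def 1 2 3 k flip: v_def w_def e_def f_def) (simp add: field_simps)
qed (simp_all add: v_shift_def ex1_add add_ac)

lemma Th_inverse: "Th (- a) (Th a p) = p"
  by (rule mk_eqI) (simp_all add: v_shift_def)

lemma vpoly_v_shift: "polynomial_fun x \<Longrightarrow> vpoly h \<Longrightarrow> vpoly a \<Longrightarrow> vpoly (\<lambda>z. v_shift (h z) (a z) (x z))"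
  unfolding v_shift_def by (intro vpoly_intros vpoly_ex)

lemma vpoly_isoF:
  "polynomial_fun c \<Longrightarrow> vpoly h \<Longrightarrow> vpoly a \<Longrightarrow> polynomial_fun k \<Longrightarrow> vpoly p \<Longrightarrow>
    vpoly (\<lambda>z. isoF (c z) (h z) (a z) (k z) (p z))"
  unfolding isoF_def
  by (assumption | rule vpoly_mk vpoly_intros polynomial_intros vpoly_v_shift vpoly_pv polynomial_ip vpoly_comp)+

lemma vder_v_shift:
  "(x has_real_derivative x') (at t) \<Longrightarrow>
    vder (\<lambda>s. v_shift h0 a (x s)) (scl x' (a - D (v_shift h0 a (x t)))) t"
  unfolding v_shift_def
  using vder_add[OF vder_E[OF _ vder_const, of x x' t h0] vder_ex_Suc[OF _ vder_const, of x x' t 0 a]]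
  by (auto simp: scl_add D_ex1 algebra_simps)

text \<open>The differential of \<open>isoF\<close> at \<open>p\<close>; here \<open>c\<close> and \<open>k\<close> are additive constants that differentiation removes.\<close>

definition disoF :: "vec \<Rightarrow> vec \<Rightarrow> vec \<Rightarrow> vec \<Rightarrow> vec" where
  "disoF h0 a p X = (let h = v_shift h0 a (p 0); h' = scl (X 0) (a - D h) in
     mk (X 0) (X 1 - a \<cdot> (pv X + scl (1/2) h') + (J h' \<cdot> pv p + J h \<cdot> pv X) / 2) (pv X + h'))"

lemma vder_isoF:
  assumes "vder p X t"
  shows "vder (\<lambda>s. isoF c h0 a k (p s)) (disoF h0 a (p t) X) t"
proof -
  define h' where "h' = scl (X 0) (a - D (v_shift h0 a (p t 0)))"
  note 0 = vder_comp[OF assms, of 0] and 1 = vder_comp[OF assms, of 1] and v = vder_pv[OF assms]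
  have h: "vder (\<lambda>s. v_shift h0 a (p s 0)) h' t" unfolding h'_def by (rule vder_v_shift[OF 0])
  have h2: "vder (\<lambda>s. scl (1/2) (v_shift h0 a (p s 0))) (scl (1/2) h') t"
    using vder_scl[OF DERIV_const h] by simp
  have d1: "((\<lambda>s. a \<cdot> (pv (p s) + scl (1/2) (v_shift h0 a (p s 0)))) has_real_derivative
      a \<cdot> (pv X + scl (1/2) h')) (at t)"
    using vder_ip[OF vder_const[of a] vder_add[OF v h2], of m] by simp
  have d2: "((\<lambda>s. (J (v_shift h0 a (p s 0)) \<cdot> pv (p s)) / 2) has_real_derivative
      (J h' \<cdot> pv (p t) + J (v_shift h0 a (p t 0)) \<cdot> pv X) / 2) (at t)"
    by (rule DERIV_cdivide[OF vder_ip[OF vder_ap[OF h] v]])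
  have d3: "((\<lambda>s. p s 1 + k) has_real_derivative X 1) (at t)"
    using DERIV_add[OF 1 DERIV_const] by simp
  have d4: "((\<lambda>s. p s 0 + c) has_real_derivative X 0) (at t)"
    using DERIV_add[OF 0 DERIV_const] by simp
  show ?thesis
    unfolding isoF_def disoF_def Let_def h'_def[symmetric]
    by (intro vder_mk d4 DERIV_add DERIV_diff d3 d1 d2 vder_add v h)
qed

subsection \<open>The metric\<close>

text \<open>The left-invariant coframe consists of \<open>dx\<close>, \<open>\<theta>\<close> and \<open>\<sigma>\<close>, dual to \<open>f\<close>, \<open>V\<close> and \<open>e\<close>. Expressed in it, the
  metric has the constant coefficients of the scalar product on the Lie algebra.\<close>

definition \<theta> :: "vec \<Rightarrow> vec \<Rightarrow> vec" where "\<theta> p X = pv X + scl (X 0) (D (pv p))"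

definition \<sigma> :: "vec \<Rightarrow> vec \<Rightarrow> real" where "\<sigma> p X = X 1 - (J (pv p) \<cdot> \<theta> p X) / 2"

definition mform :: "vec \<Rightarrow> vec \<Rightarrow> vec \<Rightarrow> real" where
  "mform p X Y = X 0 * \<sigma> p Y + Y 0 * \<sigma> p X + \<theta> p X \<cdot> \<theta> p Y"

definition frame :: "vec \<Rightarrow> real \<Rightarrow> real \<Rightarrow> vec \<Rightarrow> vec" where
  "frame p s z \<tau> = mk s (z + (J (pv p) \<cdot> \<tau>) / 2) (\<tau> - scl s (D (pv p)))"

lemma frame_simps [simp]:
  "frame p s z \<tau> 0 = s" "\<theta> p (frame p s z \<tau>) = \<tau>" "\<sigma> p (frame p s z \<tau>) = z"
  by (simp_all add: frame_def \<theta>_def \<sigma>_def)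

lemma frame_in [simp]: "\<tau> \<in> coord_space m \<Longrightarrow> frame p s z \<tau> \<in> coords"
  unfolding frame_def by simp

lemma mform_sym: "mform p X Y = mform p Y X"
  by (simp add: mform_def ip_commute)

lemma mform_linear:
  "mform p (X + X') Y = mform p X Y + mform p X' Y" "mform p (scl c X) Y = c * mform p X Y"
  "mform p Y (X + X') = mform p Y X + mform p Y X'" "mform p Y (scl c X) = c * mform p Y X"
  by (simp_all add: mform_def \<theta>_def \<sigma>_def scl_add algebra_simps add_divide_distrib)

lemma ip_trunc: "ip m u (pv (\<lambda>i. if i < Suc (Suc m) then X i else 0)) = ip m u (pv X)"
    "ip m (pv (\<lambda>i. if i < Suc (Suc m) then X i else 0)) u = ip m (pv X) u"
  by (simp_all add: ip_def pv_def)

lemma mform_trunc: "mform p X Y = mform p X (\<lambda>i. if i < Suc (Suc m) then Y i else 0)"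
  by (simp add: mform_def \<theta>_def \<sigma>_def ip_trunc)

lemma mform_expand:
  "mform p X Y = (\<Sum>i<Suc (Suc m). \<Sum>j<Suc (Suc m). mform p (unit_coord i) (unit_coord j) * X i * Y j)"
proof -
  have 1: "mform p X Y = (\<Sum>j<Suc (Suc m). Y j * mform p X (unit_coord j))" for X Y
    by (rule linear_functional_expand[where f = "mform p X"]) (simp_all add: mform_linear mform_trunc[symmetric])
  have "mform p X Y = (\<Sum>j<Suc (Suc m). Y j * (\<Sum>i<Suc (Suc m). X i * mform p (unit_coord j) (unit_coord i)))"
    unfolding 1[of X Y] by (intro sum.cong refl) (metis 1 mform_sym)
  also have "\<dots> = (\<Sum>j<Suc (Suc m). \<Sum>i<Suc (Suc m). mform p (unit_coord i) (unit_coord j) * X i * Y j)"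
    unfolding sum_distrib_left by (intro sum.cong refl) (simp add: mform_sym)
  also have "\<dots> = (\<Sum>i<Suc (Suc m). \<Sum>j<Suc (Suc m). mform p (unit_coord i) (unit_coord j) * X i * Y j)"
    by (rule sum.swap)
  finally show ?thesis .
qed

lemma polynomial_mform: "polynomial_fun (\<lambda>p. mform p X Y)"
  unfolding mform_def \<theta>_def \<sigma>_def
  by (intro polynomial_intros polynomial_ip vpoly_intros vpoly_pv)

lemma mform_nondeg:
  assumes u: "u \<in> coords"
    and 0: "\<And>w. w \<in> coords \<Longrightarrow> mform p u w = 0"
  shows "u = 0"
proof (rule mk_eqI)
  have f: "u 0 * z + s * \<sigma> p u + \<theta> p u \<cdot> \<tau> = 0" if "\<tau> \<in> coord_space m" for s z \<tau>
    using 0[OF frame_in[OF that], of p s z] by (simp add: mform_def)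
  show u0: "u 0 = 0 0" using f[of 0 1 0] by simp
  then have u1: "\<sigma> p u = 0" using f[of 0 0 1] by simp
  have t: "\<theta> p u = pv u" using u0 by (simp add: \<theta>_def)
  have "pv u \<cdot> pv u = 0" using f[of "pv u" 0 0] u t by simp
  then have v: "pv u = 0" using ip_self_zero u by (meson pv_in)
  then show "pv u = pv 0" by simp
  show "u (Suc 0) = 0 (Suc 0)" using u1 t v by (simp add: \<sigma>_def)
qed

text \<open>The coframe changes by a null rotation: \<open>\<theta>\<close> becomes \<open>\<theta> + a dx\<close> and \<open>\<sigma>\<close> becomes \<open>\<sigma> - \<langle>a, \<theta>\<rangle> - |a|\<^sup>2 dx / 2\<close>, while
  \<open>dx\<close> stays. Null rotations preserve \<open>2 dx \<sigma> + |\<theta>|\<^sup>2\<close>.\<close>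

lemma isoF_isometric:
  assumes a: "S a = 0"
  shows "mform (isoF c h0 a k p) (disoF h0 a p X) (disoF h0 a p Y) = mform p X Y"
proof -
  let ?F = "isoF c h0 a k p"
  define h v where "h = v_shift h0 a (p 0)" and "v = pv p"
  have Ja: "J a = - Dt a" using a by (simp add: S_def add_eq_0_iff2)
  have D0: "disoF h0 a p X 0 = X 0" for X by (simp add: disoF_def Let_def)
  have Dt: "\<theta> ?F (disoF h0 a p X) = \<theta> p X + scl (X 0) a" for X
    by (simp add: \<theta>_def disoF_def Let_def scl_add algebra_simps)
  have Ds: "\<sigma> ?F (disoF h0 a p X) = \<sigma> p X - a \<cdot> \<theta> p X - X 0 * (a \<cdot> a) / 2" for X
  proof -
    have e1: "a \<cdot> D h = - (J a \<cdot> h)" "a \<cdot> D v = - (J a \<cdot> v)"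
      using D_adj[of h a] D_adj[of v a] by (simp_all add: Ja ip_commute)
    have e2: "J (D h) \<cdot> v = - (J h \<cdot> D v)" by (rule JD_ip)
    have e3: "J v \<cdot> a = - (J a \<cdot> v)" "J h \<cdot> a = - (J a \<cdot> h)" by (rule J_skew)+
    show ?thesis
      unfolding \<sigma>_def Dt
      by (simp add: disoF_def Let_def \<theta>_def e1 e2 e3 scl_add flip: h_def v_def) (simp add: e1 e2 e3 field_simps)
  qed
  show ?thesis
    unfolding mform_def D0 Dt Ds by (simp add: field_simps ip_commute)
qed

end

section \<open>Lorentz nilmanifolds carrying this structure\<close>

context nil_data
begin

abbreviation Dp :: "nat \<Rightarrow> vec \<Rightarrow> vec" where "Dp k \<equiv> D ^^ k"

end

text \<open>A Lie group with metric that has the above form in some global chart. The points are left abstract, because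
  in a product of two such manifolds they are pairs and not coordinate vectors.\<close>

locale nil_model = nil_data +
  fixes M :: "'a manifold" and \<phi> :: "'a \<Rightarrow> nat \<Rightarrow> real" and N :: "'a monoid"
    and g :: "'a metric_field"
  assumes chart: "global_chart M \<phi>" and dim: "mdim M = Suc (Suc m)" and carrier: "carrier N = points M"
    and pt_mult: "\<And>x y. x \<in> points M \<Longrightarrow> y \<in> points M \<Longrightarrow> x \<otimes>\<^bsub>N\<^esub> y \<in> points M"
    and mult: "\<And>x y. x \<in> points M \<Longrightarrow> y \<in> points M \<Longrightarrow> \<phi> (x \<otimes>\<^bsub>N\<^esub> y) = pmul (\<phi> x) (\<phi> y)"
    and pt_one: "\<one>\<^bsub>N\<^esub> \<in> points M" and one: "\<phi> \<one>\<^bsub>N\<^esub> = 0"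
    and metric: "\<And>\<alpha> \<beta>. \<alpha> 0 \<in> points M \<Longrightarrow>
      g \<alpha> \<beta> = mform (\<phi> (\<alpha> 0)) (chart_velocity \<phi> \<alpha>) (chart_velocity \<phi> \<beta>)"
begin

lemma chart_in [simp]: "p \<in> points M \<Longrightarrow> \<phi> p \<in> coords"
  using global_chart_in[OF chart] dim by simp

lemma chart_eqI: "p \<in> points M \<Longrightarrow> q \<in> points M \<Longrightarrow> \<phi> p = \<phi> q \<Longrightarrow> p = q"
  by (rule global_chart_eqI[OF chart])

definition transport :: "(vec \<Rightarrow> vec) \<Rightarrow> 'a \<Rightarrow> 'a" where
  "transport G p = inv_into (points M) \<phi> (G (\<phi> p))"

lemma point_of:
  assumes "x \<in> coords"
  shows "inv_into (points M) \<phi> x \<in> points M" "\<phi> (inv_into (points M) \<phi> x) = x"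
  using global_chart_inv[OF chart] assms dim by simp_all

lemma transport:
  assumes "\<And>x. x \<in> coords \<Longrightarrow> G x \<in> coords" "p \<in> points M"
  shows "transport G p \<in> points M" "\<phi> (transport G p) = G (\<phi> p)"
  unfolding transport_def using point_of assms by auto

lemma group_N: "group N"
proof (rule groupI)
  fix x assume x: "x \<in> carrier N"
  define y where "y = inv_into (points M) \<phi> (pinv (\<phi> x))"
  have "y \<in> points M" "\<phi> y = pinv (\<phi> x)"
    unfolding y_def using point_of[OF pinv_in[OF chart_in]] x carrier by simp_all
  then show "\<exists>y\<in>carrier N. y \<otimes>\<^bsub>N\<^esub> x = \<one>\<^bsub>N\<^esub>"
    using x carrier mult pt_mult one pt_one by (intro bexI[of _ y]) (auto intro!: chart_eqI)
qed (auto simp: carrier mult pt_mult one pt_one pmul_assoc intro!: chart_eqI)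

lemma pt_inv: "x \<in> points M \<Longrightarrow> inv\<^bsub>N\<^esub> x \<in> points M"
  using group.inv_closed[OF group_N] carrier by auto

lemma chart_inv: "x \<in> points M \<Longrightarrow> \<phi> (inv\<^bsub>N\<^esub> x) = pinv (\<phi> x)"
proof -
  assume x: "x \<in> points M"
  have "pmul (\<phi> (inv\<^bsub>N\<^esub> x)) (\<phi> x) = 0"
    using group.l_inv[OF group_N] x carrier mult[OF pt_inv[OF x] x] one by simp
  then have "pmul (pmul (\<phi> (inv\<^bsub>N\<^esub> x)) (\<phi> x)) (pinv (\<phi> x)) = pinv (\<phi> x)" by simp
  then show ?thesis unfolding pmul_assoc by simp
qed

lemma lie_group_N: "lie_group N M"
proof (rule lie_groupI[OF chart group_N carrier])
  define n where "n = Suc (Suc m)"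
  define P where "P k z = pmul (\<lambda>i. if i < n then z i else 0) (\<lambda>i. z (i + n)) k" for k z
  have "polynomial_fun (\<lambda>z. if i < n then z i else 0)" for i
    by (cases "i < n") (simp_all add: polynomial_coord polynomial_const)
  then have "vpoly (\<lambda>z i. if i < n then z i else 0)" "vpoly (\<lambda>z i. z (i + n))"
    unfolding vpoly_def by (blast intro: polynomial_coord)+
  from vpoly_pmul[OF this] show "polynomial_fun (P k)" for k unfolding vpoly_def P_def by blast
  show "\<phi> (x \<otimes>\<^bsub>N\<^esub> y) k = P k (chart_pair (mdim M) \<phi> \<phi> (x, y))" if "x \<in> points M" "y \<in> points M" for x y k
  proof -
    have "(\<lambda>i. if i < n then chart_pair (mdim M) \<phi> \<phi> (x, y) i else 0) = \<phi> x"
      "(\<lambda>i. chart_pair (mdim M) \<phi> \<phi> (x, y) (i + n)) = \<phi> y"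
      using chart_in[OF that(1)] by (simp_all add: chart_pair_def n_def dim coord_space_iff fun_eq_iff)
    then show ?thesis using mult[OF that] by (simp add: P_def)
  qed
  show "polynomial_fun (\<lambda>z. pinv z k)" for k using vpoly_pinv[OF vpoly_id] unfolding vpoly_def by blast
qed (simp add: chart_inv)

lemma metric_N: "pseudo_riemannian_metric M g"
proof (rule pseudo_riemannian_metricI[OF chart, where \<Gamma> = mform])
  fix x u :: vec
  assume u: "u \<in> coord_space (mdim M)" and 0: "\<And>v. v \<in> coord_space (mdim M) \<Longrightarrow> mform x u v = 0"
  have "u = 0" by (rule mform_nondeg[OF u[unfolded dim] 0[unfolded dim]])
  then show "u = (\<lambda>_. 0)" by (simp only: zero_fun_def)
next
  fix x u v :: vec
  show "mform x u v = (\<Sum>i<mdim M. \<Sum>j<mdim M. mform x (unit_coord i) (unit_coord j) * u i * v j)"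
    unfolding dim by (rule mform_expand)
qed (rule metric polynomial_mform mform_sym; assumption?)+

lemma tangent_vder:
  assumes "\<alpha> \<in> tangent_curves M p"
  shows "vder (\<lambda>t. \<phi> (\<alpha> t)) (chart_velocity \<phi> \<alpha>) 0"
  unfolding vder_def
proof
  fix k
  show "((\<lambda>t. \<phi> (\<alpha> t) k) has_real_derivative chart_velocity \<phi> \<alpha> k) (at 0)"
  proof (cases "k < mdim M")
    case True
    then show ?thesis using tangent_curve_differentiable(1)[OF chart assms] by blast
  next
    case False
    have "eventually (\<lambda>t. \<phi> (\<alpha> t) k = 0) (nhds 0)"
      using tangent_curve_differentiable(2)[OF chart assms, of 0] False dim chart_in
      by (auto elim!: eventually_mono simp: coord_space_iff)
    then have "((\<lambda>t. \<phi> (\<alpha> t) k) has_real_derivative 0) (at 0)"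
      using DERIV_cong_ev[OF refl, of "\<lambda>t. \<phi> (\<alpha> t) k" "\<lambda>_. 0" 0 0 0] by simp
    then show ?thesis unfolding chart_velocity_def by (simp add: DERIV_imp_deriv)
  qed
qed

lemma velocity_eqI: "vder (\<lambda>t. \<phi> (\<alpha> t)) X 0 \<Longrightarrow> chart_velocity \<phi> \<alpha> = X"
  unfolding chart_velocity_def vder_def by (intro ext DERIV_imp_deriv) blast

lemma isometry_isoF:
  assumes a: "S a = 0"
    and F: "\<And>p. p \<in> points M \<Longrightarrow> F p \<in> points M" "\<And>p. p \<in> points M \<Longrightarrow> \<phi> (F p) = isoF c h0 a k (\<phi> p)"
    and F': "\<And>p. p \<in> points M \<Longrightarrow> F' p \<in> points M" "\<And>p. p \<in> points M \<Longrightarrow> \<phi> (F' p) = isoF c' h0' a' k' (\<phi> p)"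
    and inv: "\<And>p. p \<in> points M \<Longrightarrow> F' (F p) = p \<and> F (F' p) = p"
  shows "isometry M g F"
proof (rule isometryI[OF chart, of F F'])
  show "polynomial_fun (\<lambda>z. isoF c h0 a k z i)" for i
    using vpoly_isoF[OF polynomial_const vpoly_const vpoly_const polynomial_const vpoly_id]
    unfolding vpoly_def by blast
  show "polynomial_fun (\<lambda>z. isoF c' h0' a' k' z i)" for i
    using vpoly_isoF[OF polynomial_const vpoly_const vpoly_const polynomial_const vpoly_id]
    unfolding vpoly_def by blast
  fix p \<alpha> \<beta> assume p: "p \<in> points M" and ab: "\<alpha> \<in> tangent_curves M p" "\<beta> \<in> tangent_curves M p"
  have vel: "chart_velocity \<phi> (F \<circ> \<gamma>) = disoF h0 a (\<phi> p) (chart_velocity \<phi> \<gamma>)"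
    if "\<gamma> \<in> tangent_curves M p" for \<gamma>
  proof (rule velocity_eqI)
    have \<gamma>0: "\<gamma> 0 = p" using that by (simp add: tangent_curves_def)
    have ev: "eventually (\<lambda>t. \<phi> ((F \<circ> \<gamma>) t) i = isoF c h0 a k (\<phi> (\<gamma> t)) i) (nhds 0)" for i
      using tangent_curve_differentiable(2)[OF chart that, of 0] dim F(2)
      by (auto elim!: eventually_mono)
    show "vder (\<lambda>t. \<phi> ((F \<circ> \<gamma>) t)) (disoF h0 a (\<phi> p) (chart_velocity \<phi> \<gamma>)) 0"
      using vder_isoF[OF tangent_vder[OF that], of c h0 a k] DERIV_cong_ev[OF refl ev refl]
      unfolding vder_def \<gamma>0 by blast
  qed
  have "\<alpha> 0 = p" "(F \<circ> \<alpha>) 0 = F p" using ab by (simp_all add: tangent_curves_def)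
  then show "g (F \<circ> \<alpha>) (F \<circ> \<beta>) = g \<alpha> \<beta>"
    using metric p F vel ab isoF_isometric[OF a] by simp
qed (use F F' inv in auto)

lemma left_invariant_N: "left_invariant N M g"
  unfolding left_invariant_def
proof
  fix a assume "a \<in> carrier N"
  then have a: "a \<in> points M" "inv\<^bsub>N\<^esub> a \<in> points M" by (simp_all add: carrier pt_inv)
  interpret group N by (rule group_N)
  show "isometry M g (\<lambda>x. a \<otimes>\<^bsub>N\<^esub> x)"
    by (rule isometry_isoF[where a = 0 and a' = 0 and F' = "\<lambda>x. inv\<^bsub>N\<^esub> a \<otimes>\<^bsub>N\<^esub> x",
          OF _ pt_mult[OF a(1)] _ pt_mult[OF a(2)]])
      (use a carrier in \<open>auto simp: mult left_translation_isoF m_assoc[symmetric]\<close>)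
qed

lemma Th_automorphism:
  assumes a: "S a = 0" "a \<in> coord_space m"
  shows "transport (Th a) \<in> isometric_automorphisms N M g"
proof -
  have in_space: "Th b x \<in> coords" if "b \<in> coord_space m" "x \<in> coords" for b x
    using that by simp
  note t = transport[of "Th a", OF in_space[OF a(2)]]
  note t' = transport[of "Th (- a)", OF in_space[OF coord_space_closed(3)[OF a(2)]]]
  have inv: "transport (Th (- a)) (transport (Th a) p) = p \<and> transport (Th a) (transport (Th (- a)) p) = p" if "p \<in> points M" for p
    using that Th_inverse[of a] Th_inverse[of "- a"] by (auto intro!: chart_eqI simp: t t')
  have "isometry M g (transport (Th a))"
    by (rule isometry_isoF[OF a(1), where F' = "transport (Th (- a))"]) (use t t' inv in auto)
  moreover have "transport (Th a) \<in> hom N N"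
    by (rule homI) (auto simp: carrier t mult pt_mult Th_hom[OF a(1)] intro!: chart_eqI)
  moreover have "bij_betw (transport (Th a)) (carrier N) (carrier N)"
    by (rule bij_betw_byWitness[of _ "transport (Th (- a))"]) (use t t' inv carrier in auto)
  ultimately show ?thesis by (simp add: isometric_automorphisms_def iso_def)
qed

lemma isoF_semidirect:
  assumes a: "S a = 0" "a \<in> coord_space m" "h0 \<in> coord_space m"
  shows "transport (isoF c h0 a k) \<in> semidirect_transformations N M g"
proof -
  define b where "b = inv_into (points M) \<phi> (mk c (k - (a \<cdot> h0) / 2) h0)"
  have b: "b \<in> points M" "\<phi> b = mk c (k - (a \<cdot> h0) / 2) h0"
    unfolding b_def using point_of a(3) by simp_all
  have "transport (isoF c h0 a k) x = b \<otimes>\<^bsub>N\<^esub> transport (Th a) x" if "x \<in> points M" for x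
    using that a b by (intro chart_eqI) (simp_all add: transport mult pt_mult isoF_decomp[OF a(1), of c h0 k])
  then show ?thesis unfolding semidirect_transformations_def
    using b(1) Th_automorphism[OF a(1,2)] carrier by auto
qed

text \<open>A one-parameter group of transformations is polynomial jointly in the parameter and the point if
  its coordinate expression is, the parameter being coordinate \<open>0\<close> of the product chart.\<close>

lemma one_param_subgroupI:
  assumes G: "\<And>t. transport (G t) \<in> \<G>"
    and in_space: "\<And>t x. x \<in> coords \<Longrightarrow> G t x \<in> coords"
    and add: "\<And>s t x. G (s + t) x = G s (G t x)"
    and poly: "vpoly (\<lambda>z. G (z 0) (\<lambda>i. z (Suc i)))"
  shows "one_param_subgroup M \<G> (\<lambda>t. transport (G t))"
proof -
  have "smooth_map (prod_manifold (line_manifold UNIV) M) M (\<lambda>(t, x). transport (G t) x)"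
  proof (rule smooth_map_polynomial[OF single_chart_prod[OF single_chart_line[OF open_UNIV] global_chart_single[OF chart]]
        global_chart_single[OF chart]])
    show "polynomial_fun (\<lambda>z. G (z 0) (\<lambda>i. z (Suc i)) k)" for k using poly unfolding vpoly_def by blast
    fix p k assume p: "p \<in> points (prod_manifold (line_manifold UNIV) M)"
    then obtain t x where tx: "p = (t, x)" "x \<in> points M" by (cases p) (simp add: prod_manifold_def)
    then show "(case p of (t, x) \<Rightarrow> transport (G t) x) \<in> points M" using transport(1)[of "G t"] in_space by simp
    have "(\<lambda>i. chart_pair 1 line_coord \<phi> p (Suc i)) = \<phi> x" "chart_pair 1 line_coord \<phi> p 0 = t"
      by (simp_all add: chart_pair_def tx line_coord_def)
    then show "\<phi> (case p of (t, x) \<Rightarrow> transport (G t) x) k = G (chart_pair (mdim (line_manifold UNIV)) line_coord \<phi> p 0)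
        (\<lambda>i. chart_pair (mdim (line_manifold UNIV)) line_coord \<phi> p (Suc i)) k"
      using tx transport(2)[of "G t" x] in_space by simp
  qed
  moreover have "transport (G (s + t)) x = transport (G s) (transport (G t) x)" if "x \<in> points M" for s t x
    using that transport[of "G _"] in_space by (intro chart_eqI) (simp_all add: add)
  ultimately show ?thesis unfolding one_param_subgroup_def using G by blast
qed

text \<open>The vectors \<open>f - e / 2\<close> and \<open>f + e / 2\<close> of the left-invariant frame have square \<open>-1\<close> and \<open>1\<close>; with an
  orthonormal basis of \<open>V\<close> they form an orthonormal frame.\<close>

lemma lorentzian_N: "lorentzian M g"
  unfolding lorentzian_def
proof (intro conjI ballI)
  fix p assume p: "p \<in> points M"
  define X where "X i = (if i = 0 then frame (\<phi> p) 1 (-1/2) 0 else if i = 1 then frame (\<phi> p) 1 (1/2) 0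
    else frame (\<phi> p) 0 0 (unit_coord (i - 2)))" for i :: nat
  have X_in: "X i \<in> coord_space (mdim M)" if "i < mdim M" for i
    using that unit_coord_in[of "i - 2" m] by (auto simp: X_def dim)
  define e where "e i = coord_line (points M, \<phi>) (\<phi> p) (X i)" for i
  note px = global_chart_in[OF chart p]
  have tan: "e i \<in> tangent_curves M p" if "i < mdim M" for i
    unfolding e_def by (rule coord_line_tangent[OF chart px X_in[OF that] p refl])
  have vel: "chart_velocity \<phi> (e i) = X i" if "i < mdim M" for i
    unfolding e_def by (rule coord_line_velocity[OF chart px X_in[OF that]])
  have u: "ip m (unit_coord (i - 2)) (unit_coord (j - 2)) = (if i = j then 1 else 0)"
    if "i < mdim M" "j < mdim M" "i \<ge> 2" "j \<ge> 2" for i j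
    using that by (subst ip_unit) (auto simp: dim unit_coord_def)
  have "g (e i) (e j) = (if i \<noteq> j then 0 else if i = 0 then -1 else 1)" if ij: "i < mdim M" "j < mdim M" for i j
  proof -
    have "g (e i) (e j) = mform (\<phi> p) (X i) (X j)"
      using metric[of "e i"] tan[OF ij(1)] p vel ij by (simp add: tangent_curves_def)
    moreover have "i = 0 \<or> i = 1 \<or> i \<ge> 2" "j = 0 \<or> j = 1 \<or> j \<ge> 2" by linarith+
    ultimately show ?thesis by (elim disjE) (simp_all add: mform_def X_def u[OF ij])
  qed
  then show "\<exists>E. (\<forall>i<mdim M. E i \<in> tangent_curves M p) \<and>
        (\<forall>i<mdim M. \<forall>j<mdim M. g (E i) (E j) = (if i \<noteq> j then 0 else if i = 0 then -1 else 1))"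
    using tan by blast
qed (simp add: dim)

subsection \<open>The nilpotency step\<close>

text \<open>If \<open>x\<close> has no component along \<open>f\<close>, the commutator with \<open>y\<close> acts on the \<open>V\<close>-part as
  \<open>1 - exp (s D)\<close>, where \<open>s\<close> is the \<open>f\<close>-component of \<open>y\<close>. To leading order this is \<open>- s D\<close>, so taking commutators
  applies \<open>D\<close> once more at each step.\<close>

lemma commutator_coords:
  assumes "x \<in> points M" "y \<in> points M" "\<phi> x 0 = 0"
  defines "c \<equiv> x \<otimes>\<^bsub>N\<^esub> y \<otimes>\<^bsub>N\<^esub> inv\<^bsub>N\<^esub> x \<otimes>\<^bsub>N\<^esub> inv\<^bsub>N\<^esub> y"
  shows "c \<in> points M" "\<phi> c 0 = 0" "pv (\<phi> c) = D (ex (Suc 0) (- \<phi> y 0) (pv (\<phi> x)))"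
    and "pv (\<phi> x) = 0 \<Longrightarrow> \<phi> c 1 = 0"
  using assms(1-3) unfolding c_def
  by (simp_all add: mult pt_mult pt_inv chart_inv D_ex1 ex_0)

lemma Dpow_ex: "Dp k (ex j x v) = ex j x (Dp k v)"
  by (induction k) (simp_all add: E_D)

text \<open>On the kernel of \<open>D\<close> only the leading term of the series survives.\<close>

lemma ex_kernel: "D u = 0 \<Longrightarrow> ex j x u = scl (x ^ j / fact j) u"
  using D_ex_Suc[of j x u] E_D[of "Suc j" x u] by simp

lemma subgroup_filtration:
  "subgroup {x \<in> points M. \<phi> x 0 = 0 \<and> Dp k (pv (\<phi> x)) = 0} N"
proof -
  interpret group N by (rule group_N)
  show ?thesis
    by (rule subgroupI) (auto simp: carrier mult pt_mult pt_inv chart_inv one pt_one ex_0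
        Dpow_linear intro!: exI[of _ "\<one>\<^bsub>N\<^esub>"])
qed

text \<open>The commutator map maps the kernel of \<open>D\<^sup>j\<^sup>+\<^sup>1\<close> into the kernel of \<open>D\<^sup>j\<close>. After \<open>r + 1\<close> steps only
  the central coordinate \<open>y\<close> is left, and one further step removes it.\<close>

lemma lower_central_upper:
  "k \<le> r \<Longrightarrow> lower_central N (Suc k) \<subseteq> {x \<in> points M. \<phi> x 0 = 0 \<and> Dp (r - k) (pv (\<phi> x)) = 0}"
proof (induction k)
  case 0
  interpret group N by (rule group_N)
  have "x \<otimes>\<^bsub>N\<^esub> y \<otimes>\<^bsub>N\<^esub> inv\<^bsub>N\<^esub> x \<otimes>\<^bsub>N\<^esub> inv\<^bsub>N\<^esub> y \<in> {x \<in> points M. \<phi> x 0 = 0 \<and> Dp (r - 0) (pv (\<phi> x)) = 0}"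
    if "x \<in> points M" "y \<in> points M" for x y
    using that by (simp add: mult pt_mult pt_inv chart_inv D_nil)
  then show ?case
    unfolding lower_central.simps by (intro generate_subgroup_incl subgroup_filtration) (auto simp: carrier)
next
  case (Suc k)
  interpret group N by (rule group_N)
  have rk: "r - k = Suc (r - Suc k)" using Suc.prems by simp
  have "x \<otimes>\<^bsub>N\<^esub> y \<otimes>\<^bsub>N\<^esub> inv\<^bsub>N\<^esub> x \<otimes>\<^bsub>N\<^esub> inv\<^bsub>N\<^esub> y \<in> {x \<in> points M. \<phi> x 0 = 0 \<and> Dp (r - Suc k) (pv (\<phi> x)) = 0}"
    if "x \<in> lower_central N (Suc k)" "y \<in> points M" for x y
  proof -
    have x: "x \<in> points M" "\<phi> x 0 = 0" "Dp (r - k) (pv (\<phi> x)) = 0"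
      using Suc.IH that Suc.prems by (auto simp del: zero_fun_apply lower_central.simps)
    have "Dp (r - Suc k) (D (ex (Suc 0) (- \<phi> y 0) (pv (\<phi> x)))) = 0"
      using x(3) unfolding Dpow_Suc(2)[symmetric] Dpow_ex rk by (simp only: ex_linear)
    then show ?thesis using commutator_coords[OF x(1) that(2) x(2)] by simp
  qed
  then show ?case
    unfolding lower_central.simps(2)[of N "Suc k"]
    by (intro generate_subgroup_incl subgroup_filtration) (auto simp: carrier)
qed

lemma lower_central_trivial: "lower_central N (Suc (Suc r)) = {\<one>\<^bsub>N\<^esub>}"
proof -
  interpret group N by (rule group_N)
  have "x \<otimes>\<^bsub>N\<^esub> y \<otimes>\<^bsub>N\<^esub> inv\<^bsub>N\<^esub> x \<otimes>\<^bsub>N\<^esub> inv\<^bsub>N\<^esub> y = \<one>\<^bsub>N\<^esub>"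
    if "x \<in> lower_central N (Suc r)" "y \<in> points M" for x y
  proof -
    have x: "x \<in> points M" "\<phi> x 0 = 0" "pv (\<phi> x) = 0" using lower_central_upper[of r] that by auto
    note c = commutator_coords[OF x(1) that(2) x(2)]
    show ?thesis
      by (rule chart_eqI[OF c(1) pt_one], unfold one, rule mk_eqI) (use c x(3) in simp_all)
  qed
  then have "{x \<otimes>\<^bsub>N\<^esub> y \<otimes>\<^bsub>N\<^esub> inv\<^bsub>N\<^esub> x \<otimes>\<^bsub>N\<^esub> inv\<^bsub>N\<^esub> y |x y. x \<in> lower_central N (Suc r) \<and> y \<in> carrier N} \<subseteq> {\<one>\<^bsub>N\<^esub>}"
    by (auto simp: carrier)
  then have "lower_central N (Suc (Suc r)) \<subseteq> {\<one>\<^bsub>N\<^esub>}"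
    unfolding lower_central.simps(2)[of N "Suc r"]
    by (intro generate_subgroup_incl) (auto intro: triv_subgroup)
  moreover have "\<one>\<^bsub>N\<^esub> \<in> lower_central N (Suc (Suc r))"
    unfolding lower_central.simps(2)[of N "Suc r"] by (rule generate.one)
  ultimately show ?thesis by blast
qed

text \<open>Commutators with the single element \<open>exp f\<close>: as the \<open>V\<close>-part \<open>w\<close> of the current element satisfies
  \<open>D\<^sup>j w \<noteq> 0\<close> and \<open>D\<^sup>j\<^sup>+\<^sup>1 w = 0\<close>, the value of \<open>D\<^sup>j\<^sup>-\<^sup>1\<close> on the next \<open>V\<close>-part is \<open>- D\<^sup>j w\<close>. The condition on \<open>D\<^sup>j\<^sup>+\<^sup>1 w\<close> cuts off the
  higher terms of the exponential.\<close>

lemma lower_central_lower: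
  assumes v: "v \<in> coord_space m" "Dp q v \<noteq> 0" "Dp (Suc q) v = 0" and k: "k \<le> q"
  shows "\<exists>x \<in> lower_central N k. x \<in> points M \<and> \<phi> x 0 = 0 \<and> Dp (q - k) (pv (\<phi> x)) \<noteq> 0 \<and>
    Dp (Suc (q - k)) (pv (\<phi> x)) = 0"
  using k
proof (induction k)
  case 0
  have "inv_into (points M) \<phi> (mk 0 0 v) \<in> points M" "\<phi> (inv_into (points M) \<phi> (mk 0 0 v)) = mk 0 0 v"
    using point_of v(1) by simp_all
  then show ?case using v by (intro bexI[of _ "inv_into (points M) \<phi> (mk 0 0 v)"]) (simp_all add: carrier del: zero_fun_apply)
next
  case (Suc k)
  then obtain x where x: "x \<in> lower_central N k" "x \<in> points M" "\<phi> x 0 = 0"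
    "Dp (q - k) (pv (\<phi> x)) \<noteq> 0" "Dp (Suc (q - k)) (pv (\<phi> x)) = 0" by (auto simp del: zero_fun_apply)
  define y where "y = inv_into (points M) \<phi> (mk 1 0 0)"
  have y: "y \<in> points M" "\<phi> y = mk 1 0 0" unfolding y_def using point_of by simp_all
  define c where "c = x \<otimes>\<^bsub>N\<^esub> y \<otimes>\<^bsub>N\<^esub> inv\<^bsub>N\<^esub> x \<otimes>\<^bsub>N\<^esub> inv\<^bsub>N\<^esub> y"
  note cc = commutator_coords[OF x(2) y(1) x(3), folded c_def]
  have qk: "q - k = Suc (q - Suc k)" using Suc.prems by simp
  have c_in: "c \<in> lower_central N (Suc k)"
    unfolding lower_central.simps c_def using x(1) y(1) carrier by (intro generate.incl) blast
  have D1: "Dp (Suc j) (pv (\<phi> x)) = u \<Longrightarrow> Dp j (pv (\<phi> c)) = ex (Suc 0) (-1) u" for j u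
    unfolding cc(3) Dpow_Suc(2)[symmetric] Dpow_ex y(2) by simp
  define u where "u = Dp (q - k) (pv (\<phi> x))"
  have "D u = 0" using x(5) by (simp add: u_def)
  then have "Dp (q - Suc k) (pv (\<phi> c)) = - u"
    using D1[of "q - Suc k" u] ex_kernel[of u "Suc 0" "-1"] by (simp add: u_def qk)
  then have "Dp (q - Suc k) (pv (\<phi> c)) \<noteq> 0" using x(4) by (simp add: u_def)
  moreover have "Dp (Suc (q - Suc k)) (pv (\<phi> c)) = 0"
    using D1[of "Suc (q - Suc k)" 0] x(5) unfolding qk by simp
  ultimately show ?case using cc(1,2) c_in by blast
qed

lemma nilpotent_N: "\<exists>s. nilpotent_of_step N s"
proof -
  define s where "s = (LEAST s. lower_central N s = {\<one>\<^bsub>N\<^esub>})"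
  have "lower_central N s = {\<one>\<^bsub>N\<^esub>}" unfolding s_def by (rule LeastI[of "\<lambda>s. lower_central N s = {\<one>\<^bsub>N\<^esub>}", OF lower_central_trivial])
  moreover have "lower_central N k \<noteq> {\<one>\<^bsub>N\<^esub>}" if "k < s" for k
    using not_less_Least that unfolding s_def by blast
  ultimately show ?thesis unfolding nilpotent_of_step_def by blast
qed

lemma nilpotent_step:
  assumes v: "v \<in> coord_space m" "Dp q v \<noteq> 0"
  shows "\<exists>s>q. nilpotent_of_step N s"
proof -
  \<comment> \<open>The largest exponent with \<open>D\<^sup>q' v \<noteq> 0\<close>, for which \<open>lower_central_lower\<close> applies.\<close>
  have "\<exists>q'\<ge>q. Dp q' v \<noteq> 0 \<and> Dp (Suc q') v = 0"
  proof (rule ccontr)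
    assume c: "\<not> ?thesis"
    have "Dp (q + k) v \<noteq> 0" for k 
    proof (induction k)
      case (Suc k)
      have "q + k \<ge> q" by simp
      then show ?case using c Suc by (metis add_Suc_right)
    qed (use v in \<open>simp del: zero_fun_apply\<close>)
    then have "Dp (q + r) v \<noteq> 0" .
    then show False using D_nil[of v] by (simp add: funpow_add Dpow_linear)
  qed
  then obtain q' where q': "q' \<ge> q" "Dp q' v \<noteq> 0" "Dp (Suc q') v = 0" by blast
  have low: "lower_central N k \<noteq> {\<one>\<^bsub>N\<^esub>}" if "k \<le> q" for k
    using lower_central_lower[OF v(1) q'(2,3), of k] that q'(1) one by (auto simp: Dpow_linear)
  obtain s where s: "nilpotent_of_step N s" using nilpotent_N by blast
  then have "lower_central N s = {\<one>\<^bsub>N\<^esub>}" by (simp add: nilpotent_of_step_def)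
  then show ?thesis using low s not_less by blast
qed

theorem lorentz_nilmanifold_N: "lorentz_nilmanifold N M g"
  unfolding lorentz_nilmanifold_def pseudo_riemannian_nilmanifold_def
  using lie_group_N connected_global_chart[OF chart] nilpotent_N metric_N left_invariant_N lorentzian_N
  by blast

end

section \<open>Geodesics are orbits\<close>

lemma interval_const:
  assumes "is_interval I" "t0 \<in> I" "t \<in> I" "\<And>t. t \<in> I \<Longrightarrow> (f has_real_derivative 0) (at t)"
  shows "f t = f t0"
proof -
  have "(f has_field_derivative 0) (at t within I)" if "t \<in> I" for t
    using assms(4)[OF that] DERIV_subset by blast
  then obtain d where "\<forall>t\<in>I. f t = d"
    using has_field_derivative_zero_constant[of I f] assms(1) is_interval_convex by blast
  then show ?thesis using assms by simp
qed

lemma interval_eqI: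
  assumes "is_interval I" "t0 \<in> I" "t \<in> I" "f t0 = h t0"
    and "\<And>t. t \<in> I \<Longrightarrow> (f has_real_derivative f' t) (at t)"
    and "\<And>t. t \<in> I \<Longrightarrow> (h has_real_derivative f' t) (at t)"
  shows "f t = h t"
proof -
  have "(f t - h t) = f t0 - h t0"
    by (rule interval_const[OF assms(1-3)]) (use DERIV_diff[OF assms(5,6)] in simp)
  then show ?thesis using assms(4) by simp
qed

context nil_data
begin

text \<open>The Christoffel symbols are combinations of derivatives of the metric coefficients with respect to the base
  point. Keeping the direction \<open>Z\<close> as a vector avoids all indices.\<close>

definition dmform :: "vec \<Rightarrow> vec \<Rightarrow> vec \<Rightarrow> vec \<Rightarrow> real" where
  "dmform p Z X Y =
     X 0 * (- (J (pv Z) \<cdot> \<theta> p Y + J (pv p) \<cdot> scl (Y 0) (D (pv Z))) / 2)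
     + Y 0 * (- (J (pv Z) \<cdot> \<theta> p X + J (pv p) \<cdot> scl (X 0) (D (pv Z))) / 2)
     + (scl (X 0) (D (pv Z)) \<cdot> \<theta> p Y + \<theta> p X \<cdot> scl (Y 0) (D (pv Z)))"

lemma mform_deriv:
  assumes "vder p Z t"
  shows "((\<lambda>s. mform (p s) X Y) has_real_derivative dmform (p t) Z X Y) (at t)"
proof -
  note v = vder_pv[OF assms]
  have th: "vder (\<lambda>s. \<theta> (p s) X) (scl (X 0) (D (pv Z))) t" for X
    unfolding \<theta>_def
    by (rule vder_cong_eq[OF vder_add[OF vder_const vder_scl[OF DERIV_const vder_ap[OF v]]]]) simp
  have si: "((\<lambda>s. \<sigma> (p s) X) has_real_derivative
      - (J (pv Z) \<cdot> \<theta> (p t) X + J (pv (p t)) \<cdot> scl (X 0) (D (pv Z))) / 2) (at t)" for X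
    unfolding \<sigma>_def
    by (rule DERIV_cong[OF DERIV_diff[OF DERIV_const DERIV_cdivide[OF vder_ip[OF vder_ap[OF v] th]]]]) (simp add: field_simps)
  show ?thesis
    unfolding mform_def dmform_def
    by (intro DERIV_add DERIV_cmult si vder_ip th)
qed

lemma dmform_linear:
  "dmform p (Z + Z') X Y = dmform p Z X Y + dmform p Z' X Y" "dmform p (scl c Z) X Y = c * dmform p Z X Y"
  "dmform p Z (X + X') Y = dmform p Z X Y + dmform p Z X' Y" "dmform p Z (scl c X) Y = c * dmform p Z X Y"
  "dmform p Z X (Y + Y') = dmform p Z X Y + dmform p Z X Y'" "dmform p Z X (scl c Y) = c * dmform p Z X Y"
  by (simp_all add: dmform_def \<theta>_def scl_add field_simps)

lemma ap_pv_trunc: "ap m A (pv (\<lambda>i. if i < Suc (Suc m) then X i else 0)) = ap m A (pv X)"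
  by (simp add: ap_def pv_def fun_eq_iff)

lemma dmform_trunc:
  "dmform p Z X Y = dmform p (\<lambda>i. if i < Suc (Suc m) then Z i else 0) X Y"
  "dmform p Z X Y = dmform p Z (\<lambda>i. if i < Suc (Suc m) then X i else 0) Y"
  "dmform p Z X Y = dmform p Z X (\<lambda>i. if i < Suc (Suc m) then Y i else 0)"
  by (simp_all add: dmform_def \<theta>_def ip_trunc ap_pv_trunc)

lemma dmform_expand:
  "dmform p Z X Y = (\<Sum>i<Suc (Suc m). Z i * dmform p (unit_coord i) X Y)"
  "dmform p Z X Y = (\<Sum>i<Suc (Suc m). X i * dmform p Z (unit_coord i) Y)"
  "dmform p Z X Y = (\<Sum>i<Suc (Suc m). Y i * dmform p Z X (unit_coord i))"
proof -
  show "dmform p Z X Y = (\<Sum>i<Suc (Suc m). Z i * dmform p (unit_coord i) X Y)"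
    by (rule linear_functional_expand[of "\<lambda>Z. dmform p Z X Y"])
      (simp_all only: dmform_linear dmform_trunc(1)[symmetric])
  show "dmform p Z X Y = (\<Sum>i<Suc (Suc m). X i * dmform p Z (unit_coord i) Y)"
    by (rule linear_functional_expand[of "\<lambda>X. dmform p Z X Y"])
      (simp_all only: dmform_linear dmform_trunc(2)[symmetric])
  show "dmform p Z X Y = (\<Sum>i<Suc (Suc m). Y i * dmform p Z X (unit_coord i))"
    by (rule linear_functional_expand[of "dmform p Z X"])
      (simp_all only: dmform_linear dmform_trunc(3)[symmetric])
qed

lemma mform_expand1: "mform p X Y = (\<Sum>i<Suc (Suc m). Y i * mform p X (unit_coord i))"
  by (rule linear_functional_expand[of "mform p X"])
    (simp_all only: mform_linear mform_trunc[symmetric])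

subsection \<open>One-parameter groups of isometries\<close>

lemma v_shift_unique:
  assumes "\<And>x. vder \<eta> (a - D (\<eta> x)) x"
  shows "\<eta> x = v_shift (\<eta> 0) a x"
proof -
  define f where "f x = \<eta> x - v_shift (\<eta> 0) a x" for x
  have "f x = 0"
  proof (rule linear_ode_unique[of UNIV 0 f "-1"])
    show "f 0 = 0" by (simp add: f_def v_shift_def ex_0)
    show "vder f (scl (- 1) (D (f t))) t" for t
      unfolding f_def
      by (rule vder_cong_eq[OF vder_diff[OF assms vder_v_shift[OF DERIV_ident]]]) (simp add: fun_eq_iff)
  qed auto
  then show ?thesis by (simp add: f_def)
qed

text \<open>A geodesic on which \<open>x\<close> is not constant can be parametrized by \<open>x\<close>. Its \<open>V\<close>-part is then the curve \<open>geo_v\<close>, with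
  initial value \<open>v0\<close> at \<open>x0\<close>; \<open>geo_w\<close> is the \<open>V\<close>-component \<open>z' + D z\<close> of its velocity in the
  left-invariant frame. The curve is an extremal of the Lagrangian \<open>|z' + D z|\<^sup>2 / 2 - \<langle>J z, z' + D z\<rangle> / 2\<close>, and \<open>geo_p\<close> is the conjugate momentum.\<close>

definition geo_v :: "real \<Rightarrow> vec \<Rightarrow> vec \<Rightarrow> real \<Rightarrow> vec" where
  "geo_v x0 v0 b0 x = E (x - x0) v0 + ex (Suc 0) (x - x0) b0 + ex (Suc (Suc 0)) (x - x0) (S b0)"

definition geo_w :: "real \<Rightarrow> vec \<Rightarrow> real \<Rightarrow> vec" where
  "geo_w x0 b0 x = b0 + scl (x - x0) (S b0)"

definition geo_p :: "real \<Rightarrow> vec \<Rightarrow> vec \<Rightarrow> real \<Rightarrow> vec" where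
  "geo_p x0 v0 b0 x = geo_w x0 b0 x - scl (1/2) (J (geo_v x0 v0 b0 x))"

lemma vder_geo_v: "vder (geo_v x0 v0 b0) (geo_w x0 b0 x - D (geo_v x0 v0 b0 x)) x"
proof -
  have d: "((\<lambda>x. x - x0) has_real_derivative 1) (at x)" by (auto intro!: derivative_eq_intros)
  have "vder (geo_v x0 v0 b0) (scl 1 (- D (E (x - x0) v0)) + scl 1 (E (x - x0) b0)
      + scl 1 (ex (Suc 0) (x - x0) (S b0))) x"
    unfolding geo_v_def by (intro vder_add vder_chain[OF _ d] vder_E' vder_ex_Suc')
  then show ?thesis
    by (rule vder_cong_eq) (simp add: geo_v_def geo_w_def D_ex_Suc algebra_simps)
qed

lemma vder_geo_w: "vder (geo_w x0 b0) (S b0) x"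
proof -
  have d: "((\<lambda>x. x - x0) has_real_derivative 1) (at x)" by (auto intro!: derivative_eq_intros)
  show ?thesis
    unfolding geo_w_def by (rule vder_cong_eq[OF vder_add[OF vder_const vder_scl[OF d vder_const]]]) simp
qed

lemma S_geo_w: "S (geo_w x0 b0 x) = S b0"
  by (simp add: geo_w_def)

lemma S_ip: "S b \<cdot> z = J b \<cdot> z + b \<cdot> D z"
  using D_adj[of z b] by (simp add: S_def ip_commute)

lemma vder_geo_p: "vder (geo_p x0 v0 b0) (S b0 - scl (1/2) (J (geo_w x0 b0 x - D (geo_v x0 v0 b0 x)))) x"
  unfolding geo_p_def
  by (rule vder_cong_eq[OF vder_diff[OF vder_geo_w vder_scl[OF DERIV_const vder_ap[OF vder_geo_v]]]]) simp

lemma vder_translate: "(\<And>x. vder f (f' x) x) \<Longrightarrow> vder (\<lambda>x. f (x + c)) (f' (x + c)) x"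
proof -
  assume f: "\<And>x. vder f (f' x) x"
  have "((\<lambda>x. x + c) has_real_derivative 1) (at x)" by (auto intro!: derivative_eq_intros)
  from vder_chain[OF f this] show ?thesis by simp
qed

text \<open>The curves \<open>z\<close> and \<open>x \<mapsto> z (x + c)\<close> are extremals of the same quadratic Lagrangian, so their symplectic product, formed with
  the momenta, is constant.\<close>

lemma geo_v_symplectic:
  fixes x0 v0 b0 c
  defines "z \<equiv> geo_v x0 v0 b0" and "p \<equiv> geo_p x0 v0 b0"
  shows "p (x + c) \<cdot> z x - p x \<cdot> z (x + c) = p c \<cdot> z 0 - p 0 \<cdot> z c"
proof -
  let ?f = "\<lambda>x. p (x + c) \<cdot> z x - p x \<cdot> z (x + c)"
  have "(?f has_real_derivative 0) (at x)" for x
  proof -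
    define b b' s where "b = geo_w x0 b0 x" and "b' = geo_w x0 b0 (x + c)" and "s = S b0"
    define u u' where "u = z x" and "u' = z (x + c)"
    have z1: "vder z (b - D u) x" and z2: "vder (\<lambda>x. z (x + c)) (b' - D u') x"
      unfolding z_def b_def b'_def u_def u'_def by (rule vder_geo_v, rule vder_translate, rule vder_geo_v)
    have p1: "vder p (s - scl (1/2) (J (b - D u))) x"
      and p2: "vder (\<lambda>x. p (x + c)) (s - scl (1/2) (J (b' - D u'))) x"
      unfolding z_def p_def b_def b'_def u_def u'_def s_def by (rule vder_geo_p, rule vder_translate, rule vder_geo_p)
    have pu: "p x = b - scl (1/2) (J u)" "p (x + c) = b' - scl (1/2) (J u')"
      by (simp_all add: p_def geo_p_def z_def b_def b'_def u_def u'_def)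
    have "s \<cdot> w = J b \<cdot> w + b \<cdot> D w" "s \<cdot> w = J b' \<cdot> w + b' \<cdot> D w" for w
      unfolding s_def b_def b'_def by (metis S_geo_w S_ip)+
    note s = this(1)[of u'] this(2)[of u]
    have j: "J b' \<cdot> u = - (J u \<cdot> b')" "J u' \<cdot> b = - (J b \<cdot> u')" "J (D u') \<cdot> u = J u' \<cdot> D u * (-1)"
      "J (D u) \<cdot> u' = - (J u \<cdot> D u')" "J u' \<cdot> D u = J u \<cdot> D u'"
      using J_skew[of b' u] J_skew[of u' b] JD_ip[of u' u] JD_ip[of u u'] J_skew[of u' "D u"] by simp_all
    have "((s - scl (1/2) (J (b' - D u'))) \<cdot> u + p (x + c) \<cdot> (b - D u))
        - ((s - scl (1/2) (J (b - D u))) \<cdot> u' + p x \<cdot> (b' - D u')) = 0"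
      unfolding pu by (simp add: s j ip_commute[of m b' b]) (simp add: j field_simps)
    then show ?thesis
      by (intro DERIV_cong[OF DERIV_diff[OF vder_ip[OF p2 z1] vder_ip[OF p1 z2]]]) (simp add: u_def u'_def)
  qed
  then have "?f x = ?f 0" by (rule scalar_const)
  then show ?thesis by simp
qed

text \<open>The conjugate of the translation \<open>(x, y) \<mapsto> (x + c t, y + \<kappa> t)\<close> by the map
  \<open>(x, y, v) \<mapsto> (x, y - \<langle>P x, v + z x / 2\<rangle>, v + z x)\<close>, where \<open>z\<close> is the \<open>V\<close>-part of a geodesic and \<open>P\<close> its
  momentum. This makes the group law evident. That each map is an isometry is less so: the conjugating map is in general not one,
  but \<open>z (x + c t) - z x\<close> solves \<open>h' = a - D h\<close> with \<open>a\<close> a multiple of \<open>S b0\<close>, hence \<open>S a = 0\<close>.\<close>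

definition geodesic_flow :: "real \<Rightarrow> real \<Rightarrow> vec \<Rightarrow> vec \<Rightarrow> real \<Rightarrow> real \<Rightarrow> vec \<Rightarrow> vec" where
  "geodesic_flow c x0 v0 b0 \<kappa> t p = (let x = p 0; z = geo_v x0 v0 b0; P = geo_p x0 v0 b0 in
     mk (x + c * t)
       (p 1 + \<kappa> * t + P x \<cdot> (pv p - scl (1/2) (z x))
          - P (x + c * t) \<cdot> (pv p - z x + scl (1/2) (z (x + c * t))))
       (pv p + z (x + c * t) - z x))"

lemma geodesic_flow_add: "geodesic_flow c x0 v0 b0 \<kappa> (s + t) p = geodesic_flow c x0 v0 b0 \<kappa> s (geodesic_flow c x0 v0 b0 \<kappa> t p)"
proof -
  have e: "p 0 + c * (s + t) = p 0 + c * t + c * s" by (simp add: algebra_simps)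
  show ?thesis unfolding geodesic_flow_def Let_def e
    by (rule mk_eqI) (simp_all add: algebra_simps)
qed

lemma geodesic_flow_isoF:
  "geodesic_flow c x0 v0 b0 \<kappa> t p = isoF (c * t) (geo_v x0 v0 b0 (c * t) - geo_v x0 v0 b0 0) (scl (c * t) (S b0))
     (\<kappa> * t + (geo_p x0 v0 b0 (c * t) \<cdot> geo_v x0 v0 b0 0 - geo_p x0 v0 b0 0 \<cdot> geo_v x0 v0 b0 (c * t)) / 2) p"
proof -
  define z P a x where "z = geo_v x0 v0 b0" and "P = geo_p x0 v0 b0" and "a = scl (c * t) (S b0)" and "x = p 0"
  have "vder (\<lambda>x. z (x + c * t) - z x) (a - D (z (x + c * t) - z x)) x" for x
    unfolding z_def a_def
    by (rule vder_cong_eq[OF vder_diff[OF vder_translate[OF vder_geo_v] vder_geo_v]])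
      (simp add: geo_w_def scl_add algebra_simps)
  from v_shift_unique[OF this, of x] have v_shift: "v_shift (z (c * t) - z 0) a x = z (x + c * t) - z x" by simp
  have a: "a = P (x + c * t) - P x + scl (1/2) (J (z (x + c * t) - z x))"
    unfolding a_def P_def z_def geo_p_def by (simp add: geo_w_def scl_add algebra_simps)
  \<comment> \<open>The change of \<open>y\<close> contains this symplectic product, which has to be independent of \<open>x\<close>.\<close>
  have k: "P (c * t) \<cdot> z 0 - P 0 \<cdot> z (c * t) = P (x + c * t) \<cdot> z x - P x \<cdot> z (x + c * t)"
    using geo_v_symplectic[of x0 v0 b0 x "c * t"] by (simp add: P_def z_def)
  have j: "J (z (x + c * t)) \<cdot> z x = - (J (z x) \<cdot> z (x + c * t))" by (rule J_skew)
  have "isoF (c * t) (z (c * t) - z 0) a (\<kappa> * t + (P (c * t) \<cdot> z 0 - P 0 \<cdot> z (c * t)) / 2) p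
      = geodesic_flow c x0 v0 b0 \<kappa> t p"
  proof (rule mk_eqI)
    show "isoF (c * t) (z (c * t) - z 0) a (\<kappa> * t + (P (c * t) \<cdot> z 0 - P 0 \<cdot> z (c * t)) / 2) p (Suc 0)
      = geodesic_flow c x0 v0 b0 \<kappa> t p (Suc 0)"
      unfolding k isoF_simps x_def[symmetric] v_shift
      unfolding geodesic_flow_def Let_def mk_simps x_def[symmetric] z_def[symmetric] P_def[symmetric]
      by (subst a) (simp add: j field_simps)
    show "pv (isoF (c * t) (z (c * t) - z 0) a (\<kappa> * t + (P (c * t) \<cdot> z 0 - P 0 \<cdot> z (c * t)) / 2) p)
      = pv (geodesic_flow c x0 v0 b0 \<kappa> t p)"
      unfolding isoF_simps x_def[symmetric] v_shift by (simp add: geodesic_flow_def Let_def z_def x_def)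
  qed (simp add: geodesic_flow_def Let_def)
  then show ?thesis by (simp add: z_def P_def a_def)
qed

lemma geo_v_in [simp]: "v0 \<in> coord_space m \<Longrightarrow> b0 \<in> coord_space m \<Longrightarrow> geo_v x0 v0 b0 x \<in> coord_space m"
  by (simp add: geo_v_def)

lemma vpoly_geodesic_flow: "vpoly (\<lambda>z. geodesic_flow c x0 v0 b0 \<kappa> (z 0) (\<lambda>i. z (Suc i)))"
proof -
  have p: "vpoly (\<lambda>z i. z (Suc i))" by (simp add: vpoly_def polynomial_coord)
  have z: "vpoly (\<lambda>z. geo_v x0 v0 b0 (x z))" if "polynomial_fun x" for x
    unfolding geo_v_def using that
    by (intro vpoly_add vpoly_ex polynomial_diff polynomial_const vpoly_const)
  have P: "vpoly (\<lambda>z. geo_p x0 v0 b0 (x z))" if "polynomial_fun x" for x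
    unfolding geo_p_def geo_w_def using that
    by (intro vpoly_add vpoly_diff vpoly_scl vpoly_ap z polynomial_diff polynomial_const vpoly_const)
  show ?thesis
    unfolding geodesic_flow_def Let_def
    by (intro vpoly_mk vpoly_add vpoly_diff vpoly_scl polynomial_add polynomial_diff polynomial_mult
        polynomial_ip z P vpoly_pv[OF p] polynomial_const polynomial_coord)
qed

text \<open>The corresponding group for geodesics on which \<open>x\<close> is constant: no translation of \<open>x\<close>, and a shift of \<open>v\<close> that is
  proportional to \<open>t\<close> and has velocity \<open>u\<close> at \<open>x0\<close>.\<close>

definition vertical_flow :: "real \<Rightarrow> vec \<Rightarrow> vec \<Rightarrow> real \<Rightarrow> real \<Rightarrow> vec \<Rightarrow> vec" where
  "vertical_flow x0 u a \<kappa> t p = (let h = v_shift u a (p 0 - x0) in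
     mk (p 0) (p 1 + \<kappa> * t - t * (a \<cdot> pv p) - t\<^sup>2 / 2 * (a \<cdot> h) + t / 2 * (J h \<cdot> pv p))
       (pv p + scl t h))"

lemma vertical_flow_add: "vertical_flow x0 u a \<kappa> (s + t) p = vertical_flow x0 u a \<kappa> s (vertical_flow x0 u a \<kappa> t p)"
  unfolding vertical_flow_def Let_def
  by (rule mk_eqI) (simp_all add: scl_add power2_eq_square field_simps)

lemma vertical_flow_isoF: "vertical_flow x0 u a \<kappa> t p = isoF 0 (scl t (v_shift u a (- x0))) (scl t a) (\<kappa> * t) p"
proof -
  have d: "((\<lambda>x. x - x0) has_real_derivative 1) (at x)" for x by (auto intro!: derivative_eq_intros)
  have "vder (\<lambda>x. scl t (v_shift u a (x - x0))) (scl t a - D (scl t (v_shift u a (x - x0)))) x" for x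
    by (rule vder_cong_eq[OF vder_scl[OF DERIV_const vder_v_shift[OF d]]]) (simp add: scl_add)
  from v_shift_unique[OF this] have v_shift: "v_shift (scl t (v_shift u a (- x0))) (scl t a) x = scl t (v_shift u a (x - x0))" for x
    by simp
  show ?thesis
    by (rule mk_eqI) (simp_all add: v_shift, simp_all add: vertical_flow_def Let_def power2_eq_square algebra_simps)
qed

lemma vpoly_vertical_flow: "vpoly (\<lambda>z. vertical_flow x0 u a \<kappa> (z 0) (\<lambda>i. z (Suc i)))"
proof -
  have p: "vpoly (\<lambda>z i. z (Suc i))" by (simp add: vpoly_def polynomial_coord)
  show ?thesis
    unfolding vertical_flow_def Let_def
    by (intro vpoly_mk vpoly_add vpoly_scl polynomial_add polynomial_diff polynomial_mult
        polynomial_ip vpoly_v_shift vpoly_ap vpoly_pv[OF p] polynomial_const polynomial_coord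
        polynomial_power polynomial_divide_const vpoly_const)
qed

end

context nil_model
begin

lemma metric_comp_eq:
  "x \<in> coords \<Longrightarrow> i < Suc (Suc m) \<Longrightarrow> j < Suc (Suc m) \<Longrightarrow>
    metric_comp g (points M, \<phi>) i j x = mform x (unit_coord i) (unit_coord j)"
  by (rule metric_comp_global[OF chart, where \<Gamma> = mform]) (use metric dim in auto)

lemma partial_metric_comp:
  assumes x: "x \<in> coords" and i: "i < Suc (Suc m)" and jk: "j < Suc (Suc m)" "k < Suc (Suc m)"
  shows "partial_deriv i (metric_comp g (points M, \<phi>) j k) x = dmform x (unit_coord i) (unit_coord j) (unit_coord k)"
proof -
  have "metric_comp g (points M, \<phi>) j k (x(i := t)) = mform (x(i := t)) (unit_coord j) (unit_coord k)" for t
    by (rule metric_comp_eq[OF coord_space_upd[OF x i] jk])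
  moreover have "vder (\<lambda>t. x(i := t)) (unit_coord i) (x i)"
    unfolding vder_def
  proof
    fix l show "((\<lambda>t. (x(i := t)) l) has_real_derivative unit_coord i l) (at (x i))"
      by (cases "l = i") (simp_all add: unit_coord_def)
  qed
  from mform_deriv[OF this, of "unit_coord j" "unit_coord k"]
  have "((\<lambda>t. mform (x(i := t)) (unit_coord j) (unit_coord k)) has_real_derivative
      dmform x (unit_coord i) (unit_coord j) (unit_coord k)) (at (x i))" by (simp only: fun_upd_triv)
  ultimately show ?thesis unfolding partial_deriv_def by (simp only: DERIV_imp_deriv)
qed

text \<open>The index form of the geodesic equation, paired with a free vector \<open>W\<close>. The first two Christoffel terms
  agree after symmetrization in the velocities.\<close>

lemma geodesic_contracted:
  assumes geo: "geodesic M g I \<gamma>" and t: "t \<in> I"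
  defines "q1 \<equiv> (\<lambda>k. deriv (\<lambda>s. \<phi> (\<gamma> s) k) t)"
    and "q2 \<equiv> (\<lambda>k. deriv (deriv (\<lambda>s. \<phi> (\<gamma> s) k)) t)"
  shows "mform (\<phi> (\<gamma> t)) W q2 + dmform (\<phi> (\<gamma> t)) q1 W q1 - dmform (\<phi> (\<gamma> t)) W q1 q1 / 2 = 0"
proof -
  let ?n = "Suc (Suc m)" and ?c = "(points M, \<phi>)"
  define x where "x = \<phi> (\<gamma> t)"
  have g: "open I" "smooth_curve M I \<gamma>" using geo by (simp_all add: geodesic_def)
  have "\<gamma> ` I \<subseteq> points M"
    using g(2) continuous_map_image_subset_topspace unfolding smooth_curve_def smooth_map_def by force
  then have \<gamma>t: "\<gamma> t \<in> points M" using t by blast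
  then have x: "x \<in> coord_space ?n" by (simp add: x_def)
  have A: "atlas M = {?c}" using chart by (simp add: global_chart_def single_chart_def)
  have eq: "(\<Sum>l<?n. metric_comp g ?c k l x * q2 l) +
      (\<Sum>i<?n. \<Sum>j<?n. christoffel1 g ?c k i j x * q1 i * q1 j) = 0" if k: "k < ?n" for k
    using geo t \<gamma>t k unfolding geodesic_def A by (simp add: dim x_def q1_def q2_def)
  have eq': "mform x (unit_coord k) q2 + dmform x q1 (unit_coord k) q1 - dmform x (unit_coord k) q1 q1 / 2 = 0"
    if k: "k < ?n" for k
  proof -
    let ?e = "\<lambda>i. unit_coord i :: vec"
    have 1: "(\<Sum>l<?n. metric_comp g ?c k l x * q2 l) = mform x (?e k) q2"
      unfolding mform_expand1[of x "?e k" q2] by (intro sum.cong) (simp_all add: metric_comp_eq[OF x k])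
    have c: "christoffel1 g ?c k i j x =
        (dmform x (?e i) (?e k) (?e j) + dmform x (?e j) (?e k) (?e i) - dmform x (?e k) (?e i) (?e j)) / 2"
      if "i < ?n" "j < ?n" for i j
      unfolding christoffel1_def using partial_metric_comp[OF x] that k by simp
    have e1: "dmform x q1 (?e k) q1 = (\<Sum>i<?n. \<Sum>j<?n. dmform x (?e i) (?e k) (?e j) * q1 i * q1 j)"
      unfolding dmform_expand(1)[of x q1 "?e k" q1]
      by (intro sum.cong refl, subst dmform_expand(3)) (simp only: sum_distrib_left mult_ac)
    have e2: "dmform x q1 (?e k) q1 = (\<Sum>i<?n. \<Sum>j<?n. dmform x (?e j) (?e k) (?e i) * q1 i * q1 j)"
      unfolding dmform_expand(3)[of x q1 "?e k" q1]
      by (intro sum.cong refl, subst dmform_expand(1)) (simp only: sum_distrib_left mult_ac)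
    have e3: "dmform x (?e k) q1 q1 = (\<Sum>i<?n. \<Sum>j<?n. dmform x (?e k) (?e i) (?e j) * q1 i * q1 j)"
      unfolding dmform_expand(2)[of x "?e k" q1 q1]
      by (intro sum.cong refl, subst dmform_expand(3)) (simp only: sum_distrib_left mult_ac)
    have "(\<Sum>i<?n. \<Sum>j<?n. christoffel1 g ?c k i j x * q1 i * q1 j) =
      (\<Sum>i<?n. \<Sum>j<?n. (dmform x (?e i) (?e k) (?e j) * q1 i * q1 j
          + dmform x (?e j) (?e k) (?e i) * q1 i * q1 j - dmform x (?e k) (?e i) (?e j) * q1 i * q1 j) / 2)"
      by (intro sum.cong refl) (simp only: c lessThan_iff, simp add: algebra_simps)
    also have "\<dots> = (dmform x q1 (?e k) q1 + dmform x q1 (?e k) q1 - dmform x (?e k) q1 q1) / 2"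
      unfolding sum_divide_distrib[symmetric] sum.distrib sum_subtractf e1[symmetric] e2[symmetric] e3[symmetric] ..
    finally show ?thesis using eq[OF k] 1 by simp
  qed
  have "mform x W q2 + dmform x q1 W q1 - dmform x W q1 q1 / 2 =
     (\<Sum>k<?n. W k * (mform x (unit_coord k) q2 + dmform x q1 (unit_coord k) q1 - dmform x (unit_coord k) q1 q1 / 2))"
  proof -
    have "mform x W q2 = (\<Sum>k<?n. W k * mform x (unit_coord k) q2)"
      using mform_expand1[of x q2 W] by (simp add: mform_sym)
    then show ?thesis
      unfolding dmform_expand(2)[of x q1 W q1] dmform_expand(1)[of x W q1 q1]
      by (simp only: sum.distrib sum_subtractf right_diff_distrib distrib_left sum_divide_distrib times_divide_eq_right)
  qed
  also have "\<dots> = 0" by (intro sum.neutral ballI) (simp add: eq')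
  finally show ?thesis by (simp add: x_def)
qed

text \<open>In the left-invariant frame the \<open>x\<close>-component of the velocity is a constant \<open>c\<close>, and its other components
  obey the Euler equations \<open>w' = c S w\<close> and \<open>s' = - \<langle>S w, w\<rangle>\<close>. As \<open>S\<^sup>2 = 0\<close>, the vector \<open>S w\<close> is constant, so
  \<open>w\<close> is affine and \<open>s\<close> quadratic in time; this is the step that fails for general \<open>J\<close> and \<open>D\<close>.\<close>

lemma geodesic_velocity:
  assumes geo: "geodesic M g I \<gamma>" and t0: "t0 \<in> I"
  obtains c w0 s0 where "w0 \<in> coord_space m"
    and "\<And>t. t \<in> I \<Longrightarrow> \<phi> (\<gamma> t) 0 = \<phi> (\<gamma> t0) 0 + c * (t - t0)"
    and "\<And>t. t \<in> I \<Longrightarrow> vder (\<lambda>t. pv (\<phi> (\<gamma> t)))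
           (w0 + scl (c * (t - t0)) (S w0) - scl c (D (pv (\<phi> (\<gamma> t))))) t"
    and "\<And>t. t \<in> I \<Longrightarrow> ((\<lambda>t. \<phi> (\<gamma> t) 1) has_real_derivative
           s0 - (t - t0) * (S w0 \<cdot> w0) - c * (t - t0)\<^sup>2 / 2 * (S w0 \<cdot> S w0)
             + (J (pv (\<phi> (\<gamma> t))) \<cdot> (w0 + scl (c * (t - t0)) (S w0))) / 2) (at t)"
proof -
  define q where "q = (\<lambda>t. \<phi> (\<gamma> t))"
  define q1 where "q1 t = (\<lambda>k. deriv (\<lambda>s. \<phi> (\<gamma> s) k) t)" for t
  define q2 where "q2 t = (\<lambda>k. deriv (deriv (\<lambda>s. \<phi> (\<gamma> s) k)) t)" for t
  have I: "open I" "is_interval I" "smooth_curve M I \<gamma>" using geo by (simp_all add: geodesic_def)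
  have "\<gamma> ` I \<subseteq> points M"
    using I(3) continuous_map_image_subset_topspace unfolding smooth_curve_def smooth_map_def by force
  then have q_in: "q t \<in> coords" if "t \<in> I" for t using that by (auto simp: q_def)
  have evI: "eventually (\<lambda>t. t \<in> I) (nhds t)" if "t \<in> I" for t
    using I(1) that eventually_nhds_in_open by blast
  have high: "((\<lambda>s. \<phi> (\<gamma> s) k) has_real_derivative 0) (at t)" if "t \<in> I" "Suc (Suc m) \<le> k" for t k
  proof -
    have ev: "eventually (\<lambda>s. \<phi> (\<gamma> s) k = 0) (nhds t)"
      using evI[OF that(1)] by (rule eventually_mono) (use q_in that(2) in \<open>auto simp: q_def coord_space_iff\<close>)
    show ?thesis using DERIV_cong_ev[OF refl ev refl] by simp
  qed
  have d1: "vder q (q1 t) t" if "t \<in> I" for t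
    unfolding vder_def
  proof
    fix k show "((\<lambda>s. q s k) has_real_derivative q1 t k) (at t)"
    proof (cases "k < Suc (Suc m)")
      case True
      then show ?thesis
        using smooth_curve_differentiable(1)[OF global_chart_single[OF chart] I(1,3) that] dim
        by (simp add: q_def q1_def DERIV_deriv_iff_real_differentiable)
    next
      case False
      then show ?thesis using high[OF that, of k] DERIV_imp_deriv unfolding q_def q1_def by (metis not_less)
    qed
  qed
  have d2: "vder q1 (q2 t) t" if "t \<in> I" for t
    unfolding vder_def
  proof
    fix k show "((\<lambda>s. q1 s k) has_real_derivative q2 t k) (at t)"
    proof (cases "k < Suc (Suc m)")
      case True
      then show ?thesis
        using smooth_curve_differentiable(2)[OF global_chart_single[OF chart] I(1,3) that] dim
        by (simp add: q1_def q2_def DERIV_deriv_iff_real_differentiable)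
    next
      case False
      have ev: "eventually (\<lambda>s. q1 s k = 0) (nhds t)"
        using evI[OF that] by (rule eventually_mono) (use high[of _ k] False in \<open>auto simp: q1_def intro!: DERIV_imp_deriv\<close>)
      then have "((\<lambda>s. q1 s k) has_real_derivative 0) (at t)" using DERIV_cong_ev[OF refl ev refl] by simp
      moreover from this have "q2 t k = 0" unfolding q1_def q2_def by (rule DERIV_imp_deriv)
      ultimately show ?thesis by simp
    qed
  qed
  have eq: "mform (q t) W (q2 t) + dmform (q t) (q1 t) W (q1 t) - dmform (q t) W (q1 t) (q1 t) / 2 = 0"
    if "t \<in> I" for t W
    using geodesic_contracted[OF geo that, of W] by (simp add: q_def q1_def q2_def)
  have q1_in: "pv (q1 t) \<in> coord_space m" and q2_in: "pv (q2 t) \<in> coord_space m" if "t \<in> I" for t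
  proof -
    have "((\<lambda>s. q s k) has_real_derivative 0) (at t)" if "t \<in> I" "Suc (Suc m) \<le> k" for t k
      unfolding q_def by (rule high[OF that])
    moreover from this have z: "q1 t k = 0" if "t \<in> I" "Suc (Suc m) \<le> k" for t k
      using that d1[OF that(1)] DERIV_unique unfolding vder_def by blast
    moreover have "q2 t k = 0" if "t \<in> I" "Suc (Suc m) \<le> k" for t k
    proof -
      have ev: "eventually (\<lambda>s. q1 s k = 0) (nhds t)"
        using evI[OF that(1)] by (rule eventually_mono) (use z that in auto)
      have "((\<lambda>s. q1 s k) has_real_derivative 0) (at t)" using DERIV_cong_ev[OF refl ev refl] by simp
      then show ?thesis using d2[OF that(1)] DERIV_unique unfolding vder_def by blast
    qed
    ultimately show "pv (q1 t) \<in> coord_space m" "pv (q2 t) \<in> coord_space m"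
      using that by (auto simp: coord_space_iff pv_def)
  qed
  \<comment> \<open>The vector field \<open>e\<close> is parallel and null; pairing with it gives that \<open>x\<close> is affine.\<close>
  have x2: "q2 t 0 = 0" if "t \<in> I" for t
    using eq[OF that, of "mk 0 1 0"] by (simp add: mform_def dmform_def \<theta>_def \<sigma>_def)
  define c where "c = q1 t0 0"
  have c: "q1 t 0 = c" if "t \<in> I" for t
    unfolding c_def
    by (rule interval_const[OF I(2) t0 that]) (use vder_comp[OF d2, of _ 0] x2 in simp)
  define w where "w t = \<theta> (q t) (q1 t)" for t
  define s where "s t = \<sigma> (q t) (q1 t)" for t
  have w_eq: "w t = pv (q1 t) + scl c (D (pv (q t)))" if "t \<in> I" for t
    by (simp add: w_def \<theta>_def c[OF that])
  have w_in: "w t \<in> coord_space m" if "t \<in> I" for t using q1_in[OF that] by (simp add: w_eq[OF that])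
  \<comment> \<open>Pairing with the coordinate vectors of \<open>V\<close>, which does not involve the component along \<open>e\<close>.\<close>
  have w': "pv (q2 t) + scl c (D (pv (q1 t))) = scl c (S (w t))" if "t \<in> I" for t
  proof (rule vec_eq_ipI[of _ m])
    fix u
    define v v1 v2 where "v = pv (q t)" and "v1 = pv (q1 t)" and "v2 = pv (q2 t)"
    have th: "\<theta> (q t) (q1 t) = v1 + scl c (D v)" by (simp add: \<theta>_def v_def v1_def c[OF that])
    have "S (v1 + scl c (D v)) \<cdot> u = J v1 \<cdot> u + v1 \<cdot> D u + c * (J (D v) \<cdot> u + D v \<cdot> D u)"
      using S_ip[of v1 u] S_ip[of "D v" u] by (simp add: algebra_simps)
    moreover have "u \<cdot> v2 + (- (c * (J v1 \<cdot> u)) / 2 + c * (u \<cdot> D v1))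
       - (2 * c * (- (J u \<cdot> (v1 + scl c (D v)) + c * (J v \<cdot> D u)) / 2) + 2 * c * (D u \<cdot> (v1 + scl c (D v)))) / 2 = 0"
      using eq[OF that, of "mk 0 0 u"]
      by (simp add: mform_def dmform_def th c[OF that] \<theta>_def[of _ "mk 0 0 u"] \<theta>_def[of _ "q2 t"] \<sigma>_def[of _ "mk 0 0 u"]
          x2[OF that] flip: v_def v1_def v2_def) (simp add: ip_commute field_simps)
    moreover have "J u \<cdot> v1 = - (J v1 \<cdot> u)" "J u \<cdot> D v = - (J (D v) \<cdot> u)" "J v \<cdot> D u = - (J (D v) \<cdot> u)"
      using J_skew[of u v1] J_skew[of u "D v"] JD_ip[of v u] by simp_all
    ultimately show "(pv (q2 t) + scl c (D (pv (q1 t)))) \<cdot> u = scl c (S (w t)) \<cdot> u"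
      unfolding w_def th v1_def[symmetric] v2_def[symmetric]
      by (simp add: ip_commute[of m u] ip_commute[of m "D u"] field_simps)
  qed (use q2_in[OF that] in simp_all)
  have dw: "vder w (scl c (S (w t))) t" if "t \<in> I" for t
  proof -
    have d: "vder (\<lambda>t. pv (q1 t) + scl c (D (pv (q t)))) (scl c (S (w t))) t"
      by (rule vder_cong_eq[OF vder_add[OF vder_pv[OF d2[OF that]]
            vder_scl[OF DERIV_const vder_ap[OF vder_pv[OF d1[OF that]]]]]]) (use w'[OF that] in simp)
    show ?thesis
      unfolding vder_def
    proof
      fix i
      have ev: "eventually (\<lambda>t. w t i = (pv (q1 t) + scl c (D (pv (q t)))) i) (nhds t)"
        using evI[OF that] by (rule eventually_mono) (simp only: w_eq)
      show "((\<lambda>t. w t i) has_real_derivative scl c (S (w t)) i) (at t)"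
        using DERIV_cong_ev[OF refl ev refl] vder_comp[OF d, of i] by blast
    qed
  qed
  define w0 where "w0 = w t0"
  have Sw: "S (w t) = S w0" if "t \<in> I" for t
  proof
    fix i
    have "vder (\<lambda>t. S (w t)) 0 t" if "t \<in> I" for t
      unfolding S_def
      by (rule vder_cong_eq[OF vder_add[OF vder_ap[OF dw[OF that]] vder_ap[OF dw[OF that]]]])
        (metis S_S S_def ap_scl scl_add(1) scl_simps(3))
    then show "S (w t) i = S w0 i"
      unfolding w0_def by (intro interval_const[OF I(2) t0 that]) (simp add: vder_def)
  qed
  have w_form: "w t = w0 + scl (c * (t - t0)) (S w0)" if "t \<in> I" for t
  proof
    fix i
    show "w t i = (w0 + scl (c * (t - t0)) (S w0)) i"
    proof (rule interval_eqI[OF I(2) t0 that])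
      show "((\<lambda>t. w t i) has_real_derivative c * S w0 i) (at t)" if "t \<in> I" for t
        using dw[OF that] Sw[OF that] by (simp add: vder_def)
      show "((\<lambda>t. (w0 + scl (c * (t - t0)) (S w0)) i) has_real_derivative c * S w0 i) (at t)" for t
        by (auto intro!: derivative_eq_intros)
    qed (simp add: w0_def)
  qed
  \<comment> \<open>Pairing with the vector \<open>(1, 0, - D v)\<close>, on which \<open>\<theta>\<close> and \<open>\<sigma>\<close> vanish, isolates the remaining component.\<close>
  have ds: "(s has_real_derivative - (S w0 \<cdot> w t)) (at t)" if "t \<in> I" for t
  proof -
    define v v1 v2 where "v = pv (q t)" and "v1 = pv (q1 t)" and "v2 = pv (q2 t)"
    note dq = d1[OF that] and dq1 = d2[OF that]
    have "((\<lambda>t. q1 t 1 - (J (pv (q t)) \<cdot> w t) / 2) has_real_derivative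
        q2 t 1 - (J v1 \<cdot> w t + J v \<cdot> scl c (S (w t))) / 2) (at t)"
      unfolding v_def v1_def
      by (intro DERIV_diff vder_comp[OF dq1] DERIV_cdivide vder_ip vder_ap vder_pv[OF dq] dw[OF that])
    moreover have "q2 t 1 - (J v1 \<cdot> w t + J v \<cdot> scl c (S (w t))) / 2 = - (S w0 \<cdot> w t)"
    proof -
      have th: "\<theta> (q t) (q1 t) = w t" by (simp add: w_def)
      have "q2 t 1 - (J v \<cdot> v2) / 2 + (- (J v1 \<cdot> w t + c * (J v \<cdot> D v1)) / 2 + c * (- (J v \<cdot> D v1) / 2)
           + D v1 \<cdot> w t) - (2 * c * ((J (D v) \<cdot> w t + c * (J v \<cdot> D (D v))) / 2)
            - 2 * c * (D (D v) \<cdot> w t)) / 2 = 0"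
        using eq[OF that, of "mk 1 0 (- D v)"]
        by (simp add: mform_def dmform_def th c[OF that] \<theta>_def[of _ "mk 1 0 (- D v)"] \<theta>_def[of _ "q2 t"] \<sigma>_def
            x2[OF that] flip: v_def v1_def v2_def) (simp add: ip_commute field_simps)
      moreover have "scl c (S (w t)) = v2 + scl c (D v1)" unfolding v1_def v2_def w'[OF that] ..
      moreover have "S w0 \<cdot> w t = D (w t) \<cdot> w t"
        using S_ip[of "w t" "w t"] Sw[OF that] ip_commute[of m "w t" "D (w t)"] by simp
      moreover have "D (w t) \<cdot> w t = D v1 \<cdot> w t + c * (D (D v) \<cdot> w t)"
        by (simp add: w_eq[OF that] v_def v1_def algebra_simps)
      moreover have "J (D v) \<cdot> w t = - (J v \<cdot> D v1) - c * (J v \<cdot> D (D v))"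
        using JD_ip[of v "w t"] by (simp add: w_eq[OF that] v_def v1_def algebra_simps)
      ultimately show ?thesis by (simp add: field_simps)
    qed
    ultimately have "((\<lambda>t. q1 t 1 - (J (pv (q t)) \<cdot> w t) / 2) has_real_derivative - (S w0 \<cdot> w t)) (at t)"
      by simp
    then show ?thesis unfolding s_def[abs_def] \<sigma>_def w_def[symmetric] .
  qed
  define s0 where "s0 = s t0"
  have s_form: "s t = s0 - (t - t0) * (S w0 \<cdot> w0) - c * (t - t0)\<^sup>2 / 2 * (S w0 \<cdot> S w0)" if "t \<in> I" for t
  proof (rule interval_eqI[OF I(2) t0 that])
    show "(s has_real_derivative - (S w0 \<cdot> w0) - c * (t - t0) * (S w0 \<cdot> S w0)) (at t)" if "t \<in> I" for t
      using ds[OF that] by (simp add: w_form[OF that])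
    show "((\<lambda>t. s0 - (t - t0) * (S w0 \<cdot> w0) - c * (t - t0)\<^sup>2 / 2 * (S w0 \<cdot> S w0)) has_real_derivative
        - (S w0 \<cdot> w0) - c * (t - t0) * (S w0 \<cdot> S w0)) (at t)" for t
      by (auto intro!: derivative_eq_intros)
  qed (simp add: s0_def)
  show ?thesis
  proof (rule that[of w0 c s0])
    show "w0 \<in> coord_space m" unfolding w0_def by (rule w_in[OF t0])
    show "\<phi> (\<gamma> t) 0 = \<phi> (\<gamma> t0) 0 + c * (t - t0)" if "t \<in> I" for t
    proof (rule interval_eqI[OF I(2) t0 that])
      show "((\<lambda>t. \<phi> (\<gamma> t) 0) has_real_derivative c) (at t)" if "t \<in> I" for t
        using vder_comp[OF d1[OF that], of 0] c[OF that] by (simp add: q_def)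
      show "((\<lambda>t. \<phi> (\<gamma> t0) 0 + c * (t - t0)) has_real_derivative c) (at t)" for t
        by (auto intro!: derivative_eq_intros)
    qed simp
    show "vder (\<lambda>t. pv (\<phi> (\<gamma> t))) (w0 + scl (c * (t - t0)) (S w0) - scl c (D (pv (\<phi> (\<gamma> t))))) t"
      if "t \<in> I" for t
    proof -
      have "pv (q1 t) = w0 + scl (c * (t - t0)) (S w0) - scl c (D (pv (q t)))"
        using w_form[OF that] w_eq[OF that] by (metis add_diff_cancel_right')
      then show ?thesis using vder_pv[OF d1[OF that]] by (simp add: q_def)
    qed
    show "((\<lambda>t. \<phi> (\<gamma> t) 1) has_real_derivative
           s0 - (t - t0) * (S w0 \<cdot> w0) - c * (t - t0)\<^sup>2 / 2 * (S w0 \<cdot> S w0)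
             + (J (pv (\<phi> (\<gamma> t))) \<cdot> (w0 + scl (c * (t - t0)) (S w0))) / 2) (at t)" if "t \<in> I" for t
    proof -
      have "q1 t 1 = s t + (J (pv (q t)) \<cdot> w t) / 2" by (simp add: s_def \<sigma>_def w_def)
      then have e: "q1 t 1 = s0 - (t - t0) * (S w0 \<cdot> w0) - c * (t - t0)\<^sup>2 / 2 * (S w0 \<cdot> S w0)
             + (J (pv (\<phi> (\<gamma> t))) \<cdot> (w0 + scl (c * (t - t0)) (S w0))) / 2"
        unfolding s_form[OF that] w_form[OF that] by (simp only: q_def)
      show ?thesis using vder_comp[OF d1[OF that], of 1] unfolding e unfolding q_def .
    qed
  qed
qed

end

context nil_data
begin

text \<open>The orbit through the initial point of the geodesic has the velocity found in \<open>geodesic_velocity\<close>, with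
  \<open>w0 = c b0\<close> as \<open>x\<close> has velocity \<open>c\<close>. The value of \<open>\<kappa>\<close> is forced by the initial \<open>\<sigma>\<close>-component \<open>s0\<close>.\<close>

lemma geodesic_flow_orbit:
  fixes c s0 :: real and p0 b0 :: vec
  defines "o\<tau> \<equiv> \<lambda>t. geodesic_flow c (p0 0) (pv p0) b0 (s0 + c / 2 * (b0 \<cdot> b0)) t p0" and "w0 \<equiv> scl c b0"
  shows "o\<tau> 0 = p0" and "o\<tau> t 0 = p0 0 + c * t"
    and "vder (\<lambda>t. pv (o\<tau> t)) (w0 + scl (c * t) (S w0) - scl c (D (pv (o\<tau> t)))) t"
    and "((\<lambda>t. o\<tau> t 1) has_real_derivative
       s0 - t * (S w0 \<cdot> w0) - c * t\<^sup>2 / 2 * (S w0 \<cdot> S w0)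
         + (J (pv (o\<tau> t)) \<cdot> (w0 + scl (c * t) (S w0))) / 2) (at t)"
proof -
  define x0 v0 z P where "x0 = p0 0" and "v0 = pv p0" and "z = geo_v x0 v0 b0" and "P = geo_p x0 v0 b0"
  define \<kappa> where "\<kappa> = s0 + c / 2 * (b0 \<cdot> b0)"
  have z0: "z x0 = v0" by (simp add: z_def geo_v_def ex_0)
  have pvo: "pv (o\<tau> t) = z (x0 + c * t)" for t
    by (simp add: o\<tau>_def geodesic_flow_def Let_def z_def[symmetric] x0_def[symmetric] v0_def[symmetric] z0)
  have yo: "o\<tau> t 1 = p0 1 + \<kappa> * t + P x0 \<cdot> scl (1/2) v0 - P (x0 + c * t) \<cdot> scl (1/2) (z (x0 + c * t))" for t
    by (simp add: o\<tau>_def geodesic_flow_def Let_def z_def[symmetric] P_def[symmetric] x0_def[symmetric] v0_def[symmetric]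
        \<kappa>_def z0)
  show "o\<tau> t 0 = p0 0 + c * t" for t by (simp add: o\<tau>_def geodesic_flow_def Let_def)
  show "o\<tau> 0 = p0"
    by (rule mk_eqI)
      (use yo[of 0] in \<open>simp_all add: pvo z0 v0_def\<close>, simp add: o\<tau>_def geodesic_flow_def Let_def)
  have d: "((\<lambda>t. x0 + c * t) has_real_derivative c) (at t)" by (auto intro!: derivative_eq_intros)
  define b u where "b = geo_w x0 b0 (x0 + c * t)" and "u = z (x0 + c * t)"
  have b: "b = b0 + scl (c * t) (S b0)" by (simp add: b_def geo_w_def)
  have zd: "vder (\<lambda>t. z (x0 + c * t)) (scl c (b - D u)) t"
    unfolding z_def b_def u_def by (rule vder_chain[OF vder_geo_v d])
  then show "vder (\<lambda>t. pv (o\<tau> t)) (w0 + scl (c * t) (S w0) - scl c (D (pv (o\<tau> t)))) t"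
    unfolding pvo by (rule vder_cong_eq) (simp add: b w0_def u_def scl_add mult_ac)
  have Pd: "vder (\<lambda>t. P (x0 + c * t)) (scl c (S b0 - scl (1/2) (J (b - D u)))) t"
    unfolding P_def z_def b_def u_def by (rule vder_chain[OF vder_geo_p d])
  have Pu: "P (x0 + c * t) = b - scl (1/2) (J u)" by (simp add: P_def geo_p_def b_def u_def z_def)
  have h2: "vder (\<lambda>t. scl (1/2) (z (x0 + c * t))) (scl (1/2) (scl c (b - D u))) t"
    by (rule vder_cong_eq[OF vder_scl[OF DERIV_const zd]]) simp
  have "((\<lambda>t. p0 1 + \<kappa> * t + P x0 \<cdot> scl (1/2) v0 - P (x0 + c * t) \<cdot> scl (1/2) (z (x0 + c * t)))
      has_real_derivative \<kappa> - (scl c (S b0 - scl (1/2) (J (b - D u))) \<cdot> scl (1/2) u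
         + P (x0 + c * t) \<cdot> scl (1/2) (scl c (b - D u)))) (at t)"
    unfolding u_def
    by (intro DERIV_diff[OF _ vder_ip[OF Pd h2, unfolded u_def]]) (auto intro!: derivative_eq_intros)
  moreover have "\<kappa> - (scl c (S b0 - scl (1/2) (J (b - D u))) \<cdot> scl (1/2) u
         + P (x0 + c * t) \<cdot> scl (1/2) (scl c (b - D u))) =
       s0 - t * (S w0 \<cdot> w0) - c * t\<^sup>2 / 2 * (S w0 \<cdot> S w0) + (J u \<cdot> (w0 + scl (c * t) (S w0))) / 2"
  proof -
    have "S b0 = S b" unfolding b_def by (simp add: S_geo_w)
    then have e1: "S b0 \<cdot> u = b \<cdot> D u - J u \<cdot> b"
      using S_ip[of b u] J_skew[of b u] by simp
    have e2: "J b \<cdot> u = - (J u \<cdot> b)" "J (D u) \<cdot> u = - (J u \<cdot> D u)" by (rule J_skew, rule JD_ip)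
    have "\<kappa> - (scl c (S b0 - scl (1/2) (J (b - D u))) \<cdot> scl (1/2) u
         + P (x0 + c * t) \<cdot> scl (1/2) (scl c (b - D u))) = \<kappa> - c / 2 * (b \<cdot> b) + c / 2 * (J u \<cdot> b)"
      unfolding Pu by (simp add: e1 e2 field_simps)
    also have "b \<cdot> b = b0 \<cdot> b0 + 2 * (c * t) * (S b0 \<cdot> b0) + (c * t)\<^sup>2 * (S b0 \<cdot> S b0)"
      unfolding b using ip_commute[of m b0 "S b0"] by (simp add: power2_eq_square algebra_simps)
    also have "J u \<cdot> b = J u \<cdot> b0 + c * t * (J u \<cdot> S b0)" unfolding b by simp
    also have "\<kappa> - c / 2 * (b0 \<cdot> b0 + 2 * (c * t) * (S b0 \<cdot> b0) + (c * t)\<^sup>2 * (S b0 \<cdot> S b0))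
        + c / 2 * (J u \<cdot> b0 + c * t * (J u \<cdot> S b0)) =
       s0 - t * (S w0 \<cdot> w0) - c * t\<^sup>2 / 2 * (S w0 \<cdot> S w0) + (J u \<cdot> (w0 + scl (c * t) (S w0))) / 2"
      by (simp add: w0_def \<kappa>_def power2_eq_square field_simps)
    finally show ?thesis .
  qed
  ultimately show "((\<lambda>t. o\<tau> t 1) has_real_derivative
       s0 - t * (S w0 \<cdot> w0) - c * t\<^sup>2 / 2 * (S w0 \<cdot> S w0)
         + (J (pv (o\<tau> t)) \<cdot> (w0 + scl (c * t) (S w0))) / 2) (at t)"
    unfolding yo pvo u_def by simp
qed

text \<open>The shift group with \<open>a = S w0\<close>: for \<open>c = 0\<close> the geodesic is a straight line in \<open>V\<close>, and the quadratic part of its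
  \<open>y\<close>-coordinate comes from the term \<open>\<langle>S w0, v\<rangle>\<close> of the isometry.\<close>

lemma vertical_flow_orbit:
  fixes s0 :: real and p0 w0 :: vec
  defines "o\<tau> \<equiv> \<lambda>t. vertical_flow (p0 0) w0 (S w0) (s0 + S w0 \<cdot> pv p0 + J (pv p0) \<cdot> w0) t p0"
  shows "o\<tau> 0 = p0" and "o\<tau> t 0 = p0 0" and "vder (\<lambda>t. pv (o\<tau> t)) w0 t"
    and "((\<lambda>t. o\<tau> t 1) has_real_derivative s0 - t * (S w0 \<cdot> w0) + (J (pv (o\<tau> t)) \<cdot> w0) / 2) (at t)"
proof -
  have h: "v_shift w0 (S w0) 0 = w0" by (simp add: v_shift_def ex_0)
  have pvo: "pv (o\<tau> t) = pv p0 + scl t w0" for t by (simp add: o\<tau>_def vertical_flow_def Let_def h)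
  show "o\<tau> t 0 = p0 0" for t by (simp add: o\<tau>_def vertical_flow_def Let_def)
  show "o\<tau> 0 = p0" by (rule mk_eqI) (simp_all add: pvo, simp_all add: o\<tau>_def vertical_flow_def Let_def)
  show "vder (\<lambda>t. pv (o\<tau> t)) w0 t"
    unfolding pvo
    by (rule vder_cong_eq[OF vder_add[OF vder_const vder_scl[OF DERIV_ident vder_const]]]) simp
  have j: "J w0 \<cdot> pv p0 = - (J (pv p0) \<cdot> w0)" by (rule J_skew)
  show "((\<lambda>t. o\<tau> t 1) has_real_derivative s0 - t * (S w0 \<cdot> w0) + (J (pv (o\<tau> t)) \<cdot> w0) / 2) (at t)"
    unfolding pvo
    by (auto simp: o\<tau>_def vertical_flow_def Let_def h j field_simps intro!: derivative_eq_intros)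
qed

end

context nil_model
begin

text \<open>A geodesic and an orbit with the same initial point satisfy the same triangular system: \<open>x\<close> is given, the
  equation for \<open>v\<close> is linear with nilpotent matrix, and \<open>y\<close> is an integral. The two kinds of one-parameter
  groups correspond to \<open>c \<noteq> 0\<close> and \<open>c = 0\<close>.\<close>

lemma geodesic_is_orbit:
  assumes geo: "geodesic M g I \<gamma>" and t0: "t0 \<in> I"
  obtains G where "\<And>t. transport (G t) \<in> semidirect_transformations N M g"
    and "\<And>t x. x \<in> coords \<Longrightarrow> G t x \<in> coords"
    and "\<And>s t x. G (s + t) x = G s (G t x)"
    and "vpoly (\<lambda>z. G (z 0) (\<lambda>i. z (Suc i)))"
    and "\<And>t. t \<in> I \<Longrightarrow> \<phi> (\<gamma> t) = G (t - t0) (\<phi> (\<gamma> t0))"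
proof -
  define p0 where "p0 = \<phi> (\<gamma> t0)"
  have I: "open I" "is_interval I" "smooth_curve M I \<gamma>" using geo by (simp_all add: geodesic_def)
  have "\<gamma> ` I \<subseteq> points M"
    using I(3) continuous_map_image_subset_topspace unfolding smooth_curve_def smooth_map_def by force
  then have "p0 \<in> coords" using t0 by (auto simp: p0_def)
  then have v0: "pv p0 \<in> coord_space m" by simp
  obtain c w0 s0 where w0: "w0 \<in> coord_space m"
    and x: "\<And>t. t \<in> I \<Longrightarrow> \<phi> (\<gamma> t) 0 = p0 0 + c * (t - t0)"
    and v: "\<And>t. t \<in> I \<Longrightarrow> vder (\<lambda>t. pv (\<phi> (\<gamma> t)))
           (w0 + scl (c * (t - t0)) (S w0) - scl c (D (pv (\<phi> (\<gamma> t))))) t"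
    and y: "\<And>t. t \<in> I \<Longrightarrow> ((\<lambda>t. \<phi> (\<gamma> t) 1) has_real_derivative
           s0 - (t - t0) * (S w0 \<cdot> w0) - c * (t - t0)\<^sup>2 / 2 * (S w0 \<cdot> S w0)
             + (J (pv (\<phi> (\<gamma> t))) \<cdot> (w0 + scl (c * (t - t0)) (S w0))) / 2) (at t)"
    using geodesic_velocity[OF geo t0] unfolding p0_def by metis
  have match: "\<phi> (\<gamma> t) = G (t - t0) p0" if t: "t \<in> I" and o0: "G 0 p0 = p0" and ox: "\<And>t. G t p0 0 = p0 0 + c * t"
    and ov: "\<And>t. vder (\<lambda>t. pv (G t p0)) (w0 + scl (c * t) (S w0) - scl c (D (pv (G t p0)))) t"
    and oy: "\<And>t. ((\<lambda>t. G t p0 1) has_real_derivative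
       s0 - t * (S w0 \<cdot> w0) - c * t\<^sup>2 / 2 * (S w0 \<cdot> S w0)
         + (J (pv (G t p0)) \<cdot> (w0 + scl (c * t) (S w0))) / 2) (at t)" for G t
  proof (rule mk_eqI)
    have d: "((\<lambda>t. t - t0) has_real_derivative 1) (at t)" for t by (auto intro!: derivative_eq_intros)
    have vt: "pv (\<phi> (\<gamma> t)) - pv (G (t - t0) p0) = 0" if "t \<in> I" for t
    proof (rule linear_ode_unique[OF I(2,1) t0 _ _ that])
      show "pv (\<phi> (\<gamma> t0)) - pv (G (t0 - t0) p0) = 0" by (simp add: o0 flip: p0_def)
      show "vder (\<lambda>t. pv (\<phi> (\<gamma> t)) - pv (G (t - t0) p0)) (scl (- c) (D (pv (\<phi> (\<gamma> t)) - pv (G (t - t0) p0)))) t"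
        if "t \<in> I" for t
        by (rule vder_cong_eq[OF vder_diff[OF v[OF that] vder_chain[OF ov d]]]) (simp add: scl_add)
    qed
    show "pv (\<phi> (\<gamma> t)) = pv (G (t - t0) p0)" using vt[OF t] by simp
    show "\<phi> (\<gamma> t) 0 = G (t - t0) p0 0" using x[OF t] ox by simp
    have "\<phi> (\<gamma> t) 1 = G (t - t0) p0 1"
    proof (rule interval_eqI[OF I(2) t0 t _ y])
      show "\<phi> (\<gamma> t0) 1 = G (t0 - t0) p0 1" by (simp add: o0 flip: p0_def)
      show "((\<lambda>t. G (t - t0) p0 1) has_real_derivative
          s0 - (t - t0) * (S w0 \<cdot> w0) - c * (t - t0)\<^sup>2 / 2 * (S w0 \<cdot> S w0)
             + (J (pv (\<phi> (\<gamma> t))) \<cdot> (w0 + scl (c * (t - t0)) (S w0))) / 2) (at t)" if "t \<in> I" for t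
        using DERIV_chain2[OF oy[of "t - t0"] d] vt[OF that] by simp
    qed
    then show "\<phi> (\<gamma> t) (Suc 0) = G (t - t0) p0 (Suc 0)" by simp
  qed
  show thesis
  proof (cases "c = 0")
    case True
    define G where "G = vertical_flow (p0 0) w0 (S w0) (s0 + S w0 \<cdot> pv p0 + J (pv p0) \<cdot> w0)"
    show thesis
    proof (rule that[of G])
      have "G t = isoF 0 (scl t (v_shift w0 (S w0) (- p0 0))) (scl t (S w0)) ((s0 + S w0 \<cdot> pv p0 + J (pv p0) \<cdot> w0) * t)" for t
        unfolding G_def by (rule ext) (rule vertical_flow_isoF)
      then show "transport (G t) \<in> semidirect_transformations N M g"
        and "x \<in> coords \<Longrightarrow> G t x \<in> coords" for t x
        using w0 by (auto intro!: isoF_semidirect)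
      show "G (s + t) x = G s (G t x)" for s t x unfolding G_def by (rule vertical_flow_add)
      show "vpoly (\<lambda>z. G (z 0) (\<lambda>i. z (Suc i)))" unfolding G_def by (rule vpoly_vertical_flow)
      show "\<phi> (\<gamma> t) = G (t - t0) (\<phi> (\<gamma> t0))" if "t \<in> I" for t
        unfolding p0_def[symmetric] by (rule match[OF that]; unfold G_def) (simp_all add: True vertical_flow_orbit[simplified])
    qed
  next
    case False
    define b0 where "b0 = scl (1 / c) w0"
    have wb: "w0 = scl c b0" using False by (simp add: b0_def)
    have b0: "b0 \<in> coord_space m" using w0 by (simp add: b0_def)
    define G where "G = geodesic_flow c (p0 0) (pv p0) b0 (s0 + c / 2 * (b0 \<cdot> b0))"
    show thesis
    proof (rule that[of G])
      define h0 k where "h0 t = geo_v (p0 0) (pv p0) b0 (c * t) - geo_v (p0 0) (pv p0) b0 0"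
        and "k t = (s0 + c / 2 * (b0 \<cdot> b0)) * t + (geo_p (p0 0) (pv p0) b0 (c * t) \<cdot> geo_v (p0 0) (pv p0) b0 0
            - geo_p (p0 0) (pv p0) b0 0 \<cdot> geo_v (p0 0) (pv p0) b0 (c * t)) / 2" for t
      have G: "G t = isoF (c * t) (h0 t) (scl (c * t) (S b0)) (k t)" for t
        unfolding G_def h0_def k_def by (rule ext) (rule geodesic_flow_isoF)
      have h0: "h0 t \<in> coord_space m" for t unfolding h0_def using v0 b0 by simp
      show "transport (G t) \<in> semidirect_transformations N M g" for t
        unfolding G by (rule isoF_semidirect) (use h0 in simp_all)
      show "x \<in> coords \<Longrightarrow> G t x \<in> coords" for t x
        unfolding G using h0 by (intro isoF_in) simp_all
      show "G (s + t) x = G s (G t x)" for s t x unfolding G_def by (rule geodesic_flow_add)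
      show "vpoly (\<lambda>z. G (z 0) (\<lambda>i. z (Suc i)))" unfolding G_def by (rule vpoly_geodesic_flow)
      show "\<phi> (\<gamma> t) = G (t - t0) (\<phi> (\<gamma> t0))" if "t \<in> I" for t
        unfolding p0_def[symmetric] by (rule match[OF that]; unfold G_def wb) (rule geodesic_flow_orbit)+
    qed
  qed
qed

theorem geodesic_orbit_N: "geodesic_orbit N M g"
  unfolding geodesic_orbit_def
proof (intro allI impI)
  fix I \<gamma> assume geo: "geodesic M g I \<gamma>"
  show "\<exists>\<Phi> p \<rho>. one_param_subgroup M (semidirect_transformations N M g) \<Phi> \<and> p \<in> points M \<and>
           smooth_curve (line_manifold UNIV) I \<rho> \<and> (\<forall>t\<in>I. deriv \<rho> t \<noteq> 0) \<and> (\<forall>t\<in>I. \<gamma> t = \<Phi> (\<rho> t) p)"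
  proof (cases "I = {}")
    case True
    \<comment> \<open>A geodesic may have an empty interval of definition; the trivial group serves for it.\<close>
    have "isoF 0 0 0 0 p = p" for p by (rule mk_eqI) (simp_all add: v_shift_def)
    then have "one_param_subgroup M (semidirect_transformations N M g) (\<lambda>t. transport (isoF 0 0 0 0))"
      by (intro one_param_subgroupI isoF_semidirect vpoly_isoF) (simp_all add: vpoly_def polynomial_intros)
    moreover have "smooth_curve (line_manifold UNIV) I (\<lambda>t. t)"
      unfolding smooth_curve_def True
      by (rule smooth_map_polynomial[OF single_chart_line[OF open_empty] single_chart_line[OF open_UNIV],
            of _ "\<lambda>k z. 0"]) (auto intro: polynomial_const)
    ultimately show ?thesis using pt_one True by auto
  next
    case False
    then obtain t0 where t0: "t0 \<in> I" by blast
    have I: "open I" "smooth_curve M I \<gamma>" using geo by (simp_all add: geodesic_def)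
    have "\<gamma> ` I \<subseteq> points M"
      using I(2) continuous_map_image_subset_topspace unfolding smooth_curve_def smooth_map_def by force
    then have \<gamma>: "\<gamma> t \<in> points M" if "t \<in> I" for t using that by blast
    obtain G where G: "\<And>t. transport (G t) \<in> semidirect_transformations N M g"
      "\<And>t x. x \<in> coords \<Longrightarrow> G t x \<in> coords"
      "\<And>s t x. G (s + t) x = G s (G t x)" "vpoly (\<lambda>z. G (z 0) (\<lambda>i. z (Suc i)))"
      "\<And>t. t \<in> I \<Longrightarrow> \<phi> (\<gamma> t) = G (t - t0) (\<phi> (\<gamma> t0))"
      by (rule geodesic_is_orbit[OF geo t0]) (rule that; assumption)
    have "one_param_subgroup M (semidirect_transformations N M g) (\<lambda>t. transport (G t))"
      by (rule one_param_subgroupI; (rule G; assumption?))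
    moreover have "smooth_curve (line_manifold UNIV) I (\<lambda>t. t - t0)"
      unfolding smooth_curve_def
      by (rule smooth_map_polynomial[OF single_chart_line[OF I(1)] single_chart_line[OF open_UNIV],
            of _ "\<lambda>k z. z 0 - t0"]) (auto simp: line_coord_def intro!: polynomial_intros)
    moreover have "deriv (\<lambda>t. t - t0) t = 1" for t
      by (rule DERIV_imp_deriv) (auto intro!: derivative_eq_intros)
    moreover have "\<gamma> t = transport (G (t - t0)) (\<gamma> t0)" if "t \<in> I" for t
      by (rule chart_eqI[OF \<gamma>[OF that]])
        (simp_all only: transport[OF G(2) \<gamma>[OF t0]] G(5)[OF that])
    ultimately show ?thesis using \<gamma>[OF t0]
      by (intro exI[of _ "\<lambda>t. transport (G t)"] exI[of _ "\<gamma> t0"] exI[of _ "\<lambda>t. t - t0"]) simp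
  qed
qed

end

section \<open>The isotropy algebra and natural reductivity\<close>

context nil_data
begin

text \<open>The bracket of the Lie algebra, \<open>[f, v] = D v\<close> and \<open>[v, w] = \<langle>J v, w\<rangle> e\<close>.\<close>

definition bracket :: "vec \<Rightarrow> vec \<Rightarrow> vec" where
  "bracket u v = mk 0 (J (pv u) \<cdot> pv v) (scl (u 0) (D (pv v)) - scl (v 0) (D (pv u)))"

text \<open>The adjoint action of the group on its Lie algebra: the derivative of conjugation at the identity (\<open>vder_conj\<close>).
  Its own derivative is the bracket (\<open>vder_Ad\<close>).\<close>

definition Ad :: "vec \<Rightarrow> vec \<Rightarrow> vec" where
  "Ad p X = mk (X 0) (X 1 + J (pv p) \<cdot> pv X + X 0 / 2 * (J (D (pv p)) \<cdot> pv p))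
     (E (- p 0) (pv X - scl (X 0) (D (pv p))))"

lemma bracket_in [simp]: "bracket u v \<in> coords"
  unfolding bracket_def by simp

lemma vder_conj:
  assumes q: "vder q X t" and q0: "q t = 0"
  shows "vder (\<lambda>s. pmul (pmul p (q s)) (pinv p)) (Ad p X) t"
proof -
  note d0 = vder_comp[OF q, of 0] and d1 = vder_comp[OF q, of 1] and v = vder_pv[OF q]
  have qt: "q t 0 = 0" "q t 1 = 0" "pv (q t) = 0" by (simp_all add: q0)
  have e: "vder (\<lambda>s. E (q s 0) (pv p)) (- scl (X 0) (D (pv p))) t"
    using vder_E[OF d0 vder_const[of "pv p"]] by (simp add: qt ex_0)
  have f: "vder (\<lambda>s. pv (q s) + E (q s 0) (pv p)) (pv X - scl (X 0) (D (pv p))) t"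
    using vder_add[OF v e] by simp
  have g: "vder (\<lambda>s. E (- p 0) (pv (q s) + E (q s 0) (pv p))) (E (- p 0) (pv X - scl (X 0) (D (pv p)))) t"
    using vder_E[OF DERIV_const f, of "- p 0"] by simp
  have "pmul (pmul p (q s)) (pinv p) = mk (q s 0) (q s 1 + (J (E (q s 0) (pv p)) \<cdot> pv (q s)) / 2
      - (J (pv (q s) + E (q s 0) (pv p)) \<cdot> pv p) / 2)
      (E (- p 0) (pv (q s) + E (q s 0) (pv p)) - E (- p 0) (pv p))" for s
    by (rule mk_eqI) (simp_all add: E_symplectic flip: ap_add ex_linear)
  moreover have "vder (\<lambda>s. mk (q s 0) (q s 1 + (J (E (q s 0) (pv p)) \<cdot> pv (q s)) / 2
      - (J (pv (q s) + E (q s 0) (pv p)) \<cdot> pv p) / 2)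
      (E (- p 0) (pv (q s) + E (q s 0) (pv p)) - E (- p 0) (pv p)))
     (mk (X 0) (X 1 + (J (- scl (X 0) (D (pv p))) \<cdot> pv (q t) + J (E (q t 0) (pv p)) \<cdot> pv X) / 2
        - (J (pv X - scl (X 0) (D (pv p))) \<cdot> pv p + J (pv (q t) + E (q t 0) (pv p)) \<cdot> 0) / 2)
       (E (- p 0) (pv X - scl (X 0) (D (pv p))) - 0)) t"
    by (intro vder_mk DERIV_add DERIV_diff DERIV_cdivide vder_ip vder_ap e f g d0 d1 v vder_diff vder_const)
  moreover have "mk (X 0) (X 1 + (J (- scl (X 0) (D (pv p))) \<cdot> pv (q t) + J (E (q t 0) (pv p)) \<cdot> pv X) / 2
        - (J (pv X - scl (X 0) (D (pv p))) \<cdot> pv p + J (pv (q t) + E (q t 0) (pv p)) \<cdot> 0) / 2)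
       (E (- p 0) (pv X - scl (X 0) (D (pv p))) - 0) = Ad p X"
    unfolding Ad_def using J_skew[of "pv X" "pv p"]
    by (intro arg_cong2[of _ _ _ _ "mk (X 0)"]) (simp_all add: qt ex_0 field_simps)
  ultimately show ?thesis by simp
qed

lemma vder_Ad:
  assumes q: "vder q X t" and q0: "q t = 0"
  shows "vder (\<lambda>s. Ad (q s) w) (bracket X w) t"
proof -
  note d0 = vder_comp[OF q, of 0] and v = vder_pv[OF q]
  have qt: "q t 0 = 0" "pv (q t) = 0" by (simp_all add: q0)
  have f: "vder (\<lambda>s. pv w - scl (w 0) (D (pv (q s)))) (- scl (w 0) (D (pv X))) t"
    by (rule vder_cong_eq[OF vder_diff[OF vder_const vder_scl[OF DERIV_const vder_ap[OF v]]]]) simp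
  have g: "vder (\<lambda>s. E (- q s 0) (pv w - scl (w 0) (D (pv (q s)))))
     (E 0 (- scl (w 0) (D (pv X))) - scl (- X 0) (D (E 0 (pv w)))) t"
    using vder_E[OF DERIV_minus[OF d0] f] by (simp add: qt)
  have y: "((\<lambda>s. w 1 + J (pv (q s)) \<cdot> pv w + w 0 / 2 * (J (D (pv (q s))) \<cdot> pv (q s)))
      has_real_derivative 0 + (J (pv X) \<cdot> pv w + J (pv (q t)) \<cdot> 0)
        + w 0 / 2 * (J (D (pv X)) \<cdot> pv (q t) + J (D (pv (q t))) \<cdot> pv X)) (at t)"
    by (intro DERIV_add DERIV_const DERIV_cmult vder_ip vder_ap v vder_const)
  show ?thesis
    unfolding Ad_def
    by (rule vder_cong_eq[OF vder_mk[OF DERIV_const y g]])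
      (simp add: bracket_def qt ex_0 algebra_simps)
qed

lemma vder_bracket: "vder X X' t \<Longrightarrow> vder Y Y' t \<Longrightarrow>
    vder (\<lambda>s. bracket (X s) (Y s)) (bracket X' (Y t) + bracket (X t) Y') t"
proof -
  assume X: "vder X X' t" and Y: "vder Y Y' t"
  note vx = vder_pv[OF X] and vy = vder_pv[OF Y] and x0 = vder_comp[OF X, of 0] and y0 = vder_comp[OF Y, of 0]
  show ?thesis
    unfolding bracket_def
    by (rule vder_cong_eq[OF vder_mk[OF DERIV_const vder_ip[OF vder_ap[OF vx] vy]
          vder_diff[OF vder_scl[OF x0 vder_ap[OF vy]] vder_scl[OF y0 vder_ap[OF vx]]]]])
      (rule mk_eqI; simp add: algebra_simps)
qed

lemma mform_0: "mform 0 X Y = X 0 * Y 1 + Y 0 * X 1 + pv X \<cdot> pv Y"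
  by (simp add: mform_def \<theta>_def \<sigma>_def)

lemma mform_0_deriv: "vder X X' t \<Longrightarrow> vder Y Y' t \<Longrightarrow>
    ((\<lambda>s. mform 0 (X s) (Y s)) has_real_derivative mform 0 X' (Y t) + mform 0 (X t) Y') (at t)"
proof -
  assume X: "vder X X' t" and Y: "vder Y Y' t"
  show ?thesis
    unfolding mform_0
    by (rule DERIV_cong[OF DERIV_add[OF DERIV_add[OF DERIV_mult[OF vder_comp[OF X] vder_comp[OF Y]]
            DERIV_mult[OF vder_comp[OF Y] vder_comp[OF X]]] vder_ip[OF vder_pv[OF X] vder_pv[OF Y]]]])
      (simp add: algebra_simps)
qed

text \<open>The null rotation \<open>f \<mapsto> a\<close>, \<open>v \<mapsto> - \<langle>a, v\<rangle> e\<close>. Outside the Lie algebra it is given the value zero, as elements of the isotropy algebra are.\<close>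

definition null_rot :: "vec \<Rightarrow> vec \<Rightarrow> vec" where
  "null_rot a u = (if u \<in> coords then mk 0 (- (a \<cdot> pv u)) (scl (u 0) a) else 0)"

lemma null_rot_in: "a \<in> coord_space m \<Longrightarrow> null_rot a u \<in> coords"
  by (simp add: null_rot_def)

lemma mk_add: "mk x y v + mk x' y' v' = mk (x + x') (y + y') (v + v')"
  and mk_scl: "scl c (mk x y v) = mk (c * x) (c * y) (scl c v)"
  by (rule mk_eqI; simp)+

lemma null_rot_linear: "null_rot (a + b) u = null_rot a u + null_rot b u" "null_rot (scl c a) u = scl c (null_rot a u)" "null_rot 0 u = 0"
  by (simp_all add: null_rot_def mk_add mk_scl scl_add mult_ac mk_zero)

lemma null_rot_commute: "a \<in> coord_space m \<Longrightarrow> b \<in> coord_space m \<Longrightarrow> null_rot a (null_rot b u) = null_rot b (null_rot a u)"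
  by (simp add: null_rot_def ip_commute mk_zero)

end

text \<open>A skew derivation of the Lie algebra induces a skew map \<open>B\<close> of \<open>V\<close> that commutes with \<open>D\<close> and \<open>J\<close> up to the
  multiple \<open>\<mu>\<close> by which it scales \<open>f\<close>. Rigidity excludes such maps. The condition \<open>J \<noteq> 0\<close> makes \<open>e\<close> a commutator.\<close>

locale rigid_data = nil_data +
  assumes J_nonzero: "\<exists>v\<in>coord_space m. \<exists>w\<in>coord_space m. J v \<cdot> w \<noteq> 0"
    and rigid: "\<And>B \<mu> v. (\<And>v w. v \<in> coord_space m \<Longrightarrow> w \<in> coord_space m \<Longrightarrow> B (v + w) = B v + B w) \<Longrightarrow>
      (\<And>c v. v \<in> coord_space m \<Longrightarrow> B (scl c v) = scl c (B v)) \<Longrightarrow>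
      (\<And>v. v \<in> coord_space m \<Longrightarrow> B v \<in> coord_space m) \<Longrightarrow>
      (\<And>v w. v \<in> coord_space m \<Longrightarrow> w \<in> coord_space m \<Longrightarrow> B v \<cdot> w = - (v \<cdot> B w)) \<Longrightarrow>
      (\<And>v. v \<in> coord_space m \<Longrightarrow> B (D v) - D (B v) = scl \<mu> (D v)) \<Longrightarrow>
      (\<And>v. v \<in> coord_space m \<Longrightarrow> B (J v) - J (B v) = scl \<mu> (J v)) \<Longrightarrow>
      v \<in> coord_space m \<Longrightarrow> B v = 0"
begin

text \<open>The line spanned by \<open>e\<close> is invariant: as \<open>e\<close> lies in the derived algebra, so does \<open>B e\<close>, and its \<open>V\<close>-part is
  \<open>D z\<close> for some \<open>z\<close>. Skewness gives \<open>\<langle>D z, D z\<rangle> = - \<langle>e, B [f, z]\<rangle> = 0\<close>, since derivations preserve the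
  derived algebra, which is orthogonal to \<open>e\<close>. So \<open>B\<close> acts on \<open>V\<close>, the quotient of the orthogonal complement of
  \<open>e\<close> by \<open>e\<close>, and by rigidity it acts there as zero. What is left is the null rotation by the
  \<open>V\<close>-part \<open>a\<close> of \<open>B f\<close>; the derivation property on \<open>[f, v]\<close> is \<open>S a = 0\<close>.\<close>

lemma skew_derivation_is_null_rotation:
  assumes add: "\<And>u v. B (u + v) = B u + B v" and scl: "\<And>c u. B (scl c u) = scl c (B u)"
    and B_in: "\<And>u. B u \<in> coords"
    and skew: "\<And>u v. u \<in> coords \<Longrightarrow> v \<in> coords \<Longrightarrow>
      mform 0 (B u) v + mform 0 u (B v) = 0"
    and der: "\<And>u v. u \<in> coords \<Longrightarrow> v \<in> coords \<Longrightarrow>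
      B (bracket u v) = bracket (B u) v + bracket u (B v)"
  shows "\<exists>a \<in> coord_space m. S a = 0 \<and> (\<forall>u \<in> coords. B u = null_rot a u)"
proof -
  define e f V where "e = mk 0 1 0" and "f = mk 1 0 0" and "V v = mk 0 0 v" for v
  have s [simp]: "e 0 = 0" "e (Suc 0) = 1" "pv e = 0" "f 0 = 1" "f (Suc 0) = 0" "pv f = 0"
    "V v 0 = 0" "V v (Suc 0) = 0" "pv (V v) = v" for v by (simp_all add: e_def f_def V_def)
  have sp [simp]: "e \<in> coords" "f \<in> coords"
    "v \<in> coord_space m \<Longrightarrow> V v \<in> coords" for v by (simp_all add: e_def f_def V_def)
  have Bv_in [simp]: "pv (B u) \<in> coord_space m" for u using B_in by simp
  have VV: "V (v + w) = V v + V w" "V (scl c v) = scl c (V v)" for v w c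
    by (rule mk_eqI; simp)+
  have bracket_fV: "bracket f (V v) = V (D v)" for v by (rule mk_eqI) (simp_all add: bracket_def)
  have bracket_VV: "bracket (V v) (V w) = scl (J v \<cdot> w) e" for v w by (rule mk_eqI) (simp_all add: bracket_def)
  have dfV: "V_x = 0" if "V_x = B (V (D v)) 0" "v \<in> coord_space m" for V_x v
    using der[of f "V v"] that by (simp add: bracket_fV) (simp add: bracket_def)
  obtain v1 w1 where vw: "v1 \<in> coord_space m" "w1 \<in> coord_space m" "J v1 \<cdot> w1 \<noteq> 0" using J_nonzero by blast
  define \<kappa> where "\<kappa> = J v1 \<cdot> w1"
  have Be: "scl \<kappa> (B e) = bracket (B (V v1)) (V w1) + bracket (V v1) (B (V w1))"
    using der[of "V v1" "V w1"] vw by (simp add: bracket_VV scl \<kappa>_def)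
  have Be0: "B e 0 = 0" using fun_cong[OF Be, of 0] vw(3) by (simp add: bracket_def \<kappa>_def)
  define z where "z = scl (1 / \<kappa>) (scl (B (V v1) 0) w1 - scl (B (V w1) 0) v1)"
  have z_in: "z \<in> coord_space m" using vw by (simp add: z_def)
  have "scl \<kappa> (pv (B e)) = scl (B (V v1) 0) (D w1) - scl (B (V w1) 0) (D v1)"
    using arg_cong[OF Be, of pv] by (simp add: bracket_def)
  then have "scl (1 / \<kappa>) (scl \<kappa> (pv (B e))) = D z"
    by (simp add: z_def scl_add)
  then have pBe: "pv (B e) = D z" using vw(3) by (simp add: \<kappa>_def)
  have "mform 0 (B e) (V (D z)) + mform 0 e (B (V (D z))) = 0" by (rule skew) simp_all
  then have "D z \<cdot> D z = 0" using dfV[OF refl z_in] Be0 by (simp add: mform_0 pBe)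
  then have "pv (B e) = 0" using ip_self_zero[of "D z" m] pBe by simp
  define \<nu> where "\<nu> = B e 1"
  have Be: "B e = scl \<nu> e" by (rule mk_eqI) (simp_all add: Be0 \<open>pv (B e) = 0\<close> \<nu>_def)
  have BV0: "B (V v) 0 = 0" if "v \<in> coord_space m" for v
    using skew[of "V v" e] that by (simp add: mform_0 Be)
  define a where "a = pv (B f)"
  define \<mu> where "\<mu> = B f 0"
  have a_in: "a \<in> coord_space m" by (simp add: a_def)
  have \<mu>: "\<mu> = - \<nu>" using skew[of f e] by (simp add: mform_0 Be \<mu>_def)
  have Bf1: "B f 1 = 0" using skew[of f f] by (simp add: mform_0)
  have BV1: "B (V v) 1 = - (v \<cdot> a)" if "v \<in> coord_space m" for v
    using skew[of "V v" f] that BV0[OF that] by (simp add: mform_0 a_def)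
  define C where "C v = pv (B (V v))" for v
  have C_D: "C (D v) - D (C v) = scl \<mu> (D v)" if "v \<in> coord_space m" for v
    using arg_cong[OF der[of f "V v"], of pv] that BV0[OF that]
    by (simp add: bracket_fV C_def) (simp add: bracket_def \<mu>_def)
  have C_skew: "C v \<cdot> w = - (v \<cdot> C w)" if "v \<in> coord_space m" "w \<in> coord_space m" for v w
    using skew[of "V v" "V w"] that BV0 by (simp add: mform_0 C_def)
  have C_J: "C (J v) - J (C v) = scl \<mu> (J v)" if v: "v \<in> coord_space m" for v
  proof (rule vec_eq_ipI[of _ m])
    fix w :: vec assume w: "w \<in> coord_space m"
    have "scl (J v \<cdot> w) (B e) = bracket (B (V v)) (V w) + bracket (V v) (B (V w))"
      using der[of "V v" "V w"] v w by (simp add: bracket_VV scl)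
    from fun_cong[OF this, of 1] have "J v \<cdot> w * \<nu> = J (C v) \<cdot> w + J v \<cdot> C w"
      by (simp add: Be bracket_def C_def)
    moreover have "C (J v) \<cdot> w = - (J v \<cdot> C w)" by (rule C_skew) (use w in simp_all)
    ultimately show "(C (J v) - J (C v)) \<cdot> w = scl \<mu> (J v) \<cdot> w" by (simp add: \<mu> algebra_simps)
  qed (simp_all add: C_def)
  have C0: "C v = 0" if "v \<in> coord_space m" for v
  proof (rule rigid[of C \<mu>, OF _ _ _ C_skew C_D C_J that])
    show "C (v + w) = C v + C w" "C (scl c v) = scl c (C v)" for v w c
      by (simp_all add: C_def VV add scl)
  qed (simp_all add: C_def)
  \<comment> \<open>With \<open>C = 0\<close> the relation between \<open>C\<close> and \<open>J\<close> becomes \<open>\<mu> J = 0\<close>.\<close>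
  have "\<mu> = 0"
  proof -
    have "scl \<mu> (J v1) = 0" using C_J[OF vw(1)] C0[OF vw(1)] C0[of "J v1"] by simp
    then have "\<mu> * (J v1 \<cdot> w1) = 0" using ip_scl(1)[of m \<mu> "J v1" w1] by simp
    then show ?thesis using vw by simp
  qed
  have "S a = 0"
  proof (rule vec_eq_ipI[of _ m])
    fix v :: vec assume v: "v \<in> coord_space m"
    have "B (V (D v)) 1 = J a \<cdot> v"
      using fun_cong[OF der[of f "V v"], of 1] v by (simp add: bracket_fV) (simp add: bracket_def a_def)
    then have "- (D v \<cdot> a) = J a \<cdot> v" using BV1[of "D v"] by simp
    then show "S a \<cdot> v = 0 \<cdot> v" using S_ip[of a v] by (simp add: ip_commute)
  qed simp_all
  moreover have "B u = null_rot a u" if u: "u \<in> coords" for u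
  proof -
    have "u = scl (u 0) f + (scl (u 1) e + V (pv u))" by (rule mk_eqI) simp_all
    then have "B u = scl (u 0) (B f) + (scl (u 1) (B e) + B (V (pv u)))" by (metis add scl)
    also have "\<dots> = mk 0 (- (a \<cdot> pv u)) (scl (u 0) a)"
      by (rule mk_eqI) (use u Be \<open>\<mu> = 0\<close> \<mu> Bf1 BV0[of "pv u"] BV1[of "pv u"] C0[of "pv u"] in
        \<open>simp_all add: \<mu>_def a_def C_def ip_commute\<close>)
    finally show ?thesis using u by (simp add: null_rot_def)
  qed
  ultimately show ?thesis using a_in by blast
qed

end

context nil_model
begin

lemma mdim_space: "lie_space M = coords"
  by (simp add: lie_space_def dim)

abbreviation cc :: "'a chart" where "cc \<equiv> (points M, \<phi>)"

lemma lie_ray: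
  assumes "u \<in> coords"
  shows "lie_ray N cc u s \<in> points M" "\<phi> (lie_ray N cc u s) = scl s u"
    "lie_ray N cc u \<in> tangent_curves M \<one>\<^bsub>N\<^esub>"
proof -
  have 0: "0 \<in> coord_space (mdim M)" and u: "u \<in> coord_space (mdim M)" using assms by (simp_all add: dim)
  show "lie_ray N cc u s \<in> points M" "\<phi> (lie_ray N cc u s) = scl s u"
    using coord_line_chart[OF chart 0 u] by (simp_all add: lie_ray_def one scl_def)
  show "lie_ray N cc u \<in> tangent_curves M \<one>\<^bsub>N\<^esub>"
    unfolding lie_ray_def snd_conv one by (rule coord_line_tangent[OF chart 0 u pt_one one])
qed

lemma vder_line: "vder (\<lambda>s. scl s u) u t"
  by (rule vder_cong_eq[OF vder_scl[OF DERIV_ident vder_const]]) simp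

lemma lie_form_eq:
  assumes "u \<in> coords" "v \<in> coords"
  shows "lie_form N g cc u v = mform 0 u v"
proof -
  have "chart_velocity \<phi> (lie_ray N cc w) = w" if "w \<in> coords" for w
    by (rule velocity_eqI) (simp add: lie_ray(2)[OF that] vder_line)
  then show ?thesis
    using metric[of "lie_ray N cc u" "lie_ray N cc v"] lie_ray[OF assms(1)] assms by (simp add: lie_form_def)
qed

text \<open>The left-invariant field of \<open>w\<close> has the coordinate functions \<open>L p w\<close>; differentiating them once more along rays from
  the identity gives the two products of fields whose difference is the bracket.\<close>

lemma lie_bracket_eq:
  assumes u: "u \<in> coords" and v: "v \<in> coords"
  shows "lie_bracket N cc u v = bracket u v"
proof -
  define L where "L p w = mk (w 0) (w 1 + (J (pv p) \<cdot> pv w) / 2) (pv w - scl (w 0) (D (pv p)))" for p w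
  have 1: "left_field N cc w (\<lambda>p. snd cc p k) p = L (\<phi> p) w k" if "p \<in> points M" "w \<in> coords" for p w k
  proof -
    have d: "((\<lambda>s. s * w 0) has_real_derivative w 0) (at 0)" by (auto intro!: derivative_eq_intros)
    have e: "vder (\<lambda>s. E (s * w 0) (pv (\<phi> p))) (- scl (w 0) (D (pv (\<phi> p)))) 0"
      by (rule vder_cong_eq[OF vder_E[OF d vder_const]]) (simp add: ex_0)
    have y: "((\<lambda>s. \<phi> p 1 + s * w 1 + (J (E (s * w 0) (pv (\<phi> p))) \<cdot> scl s (pv w)) / 2) has_real_derivative
      0 + w 1 + (J (- scl (w 0) (D (pv (\<phi> p)))) \<cdot> scl 0 (pv w) + J (E (0 * w 0) (pv (\<phi> p))) \<cdot> pv w) / 2) (at 0)"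
      by (intro DERIV_add DERIV_const DERIV_cdivide vder_ip vder_ap e vder_line)
        (auto intro!: derivative_eq_intros)
    have x: "((\<lambda>s. \<phi> p 0 + s * w 0) has_real_derivative w 0) (at 0)" by (auto intro!: derivative_eq_intros)
    have eq: "pmul (\<phi> p) (scl s w) = mk (\<phi> p 0 + s * w 0)
        (\<phi> p 1 + s * w 1 + (J (E (s * w 0) (pv (\<phi> p))) \<cdot> scl s (pv w)) / 2)
        (scl s (pv w) + E (s * w 0) (pv (\<phi> p)))" for s
      by (simp add: pmul_def)
    have "vder (\<lambda>s. pmul (\<phi> p) (scl s w)) (L (\<phi> p) w) 0"
      unfolding eq
      by (rule vder_cong_eq[OF vder_mk[OF x y vder_add[OF vder_line e]]]) (simp add: L_def ex_0)
    then have "((\<lambda>s. pmul (\<phi> p) (scl s w) k) has_real_derivative L (\<phi> p) w k) (at 0)" by (simp add: vder_def)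
    then show ?thesis
      unfolding left_field_def using mult[OF that(1) lie_ray(1)[OF that(2)]]
      by (simp add: lie_ray(2)[OF that(2)] DERIV_imp_deriv)
  qed
  have 2: "left_field N cc w (left_field N cc w' (\<lambda>p. snd cc p k)) \<one>\<^bsub>N\<^esub>
      = mk 0 ((J (pv w) \<cdot> pv w') / 2) (- scl (w' 0) (D (pv w))) k"
    if w: "w \<in> coords" "w' \<in> coords" for w w' k
  proof -
    have "left_field N cc w' (\<lambda>p. snd cc p k) (\<one>\<^bsub>N\<^esub> \<otimes>\<^bsub>N\<^esub> lie_ray N cc w s) = L (scl s w) w' k" for s
      using 1[OF pt_mult[OF pt_one lie_ray(1)[OF w(1)]] w(2)] mult[OF pt_one lie_ray(1)[OF w(1)]]
      by (simp add: one lie_ray(2)[OF w(1)])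
    moreover have "vder (\<lambda>s. L (scl s w) w') (mk 0 ((J (pv w) \<cdot> pv w') / 2) (- scl (w' 0) (D (pv w)))) 0"
      unfolding L_def pv_simps
      by (rule vder_cong_eq[OF vder_mk[OF DERIV_const DERIV_add[OF DERIV_const DERIV_cdivide[OF
              vder_ip[OF vder_ap[OF vder_line] vder_const]]]
            vder_diff[OF vder_const vder_scl[OF DERIV_const vder_ap[OF vder_line]]]]]) simp
    ultimately show ?thesis
      unfolding left_field_def[of N cc w] by (simp add: vder_def DERIV_imp_deriv)
  qed
  show ?thesis
  proof
    fix k
    have j: "J (pv v) \<cdot> pv u = - (J (pv u) \<cdot> pv v)" by (rule J_skew)
    have "mk 0 ((J (pv u) \<cdot> pv v) / 2) (- scl (v 0) (D (pv u))) - mk 0 ((J (pv v) \<cdot> pv u) / 2) (- scl (u 0) (D (pv v))) = bracket u v"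
      by (rule mk_eqI) (simp_all add: bracket_def j)
    from fun_cong[OF this, of k] show "lie_bracket N cc u v k = bracket u v k"
      unfolding lie_bracket_def 2[OF u v] 2[OF v u] by simp
  qed
qed

subsection \<open>Null rotations belong to the isotropy algebra\<close>

lemma Th_add: "Th (scl (s + t) a) p = Th (scl s a) (Th (scl t a) p)"
proof (rule mk_eqI)
  have "J (ex (Suc 0) (p 0) a) \<cdot> ex (Suc 0) (p 0) a = 0" by simp
  then show "Th (scl (s + t) a) p (Suc 0) = Th (scl s a) (Th (scl t a) p) (Suc 0)"
    by (simp add: v_shift_def field_simps)
qed (simp_all add: v_shift_def scl_add add_ac)

lemma null_rotation_in_isotropy:
  assumes a: "a \<in> coord_space m" "S a = 0"
  shows "null_rot a \<in> isotropy_algebra N M g cc"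
proof -
  let ?\<Theta> = "\<lambda>t. transport (Th (scl t a))"
  have "one_param_subgroup M (isometric_automorphisms N M g) ?\<Theta>"
  proof (rule one_param_subgroupI)
    show "transport (Th (scl t a)) \<in> isometric_automorphisms N M g" for t by (rule Th_automorphism) (simp_all add: a)
    show "vpoly (\<lambda>z. Th (scl (z 0) a) (\<lambda>i. z (Suc i)))"
      by (intro vpoly_isoF vpoly_scl polynomial_const polynomial_coord vpoly_const)
        (simp add: vpoly_def polynomial_coord)
  qed (use a Th_add in auto)
  moreover have "null_rot a = (\<lambda>u k. if u \<in> lie_space M then deriv (\<lambda>t. differential_at_one N cc (?\<Theta> t) u k) 0 else 0)"
  proof (intro ext)
    fix u k
    show "null_rot a u k = (if u \<in> lie_space M then deriv (\<lambda>t. differential_at_one N cc (?\<Theta> t) u k) 0 else 0)"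
    proof (cases "u \<in> lie_space M")
      case True
      then have u: "u \<in> coords" by (simp add: mdim_space)
      \<comment> \<open>The differential of \<open>Th (t a)\<close> at the identity is the exponential of the null rotation by \<open>t a\<close>, a quadratic
      polynomial in \<open>t\<close>.\<close>
      define X where "X t = mk (u 0) (u 1 - t * (a \<cdot> pv u) - t\<^sup>2 * (u 0 / 2 * (a \<cdot> a))) (pv u + scl t (scl (u 0) a))" for t
      have "differential_at_one N cc (?\<Theta> t) u k = X t k" for t
      proof -
        have "\<phi> (?\<Theta> t (lie_ray N cc u s)) = Th (scl t a) (scl s u)" for s
          using transport(2)[of "Th (scl t a)", OF isoF_in lie_ray(1)[OF u]] a by (simp add: lie_ray(2)[OF u])
        moreover have "vder (\<lambda>s. Th (scl t a) (scl s u)) (X t) 0"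
          by (rule vder_cong_eq[OF vder_isoF[OF vder_line]])
            (simp add: disoF_def Let_def v_shift_def ex_0 X_def power2_eq_square field_simps)
        ultimately show ?thesis unfolding differential_at_one_def by (simp add: vder_def DERIV_imp_deriv)
      qed
      moreover have "vder X (mk 0 (- (a \<cdot> pv u)) (scl (u 0) a)) 0"
      proof -
        have y: "((\<lambda>t. u 1 - t * (a \<cdot> pv u) - t\<^sup>2 * (u 0 / 2 * (a \<cdot> a))) has_real_derivative - (a \<cdot> pv u)) (at 0)"
          by (auto intro!: derivative_eq_intros)
        show ?thesis unfolding X_def
          by (rule vder_cong_eq[OF vder_mk[OF DERIV_const y vder_add[OF vder_const vder_line]]]) simp
      qed
      then have "deriv (\<lambda>t. X t k) 0 = mk 0 (- (a \<cdot> pv u)) (scl (u 0) a) k"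
        unfolding vder_def by (intro DERIV_imp_deriv) blast
      ultimately show ?thesis using True u by (simp add: null_rot_def)
    qed (simp add: null_rot_def mdim_space)
  qed
  ultimately show ?thesis
    unfolding isotropy_algebra_def mem_Collect_eq by (intro exI[of _ ?\<Theta>] conjI)
qed

end

locale rigid_model = nil_model m Dm Jm r M \<phi> N g + rigid_data m Dm Jm r
  for m :: nat and Dm Jm :: "nat \<Rightarrow> nat \<Rightarrow> real" and r :: nat
    and M :: "'a manifold" and \<phi> :: "'a \<Rightarrow> nat \<Rightarrow> real" and N :: "'a monoid" and g :: "'a metric_field"
begin

text \<open>The differentials \<open>L t\<close> at the identity of the automorphisms \<open>\<Theta> t\<close> preserve the scalar product and, because
  \<open>\<Theta> t\<close> commutes with conjugations, also the bracket. Their derivative at \<open>t = 0\<close> is therefore a skew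
  derivation. Linearity of \<open>L t\<close> and the derivative in \<open>t\<close> come from the chain rule for the joint coordinate
  expression of \<open>\<Theta>\<close>, which is smooth but not known to be polynomial.\<close>

lemma isotropy_is_null_rotation:
  assumes \<Theta>: "one_param_subgroup M (isometric_automorphisms N M g) \<Theta>"
  shows "\<exists>a \<in> coord_space m. S a = 0 \<and> (\<forall>u \<in> coords.
    (\<lambda>k. deriv (\<lambda>t. differential_at_one N cc (\<Theta> t) u k) 0) = null_rot a u)"
proof -
  define n where "n = Suc (Suc m)"
  let ?L = "line_manifold (UNIV :: real set)" and ?c = "chart_pair 1 line_coord \<phi>"
  interpret group N by (rule group_N)
  have \<Theta>_aut: "\<Theta> t \<in> isometric_automorphisms N M g" for t using \<Theta> by (simp add: one_param_subgroup_def)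
  have \<Theta>_hom: "\<Theta> t (x \<otimes>\<^bsub>N\<^esub> y) = \<Theta> t x \<otimes>\<^bsub>N\<^esub> \<Theta> t y" if "x \<in> points M" "y \<in> points M" for t x y
    using \<Theta>_aut[of t] that unfolding isometric_automorphisms_def iso_def hom_def carrier by blast
  have \<Theta>_in: "\<Theta> t x \<in> points M" if "x \<in> points M" for t x
    using \<Theta>_aut[of t] that unfolding isometric_automorphisms_def iso_def hom_def carrier by blast
  have \<Theta>_one: "\<Theta> t \<one>\<^bsub>N\<^esub> = \<one>\<^bsub>N\<^esub>" for t
  proof -
    have "\<Theta> t \<in> hom N N" using \<Theta>_aut[of t] by (simp add: isometric_automorphisms_def iso_def)
    then show ?thesis by (rule hom_one[OF _ group_N group_N])
  qed
  have \<Theta>_inv: "\<Theta> t (inv\<^bsub>N\<^esub> x) = inv\<^bsub>N\<^esub> (\<Theta> t x)" if "x \<in> points M" for t x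
  proof (rule inv_equality[symmetric])
    show "\<Theta> t (inv\<^bsub>N\<^esub> x) \<otimes>\<^bsub>N\<^esub> \<Theta> t x = \<one>\<^bsub>N\<^esub>"
      using \<Theta>_hom[OF pt_inv[OF that] that] \<Theta>_one that carrier by (simp flip: \<Theta>_hom)
  qed (use \<Theta>_in that pt_inv carrier in auto)
  have \<Theta>_0: "\<Theta> 0 x = x" if "x \<in> points M" for x
  proof -
    have "\<Theta> (0 + 0) x = \<Theta> 0 (\<Theta> 0 x)" using \<Theta> that unfolding one_param_subgroup_def by blast
    moreover have "inj_on (\<Theta> 0) (points M)"
      using \<Theta>_aut[of 0] by (simp add: isometric_automorphisms_def iso_def carrier bij_betw_def)
    ultimately show ?thesis using \<Theta>_in[OF that] that by (metis add_0 inj_onD)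
  qed
  have gP: "global_chart (prod_manifold ?L M) ?c"
  proof -
    have "line_coord ` UNIV = coord_space 1"
    proof (intro equalityI subsetI)
      fix z assume "z \<in> coord_space 1"
      then have "z = line_coord (z 0)" by (auto simp: line_coord_def coord_space_iff)
      then show "z \<in> range line_coord" by blast
    qed (auto simp: line_coord_def coord_space_iff)
    then have "global_chart ?L line_coord"
      by (simp add: global_chart_def single_chart_line)
    from global_chart_prod[OF this chart] show ?thesis by simp
  qed
  have dimP: "mdim (prod_manifold ?L M) = Suc n" and ptsP: "points (prod_manifold ?L M) = UNIV \<times> points M"
    by (simp_all add: prod_manifold_def dim n_def)
  define F where "F k z = \<phi> ((\<lambda>(t, x). \<Theta> t x) (inv_into (points (prod_manifold ?L M)) ?c z)) k" for k z
  have F_smooth: "Ck_on (Suc n) (coord_space (Suc n)) j (F k)" if "k < n" for j k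
  proof -
    have "smooth_map (prod_manifold ?L M) M (\<lambda>(t, x). \<Theta> t x)" using \<Theta> by (simp add: one_param_subgroup_def)
    from smooth_map_coord[OF global_chart_single[OF gP] global_chart_single[OF chart] this, of k] that
    have "smooth_on (Suc n) (?c ` points (prod_manifold ?L M)) (F k)"
      unfolding F_def[abs_def] dimP by (simp add: dim n_def)
    then show ?thesis using gP unfolding global_chart_def dimP smooth_on_def by simp
  qed
  define zz where "zz t u = (\<lambda>i. if i = 0 then t else u (i - 1))" for t :: real and u :: vec
  have zz_in: "zz t u \<in> coord_space (Suc n)" if "u \<in> coord_space n" for t u
    using that by (auto simp: zz_def coord_space_iff)
  have F_zz: "F k (zz t (\<phi> x)) = \<phi> (\<Theta> t x) k" if "x \<in> points M" for k t x
  proof -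
    have "zz t (\<phi> x) = ?c (t, x)" by (auto simp: zz_def chart_pair_def line_coord_def)
    then show ?thesis
      using single_chart_inv[OF global_chart_single[OF gP], of "(t, x)"] that by (simp add: F_def ptsP)
  qed
  define L where "L t u = (\<lambda>k. if k < n then \<Sum>i<n. partial_deriv (Suc i) (F k) (zz t 0) * u i else 0)" for t u
  have L_in: "L t u \<in> coord_space n" for t u by (simp add: L_def coord_space_iff)
  \<comment> \<open>The Jacobi matrix \<open>L t\<close> maps velocities of all curves through the identity, not only of rays: conjugates of rays
  are needed below.\<close>
  have L_vel: "vder (\<lambda>s. \<phi> (\<Theta> t (p s))) (L t X) 0"
    if p: "\<And>s. p s \<in> points M" "\<phi> (p 0) = 0" "vder (\<lambda>s. \<phi> (p s)) X 0" for t p X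
    unfolding vder_def
  proof
    fix k
    show "((\<lambda>s. \<phi> (\<Theta> t (p s)) k) has_real_derivative L t X k) (at 0)"
    proof (cases "k < n")
      case True
      have "((\<lambda>s. F k (zz t (\<phi> (p s)))) has_real_derivative
          (\<Sum>i<Suc n. partial_deriv i (F k) (zz t (\<phi> (p 0))) * zz 0 X i)) (at 0)"
      proof (rule chain_rule_curve[OF F_smooth[OF True]])
        show "zz t (\<phi> (p s)) \<in> coord_space (Suc n)" for s using zz_in p(1) by (simp add: n_def)
        fix i show "((\<lambda>s. zz t (\<phi> (p s)) i) has_real_derivative zz 0 X i) (at 0)"
          using p(3) by (cases "i = 0") (simp_all add: zz_def vder_def)
      qed
      moreover have "(\<Sum>i<Suc n. partial_deriv i (F k) (zz t (\<phi> (p 0))) * zz 0 X i) = L t X k"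
        using True p(2) by (subst sum.lessThan_Suc_shift) (simp add: zz_def L_def)
      ultimately show ?thesis using F_zz[OF p(1)] by simp
    next
      case False
      then have "\<phi> (\<Theta> t (p s)) k = 0" for s
        using chart_in[OF \<Theta>_in[OF p(1)]] by (simp add: coord_space_iff n_def)
      then show ?thesis using False by (simp add: L_def)
    qed
  qed
  have L_line: "vder (\<lambda>s. \<phi> (\<Theta> t (lie_ray N cc u s))) (L t u) 0" if "u \<in> coord_space n" for t u
    using that vder_line[of u] by (intro L_vel) (simp_all add: lie_ray n_def)
  have L_diff: "differential_at_one N cc (\<Theta> t) u = L t u" if "u \<in> coord_space n" for t u
    unfolding differential_at_one_def using L_line[OF that, of t]
    by (intro ext DERIV_imp_deriv) (simp add: vder_def)
  have vder_unique: "X = Y" if "vder f X s" "vder f Y s" for f X Y s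
    using that DERIV_unique unfolding vder_def by blast
  have L_0: "L 0 u = u" if "u \<in> coord_space n" for u
    using L_line[OF that, of 0] vder_line[of u 0] that \<Theta>_0 lie_ray[OF that[unfolded n_def]] vder_unique by simp
  have L_lin: "L t (u + v) = L t u + L t v" "L t (scl c u) = scl c (L t u)" "L t 0 = 0" for t u v c
    by (simp_all add: L_def fun_eq_iff distrib_left distrib_right sum.distrib sum_distrib_left mult_ac)
  define dd where "dd k i = deriv (\<lambda>t. partial_deriv (Suc i) (F k) (zz t 0)) 0" for k i
  define B where "B u = (\<lambda>k. if k < n then \<Sum>i<n. dd k i * u i else 0)" for u
  have B_der: "vder (\<lambda>t. L t u) (B u) 0" for u
    unfolding vder_def
  proof
    fix k
    have d: "((\<lambda>t. partial_deriv (Suc i) (F k) (zz t 0)) has_real_derivative dd k i) (at 0)" if "k < n" "i < n" for i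
    proof -
      have z: "zz 0 0 \<in> coord_space (Suc n)" by (rule zz_in) simp
      have "(\<lambda>t. partial_deriv (Suc i) (F k) ((zz 0 0)(0 := t))) differentiable (at (zz 0 0 0))"
        using F_smooth[OF that(1), of "Suc (Suc 0)"] that(2) z unfolding Ck_on.simps by blast
      moreover have "(zz 0 0)(0 := t) = zz t 0" for t by (auto simp: zz_def)
      moreover have "zz 0 0 0 = (0 :: real)" by (simp add: zz_def)
      ultimately show ?thesis unfolding dd_def by (simp only: DERIV_deriv_iff_real_differentiable)
    qed
    show "((\<lambda>t. L t u k) has_real_derivative B u k) (at 0)"
    proof (cases "k < n")
      case True
      then have "((\<lambda>t. \<Sum>i<n. partial_deriv (Suc i) (F k) (zz t 0) * u i) has_real_derivative (\<Sum>i<n. dd k i * u i)) (at 0)"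
        using d by (intro DERIV_sum DERIV_cmult_right) auto
      then show ?thesis using True by (simp add: L_def B_def)
    qed (simp add: L_def B_def)
  qed
  have B_lin: "B (u + v) = B u + B v" "B (scl c u) = scl c (B u)" for u v c
    by (simp_all add: B_def fun_eq_iff distrib_left distrib_right sum.distrib sum_distrib_left mult_ac)
  have B_in: "B u \<in> coord_space n" for u by (simp add: B_def coord_space_iff)
  have iso: "mform 0 (L t u) (L t v) = mform 0 u v" if uv: "u \<in> coord_space n" "v \<in> coord_space n" for t u v
  proof -
    let ?u = "lie_ray N cc u" and ?v = "lie_ray N cc v"
    have tc: "?u \<in> tangent_curves M \<one>\<^bsub>N\<^esub>" "?v \<in> tangent_curves M \<one>\<^bsub>N\<^esub>" using lie_ray(3) uv by (simp_all add: n_def)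
    then have 0: "?u 0 = \<one>\<^bsub>N\<^esub>" by (simp add: tangent_curves_def)
    have vel: "chart_velocity \<phi> (\<Theta> t \<circ> lie_ray N cc w) = L t w" if "w \<in> coord_space n" for w
      by (rule velocity_eqI) (use L_line[OF that] in simp)
    have "g (\<Theta> t \<circ> ?u) (\<Theta> t \<circ> ?v) = g ?u ?v"
      using \<Theta>_aut[of t] tc pt_one unfolding isometric_automorphisms_def isometry_def by blast
    moreover have "g (\<Theta> t \<circ> ?u) (\<Theta> t \<circ> ?v) = mform 0 (L t u) (L t v)"
      using metric[of "\<Theta> t \<circ> ?u"] vel uv by (simp add: 0 \<Theta>_one pt_one one)
    moreover have "g ?u ?v = mform 0 u v" using lie_form_eq uv by (simp add: lie_form_def n_def)
    ultimately show ?thesis by simp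
  qed
  have skew: "mform 0 (B u) v + mform 0 u (B v) = 0" if uv: "u \<in> coord_space n" "v \<in> coord_space n" for u v
  proof -
    have "((\<lambda>t. mform 0 (L t u) (L t v)) has_real_derivative mform 0 (B u) v + mform 0 u (B v)) (at 0)"
      using mform_0_deriv[OF B_der B_der, of u v] by (simp add: L_0 uv)
    moreover have "((\<lambda>t. mform 0 (L t u) (L t v)) has_real_derivative 0) (at 0)" by (simp add: iso uv)
    ultimately show ?thesis by (rule DERIV_unique)
  qed
  have conj: "L t (Ad (\<phi> a) w) = Ad (\<phi> (\<Theta> t a)) (L t w)" if a: "a \<in> points M" and w: "w \<in> coord_space n" for t a w
  proof -
    define p where "p s = a \<otimes>\<^bsub>N\<^esub> lie_ray N cc w s \<otimes>\<^bsub>N\<^esub> inv\<^bsub>N\<^esub> a" for s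
    have ray: "lie_ray N cc w s \<in> points M" "\<phi> (lie_ray N cc w s) = scl s w" for s
      using lie_ray w by (simp_all add: n_def)
    have p_in: "p s \<in> points M" for s by (simp add: p_def a ray pt_mult pt_inv)
    have pe: "\<phi> (p s) = pmul (pmul (\<phi> a) (scl s w)) (pinv (\<phi> a))" for s
      by (simp add: p_def a ray pt_mult pt_inv mult chart_inv)
    have "vder (\<lambda>s. \<phi> (\<Theta> t (p s))) (L t (Ad (\<phi> a) w)) 0"
    proof (rule L_vel[OF p_in])
      show "\<phi> (p 0) = 0" by (simp add: pe)
      show "vder (\<lambda>s. \<phi> (p s)) (Ad (\<phi> a) w) 0" unfolding pe by (rule vder_conj[OF vder_line]) simp
    qed
    moreover have "\<phi> (\<Theta> t (p s)) = pmul (pmul (\<phi> (\<Theta> t a)) (\<phi> (\<Theta> t (lie_ray N cc w s)))) (pinv (\<phi> (\<Theta> t a)))" for s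
      by (simp add: p_def \<Theta>_hom \<Theta>_inv \<Theta>_in a ray pt_mult pt_inv mult chart_inv)
    moreover have "vder (\<lambda>s. pmul (pmul (\<phi> (\<Theta> t a)) (\<phi> (\<Theta> t (lie_ray N cc w s)))) (pinv (\<phi> (\<Theta> t a))))
        (Ad (\<phi> (\<Theta> t a)) (L t w)) 0"
    proof (rule vder_conj[OF L_line[OF w]])
      have "lie_ray N cc w 0 = \<one>\<^bsub>N\<^esub>" by (rule chart_eqI) (simp_all add: ray pt_one one)
      then show "\<phi> (\<Theta> t (lie_ray N cc w 0)) = 0" by (simp add: \<Theta>_one one)
    qed
    ultimately show ?thesis using vder_unique by simp
  qed
  have aut: "L t (bracket u w) = bracket (L t u) (L t w)" if u: "u \<in> coord_space n" and w: "w \<in> coord_space n" for t u w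
  proof -
    have ray: "lie_ray N cc u s \<in> points M" "\<phi> (lie_ray N cc u s) = scl s u" for s
      using lie_ray u by (simp_all add: n_def)
    have r0: "lie_ray N cc u 0 = \<one>\<^bsub>N\<^esub>" by (rule chart_eqI) (simp_all add: ray pt_one one)
    have "vder (\<lambda>s. L t (Ad (\<phi> (lie_ray N cc u s)) w)) (L t (bracket u w)) 0"
    proof -
      have "vder (\<lambda>s. Ad (scl s u) w) (bracket u w) 0" by (rule vder_Ad[OF vder_line]) simp
      then show ?thesis
        unfolding ray(2) vder_def L_def by (auto intro!: DERIV_sum DERIV_cmult)
    qed
    moreover have "vder (\<lambda>s. Ad (\<phi> (\<Theta> t (lie_ray N cc u s))) (L t w)) (bracket (L t u) (L t w)) 0"
      by (rule vder_Ad[OF L_line[OF u]]) (simp add: r0 \<Theta>_one one)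
    ultimately show ?thesis using vder_unique conj[OF ray(1) w] by simp
  qed
  have der: "B (bracket u v) = bracket (B u) v + bracket u (B v)" if uv: "u \<in> coord_space n" "v \<in> coord_space n" for u v
  proof -
    have "vder (\<lambda>t. bracket (L t u) (L t v)) (bracket (B u) v + bracket u (B v)) 0"
      using vder_bracket[OF B_der B_der, of u v] by (simp add: L_0 uv)
    moreover have "vder (\<lambda>t. bracket (L t u) (L t v)) (B (bracket u v)) 0" using B_der by (simp add: aut[symmetric] uv)
    ultimately show ?thesis using vder_unique by blast
  qed
  have "(\<lambda>k. deriv (\<lambda>t. differential_at_one N cc (\<Theta> t) u k) 0) = B u" if "u \<in> coord_space n" for u
    unfolding L_diff[OF that] using B_der[of u] unfolding vder_def by (intro ext DERIV_imp_deriv) blast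
  moreover have "\<exists>a\<in>coord_space m. S a = 0 \<and> (\<forall>u\<in>coords. B u = null_rot a u)"
    by (rule skew_derivation_is_null_rotation) (use B_lin B_in skew der in \<open>simp_all add: n_def\<close>)
  ultimately show ?thesis by (simp add: n_def)
qed

lemma isotropy_algebra_eq: "isotropy_algebra N M g cc = {null_rot a | a. a \<in> coord_space m \<and> S a = 0}"
proof (intro equalityI subsetI)
  fix A assume "A \<in> isotropy_algebra N M g cc"
  then obtain \<Theta> where \<Theta>: "one_param_subgroup M (isometric_automorphisms N M g) \<Theta>"
    and A: "A = (\<lambda>u k. if u \<in> lie_space M then deriv (\<lambda>t. differential_at_one N cc (\<Theta> t) u k) 0 else 0)"
    unfolding isotropy_algebra_def by blast
  obtain a where a: "a \<in> coord_space m" "S a = 0" "\<And>u. u \<in> coords \<Longrightarrow>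
      (\<lambda>k. deriv (\<lambda>t. differential_at_one N cc (\<Theta> t) u k) 0) = null_rot a u"
    using isotropy_is_null_rotation[OF \<Theta>] by blast
  have "A u k = null_rot a u k" for u k
    using fun_cong[OF a(3), of u k] by (cases "u \<in> coords") (simp_all add: A mdim_space null_rot_def)
  then show "A \<in> {null_rot a | a. a \<in> coord_space m \<and> S a = 0}" using a(1,2) by blast
qed (use null_rotation_in_isotropy in auto)

text \<open>The elements \<open>A\<^bsub>S v\<^esub> + T\<close> that generate the geodesics with initial velocity \<open>T\<close>, where \<open>v\<close> is the \<open>V\<close>-part of \<open>T\<close>.
  They form a subspace because \<open>A\<^bsub>S v\<^esub>\<close> is linear in \<open>T\<close>.\<close>

definition reductive_space :: "semidirect_elem set" where
  "reductive_space = {(null_rot (S (pv u)), u) | u. u \<in> coords}"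

lemma sd_zero_eq: "sd_zero = (null_rot 0, 0)"
  by (auto simp: sd_zero_def null_rot_linear fun_eq_iff)

lemma sd_add_eq: "sd_add (null_rot a, u) (null_rot b, v) = (null_rot (a + b), u + v)"
  by (auto simp: sd_add_def null_rot_linear fun_eq_iff)

lemma sd_scale_eq: "sd_scale c (null_rot a, u) = (null_rot (scl c a), scl c u)"
  by (auto simp: sd_scale_def null_rot_linear fun_eq_iff)

text \<open>Null rotations commute, so the bracket has no component in the isotropy algebra before it is split along the
  new complement.\<close>

lemma sd_bracket_eq:
  assumes "a \<in> coord_space m" "b \<in> coord_space m" "u \<in> coords" "v \<in> coords"
  shows "sd_bracket N cc (null_rot a, u) (null_rot b, v) = (null_rot 0, null_rot a v - null_rot b u + bracket u v)"
  using null_rot_commute[OF assms(1,2)] lie_bracket_eq[OF assms(3,4)]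
  by (auto simp: sd_bracket_def null_rot_linear fun_eq_iff)

lemma isotropy_subalgebra_eq: "isotropy_subalgebra N M g cc = {(null_rot a, 0) | a. a \<in> coord_space m \<and> S a = 0}"
  by (auto simp: isotropy_subalgebra_def isotropy_algebra_eq zero_fun_def)

text \<open>A null rotation with \<open>S a = 0\<close> maps \<open>T\<close> to \<open>x a - \<langle>a, v\<rangle> e\<close>, whose \<open>V\<close>-part lies in the kernel of \<open>S\<close>. Its
  image under \<open>T \<mapsto> A\<^bsub>S v\<^esub> + T\<close> is therefore itself, which gives invariance.\<close>

lemma reductive_space_complement: "reductive_complement N M g cc reductive_space"
  unfolding reductive_complement_def
proof (intro conjI ballI)
  show "reductive_space \<subseteq> semidirect_algebra N M g cc"
    by (auto simp: reductive_space_def semidirect_algebra_def isotropy_algebra_eq mdim_space)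
  show "sd_subspace reductive_space"
    unfolding sd_subspace_def
  proof (intro conjI ballI allI)
    show "sd_zero \<in> reductive_space" by (auto simp: reductive_space_def sd_zero_eq intro!: exI[of _ 0])
    fix X assume "X \<in> reductive_space"
    then obtain u where u: "X = (null_rot (S (pv u)), u)" "u \<in> coords" unfolding reductive_space_def by blast
    show "sd_scale c X \<in> reductive_space" for c
      using u by (auto simp: reductive_space_def sd_scale_eq intro!: exI[of _ "scl c u"])
    fix Y assume "Y \<in> reductive_space"
    then obtain v where v: "Y = (null_rot (S (pv v)), v)" "v \<in> coords" unfolding reductive_space_def by blast
    show "sd_add X Y \<in> reductive_space"
      using u v by (auto simp: reductive_space_def sd_add_eq intro!: exI[of _ "u + v"])
  qed
  show "isotropy_subalgebra N M g cc \<inter> reductive_space = {sd_zero}"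
    by (auto simp: isotropy_subalgebra_eq reductive_space_def sd_zero_eq intro!: exI[of _ 0])
next
  fix X assume "X \<in> semidirect_algebra N M g cc"
  then obtain a u where X: "X = (null_rot a, u)" "a \<in> coord_space m" "S a = 0" "u \<in> coords"
    unfolding semidirect_algebra_def isotropy_algebra_eq mdim_space by blast
  have "X = sd_add (null_rot (a - S (pv u)), 0) (null_rot (S (pv u)), u)" by (simp add: sd_add_eq X(1))
  moreover have "(null_rot (a - S (pv u)), 0) \<in> isotropy_subalgebra N M g cc"
    unfolding isotropy_subalgebra_eq using X by force
  moreover have "(null_rot (S (pv u)), u) \<in> reductive_space" unfolding reductive_space_def using X by blast
  ultimately show "\<exists>Z\<in>isotropy_subalgebra N M g cc. \<exists>T\<in>reductive_space. X = sd_add Z T" by blast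
next
  fix Z T assume "Z \<in> isotropy_subalgebra N M g cc" "T \<in> reductive_space"
  then obtain a u where Z: "Z = (null_rot a, 0)" "a \<in> coord_space m" "S a = 0"
    and T: "T = (null_rot (S (pv u)), u)" "u \<in> coords"
    unfolding isotropy_subalgebra_eq reductive_space_def by blast
  have "null_rot a u - null_rot (S (pv u)) 0 + bracket 0 u = null_rot a u"
    by (rule mk_eqI) (simp_all add: bracket_def null_rot_def)
  then have "sd_bracket N cc Z T = (null_rot 0, null_rot a u)"
    using sd_bracket_eq[OF Z(2) _ _ T(2), of "S (pv u)" 0] by (simp add: Z(1) T(1))
  moreover have "S (pv (null_rot a u)) = 0" using Z(3) by (simp add: null_rot_def T(2))
  ultimately show "sd_bracket N cc Z T \<in> reductive_space"
    unfolding reductive_space_def using null_rot_in[OF Z(2), of u] by force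
qed

theorem naturally_reductive_N: "naturally_reductive N M g"
  unfolding naturally_reductive_def
proof (intro ballI impI)
  fix c assume "c \<in> atlas M"
  then have c: "c = cc" using chart by (simp add: global_chart_def single_chart_def)
  show "\<exists>\<mm>. reductive_complement N M g c \<mm> \<and> (\<forall>T'\<in>\<mm>. \<forall>T\<in>\<mm>. \<exists>Z\<in>isotropy_subalgebra N M g c. \<exists>Y\<in>\<mm>.
              sd_bracket N c T' T = sd_add Z Y \<and> sd_form N g c Y T = 0)"
    unfolding c
  proof (intro exI[of _ reductive_space] conjI ballI reductive_space_complement)
    fix T' T assume "T' \<in> reductive_space" "T \<in> reductive_space"
    then obtain u' u where T': "T' = (null_rot (S (pv u')), u')" "u' \<in> coords"
      and T: "T = (null_rot (S (pv u)), u)" "u \<in> coords" unfolding reductive_space_def by blast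
    define y where "y = null_rot (S (pv u')) u - null_rot (S (pv u)) u' + bracket u' u"
    have y_in: "y \<in> coords" by (simp add: y_def null_rot_in)
    have "sd_bracket N cc T' T = (null_rot 0, y)"
      using sd_bracket_eq[of "S (pv u')" "S (pv u)" u' u] T T' by (simp add: y_def)
    also have "\<dots> = sd_add (null_rot (- S (pv y)), 0) (null_rot (S (pv y)), y)" by (simp add: sd_add_eq)
    finally have 1: "sd_bracket N cc T' T = sd_add (null_rot (- S (pv y)), 0) (null_rot (S (pv y)), y)" .
    have 2: "(null_rot (- S (pv y)), 0) \<in> isotropy_subalgebra N M g cc" unfolding isotropy_subalgebra_eq by force
    have 3: "(null_rot (S (pv y)), y) \<in> reductive_space" unfolding reductive_space_def using y_in by blast
    \<comment> \<open>The component along the complement has the same tangent part \<open>y\<close>, and \<open>\<langle>y, T\<rangle> = 0\<close> uses only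
    \<open>S = J + D\<^sup>T\<close> and the skewness of \<open>J\<close>.\<close>
    have "mform 0 y u = 0"
    proof -
      define v v' where "v = pv u" and "v' = pv u'"
      have "S v \<cdot> v = D v \<cdot> v" using S_ip[of v v] ip_commute[of m v "D v"] by simp
      moreover have "S v \<cdot> v' = - (J v' \<cdot> v) + D v' \<cdot> v"
        using S_ip[of v v'] J_skew[of v v'] ip_commute[of m v "D v'"] by simp
      ultimately show ?thesis
        using T(2) T'(2) by (simp add: mform_0 y_def null_rot_def bracket_def algebra_simps flip: v_def v'_def)
    qed
    then have "sd_form N g cc (null_rot (S (pv y)), y) T = 0"
      using lie_form_eq[OF y_in T(2)] by (simp add: sd_form_def T(1))
    then show "\<exists>Z\<in>isotropy_subalgebra N M g cc. \<exists>Y\<in>reductive_space. sd_bracket N cc T' T = sd_add Z Y \<and> sd_form N g cc Y T = 0"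
      using 1 2 3 by blast
  qed
qed

end

section \<open>Models on the coordinate space and their products with Euclidean space\<close>

definition std_manifold :: "nat \<Rightarrow> vec manifold" where
  "std_manifold k = \<lparr>mtop = Euclidean_space k, mdim = k, atlas = {(coord_space k, \<lambda>x. x)}\<rparr>"

lemma std_manifold_simps [simp]: "points (std_manifold k) = coord_space k" "mdim (std_manifold k) = k"
  by (simp_all add: std_manifold_def)

lemma global_chart_std: "global_chart (std_manifold k) (\<lambda>x. x)"
proof -
  have "homeomorphic_map (Euclidean_space k) (Euclidean_space k) (\<lambda>x. x)"
    using homeomorphic_map_id[of "Euclidean_space k" "Euclidean_space k"] by (simp add: id_def)
  then show ?thesis
    by (simp add: global_chart_def single_chart_def std_manifold_def)
qed

lemma sum_lessThan_add: "(\<Sum>i<m + k. f i) = (\<Sum>i<m. f i) + (\<Sum>i<k. f (m + i))"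
  for f :: "nat \<Rightarrow> real"
  by (induction k) (simp_all add: add.assoc)

definition eucl_group :: "nat \<Rightarrow> vec monoid" where
  "eucl_group k = \<lparr>carrier = coord_space k, mult = (+), one = 0\<rparr>"

definition eucl_metric :: "nat \<Rightarrow> vec metric_field" where
  "eucl_metric k \<alpha> \<beta> = ip k (chart_velocity (\<lambda>x. x) \<alpha>) (chart_velocity (\<lambda>x. x) \<beta>)"

lemma eucl_group_simps [simp]: "carrier (eucl_group k) = coord_space k"
    "x \<otimes>\<^bsub>eucl_group k\<^esub> y = x + y" "\<one>\<^bsub>eucl_group k\<^esub> = 0"
  by (simp_all add: eucl_group_def)

lemma group_eucl: "group (eucl_group k)"
proof (rule groupI)
  show "\<exists>y\<in>carrier (eucl_group k). y \<otimes>\<^bsub>eucl_group k\<^esub> x = \<one>\<^bsub>eucl_group k\<^esub>" if "x \<in> carrier (eucl_group k)" for x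
    by (rule bexI[of _ "- x"]) (use that in simp_all)
qed (simp_all add: add.assoc)

lemma inv_eucl: "x \<in> coord_space k \<Longrightarrow> inv\<^bsub>eucl_group k\<^esub> x = - x"
  by (rule group.inv_equality[OF group_eucl]) simp_all

lemma eucl_nilmanifold:
  assumes "0 < k"
  shows "pseudo_riemannian_nilmanifold (eucl_group k) (std_manifold k) (eucl_metric k)"
proof -
  note chart = global_chart_std[of k]
  have lg: "lie_group (eucl_group k) (std_manifold k)"
  proof (rule lie_groupI[OF chart group_eucl])
    show "polynomial_fun (\<lambda>z. z i + z (i + k))" "polynomial_fun (\<lambda>z. - z i)" for i
      by (intro polynomial_intros)+
  qed (auto simp: chart_pair_def inv_eucl)
  have pr: "pseudo_riemannian_metric (std_manifold k) (eucl_metric k)"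
  proof (rule pseudo_riemannian_metricI[OF chart, where \<Gamma> = "\<lambda>x. ip k"])
    show "eucl_metric k \<alpha> \<beta> = ip k (chart_velocity (\<lambda>x. x) \<alpha>) (chart_velocity (\<lambda>x. x) \<beta>)" for \<alpha> \<beta>
      by (simp add: eucl_metric_def)
    fix u v :: vec
    have "ip k (unit_coord i) (unit_coord j) = (if i = j then 1 else 0)" if "i < k" "j < k" for i j
      using that by (subst ip_unit) (auto simp: unit_coord_def)
    then have "(\<Sum>i<k. \<Sum>j<k. ip k (unit_coord i) (unit_coord j) * u i * v j) = (\<Sum>i<k. \<Sum>j<k. if i = j then u i * v j else 0)"
      by (intro sum.cong) auto
    then show "ip k u v = (\<Sum>i<mdim (std_manifold k). \<Sum>j<mdim (std_manifold k).
        ip k (unit_coord i) (unit_coord j) * u i * v j)" by (simp add: ip_def)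
    assume u: "u \<in> coord_space (mdim (std_manifold k))"
      and 0: "\<And>v. v \<in> coord_space (mdim (std_manifold k)) \<Longrightarrow> ip k u v = 0"
    have "u = 0" by (rule ip_self_zero) (use u 0 in simp_all)
    then show "u = (\<lambda>_. 0)" by (simp only: zero_fun_def)
  qed (auto intro: polynomial_const ip_commute)
  have li: "left_invariant (eucl_group k) (std_manifold k) (eucl_metric k)"
    unfolding left_invariant_def
  proof
    fix a assume a: "a \<in> carrier (eucl_group k)"
    show "isometry (std_manifold k) (eucl_metric k) (\<lambda>x. a \<otimes>\<^bsub>eucl_group k\<^esub> x)"
    proof (rule isometryI[OF chart, where F' = "\<lambda>x. - a + x"])
      show "polynomial_fun (\<lambda>z. a i + z i)" "polynomial_fun (\<lambda>z. - a i + z i)" for i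
        by (intro polynomial_intros)+
      fix p \<alpha> \<beta>
      assume ab: "\<alpha> \<in> tangent_curves (std_manifold k) p" "\<beta> \<in> tangent_curves (std_manifold k) p"
      have "chart_velocity (\<lambda>x. x) ((\<lambda>x. a \<otimes>\<^bsub>eucl_group k\<^esub> x) \<circ> \<gamma>) i = chart_velocity (\<lambda>x. x) \<gamma> i"
        if "\<gamma> \<in> tangent_curves (std_manifold k) p" "i < k" for \<gamma> i
      proof -
        have "((\<lambda>t. \<gamma> t i) has_real_derivative chart_velocity (\<lambda>x. x) \<gamma> i) (at 0)"
          using tangent_curve_differentiable(1)[OF chart that(1)] that(2) by simp
        from DERIV_add[OF DERIV_const this, of "a i"]
        have "((\<lambda>t. a i + \<gamma> t i) has_real_derivative chart_velocity (\<lambda>x. x) \<gamma> i) (at 0)" by simp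
        then show ?thesis by (simp add: chart_velocity_def[of _ "_ \<circ> \<gamma>"] DERIV_imp_deriv)
      qed
      then show "eucl_metric k ((\<lambda>x. a \<otimes>\<^bsub>eucl_group k\<^esub> x) \<circ> \<alpha>) ((\<lambda>x. a \<otimes>\<^bsub>eucl_group k\<^esub> x) \<circ> \<beta>) = eucl_metric k \<alpha> \<beta>"
        using ab by (simp add: eucl_metric_def ip_def)
    qed (use a in \<open>auto simp: fun_eq_iff\<close>)
  qed
  have "nilpotent_of_step (eucl_group k) 1"
  proof -
    interpret group "eucl_group k" by (rule group_eucl)
    have "x \<otimes>\<^bsub>eucl_group k\<^esub> y \<otimes>\<^bsub>eucl_group k\<^esub> inv\<^bsub>eucl_group k\<^esub> x \<otimes>\<^bsub>eucl_group k\<^esub> inv\<^bsub>eucl_group k\<^esub> y = 0"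
      if "x \<in> coord_space k" "y \<in> coord_space k" for x y using that by (simp add: inv_eucl)
    then have "{x \<otimes>\<^bsub>eucl_group k\<^esub> y \<otimes>\<^bsub>eucl_group k\<^esub> inv\<^bsub>eucl_group k\<^esub> x \<otimes>\<^bsub>eucl_group k\<^esub> inv\<^bsub>eucl_group k\<^esub> y |x y.
        x \<in> lower_central (eucl_group k) 0 \<and> y \<in> carrier (eucl_group k)} \<subseteq> {\<one>\<^bsub>eucl_group k\<^esub>}" by auto
    from generate_subgroup_incl[OF this triv_subgroup]
    have "lower_central (eucl_group k) 1 \<subseteq> {0}" unfolding One_nat_def lower_central.simps by simp
    moreover have "0 \<in> lower_central (eucl_group k) 1" using generate.one[of "eucl_group k"] by simp
    moreover have "coord_space k \<noteq> {0}"
    proof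
      assume "coord_space k = {0}"
      then have "unit_coord 0 = (0 :: vec)" using unit_coord_in[OF assms] by blast
      from fun_cong[OF this, of 0] show False by (simp add: unit_coord_def)
    qed
    ultimately show ?thesis by (auto simp: nilpotent_of_step_def)
  qed
  then show ?thesis
    unfolding pseudo_riemannian_nilmanifold_def
    using lg pr li connected_global_chart[OF chart] by blast
qed

context nil_data
begin

definition std_group :: "vec monoid" where
  "std_group = \<lparr>carrier = coord_space (Suc (Suc m)), mult = pmul, one = 0\<rparr>"

definition std_metric :: "vec metric_field" where
  "std_metric \<alpha> \<beta> = mform (\<alpha> 0) (chart_velocity (\<lambda>x. x) \<alpha>) (chart_velocity (\<lambda>x. x) \<beta>)"

lemma std_model: "nil_model m Dm Jm r (std_manifold (Suc (Suc m))) (\<lambda>x. x) std_group std_metric"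
  by unfold_locales (simp_all add: global_chart_std std_group_def std_metric_def)

lemma Jm_zero': "m \<le> j \<Longrightarrow> Jm i j = 0"
  using Jm_zero Jm_skew[of i j] by simp

lemma ap_extend: "(\<And>i j. m \<le> j \<Longrightarrow> A i j = 0) \<Longrightarrow> ap (m + k) A v = ap m A v"
  unfolding ap_def by (intro ext sum.mono_neutral_right) auto

lemma ip_extend: "v \<in> coord_space m \<Longrightarrow> ip (m + k) v w = ip m v w"
  unfolding ip_def by (intro sum.mono_neutral_right) (auto simp: coord_space_iff)

text \<open>The matrices stay the same and only the dimension of \<open>V\<close> grows: outside the first \<open>m\<close> coordinates they vanish.\<close>

lemma product_data: "nil_data (m + k) Dm Jm r"
proof
  have t: "ap (m + k) (\<lambda>i j. Dm j i) v = Dt v" for v by (rule ap_extend[OF Dm_zero(1)])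
  have d: "ap (m + k) Dm = D" and j: "ap (m + k) Jm = J"
    by (rule ext, rule ap_extend[OF Dm_zero(2)], assumption) (rule ext, rule ap_extend[OF Jm_zero'], assumption)
  show "ap (m + k) Jm (ap (m + k) Dm v) = - ap (m + k) (\<lambda>i j. Dm j i) (ap (m + k) Jm v)" for v
    unfolding t d j by (rule JD)
  show "ap (m + k) Jm w + ap (m + k) (\<lambda>i j. Dm j i) w = 0"
    if "w = ap (m + k) Jm v + ap (m + k) (\<lambda>i j. Dm j i) v" for v w
    using that unfolding t d j by (rule SS)
  show "(ap (m + k) Dm ^^ r) v = 0" for v unfolding d by (rule D_nil)
  show "Jm i j = - Jm j i" for i j by (rule Jm_skew)
qed (auto simp: Dm_zero Jm_zero)

text \<open>The flat factor is orthogonal to \<open>e\<close> and \<open>f\<close> and commutes with everything, so it can be counted as part of \<open>V\<close>; the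
  coordinates of a pair are already in the right order.\<close>

lemma product_model:
  "nil_model (m + k) Dm Jm r (prod_manifold (std_manifold (Suc (Suc m))) (std_manifold k))
     (chart_pair (Suc (Suc m)) (\<lambda>x. x) (\<lambda>x. x)) (std_group \<times>\<times> eucl_group k) (product_metric std_metric (eucl_metric k))"
proof -
  interpret P: nil_data "m + k" Dm Jm r by (rule product_data)
  let ?c = "chart_pair (Suc (Suc m)) (\<lambda>x. x) (\<lambda>x. x)"
  have PD: "ap (m + k) Dm = D" and PJ: "ap (m + k) Jm = J"
    by (rule ext, rule ap_extend[OF Dm_zero(2)], assumption) (rule ext, rule ap_extend[OF Jm_zero'], assumption)
  have Pex: "P.ex = ex" unfolding P.ex_def[abs_def] ex_def[abs_def] PD ..
  define cat where "cat v q = (\<lambda>i. if i < m then v i else q (i - m))" for v q :: vec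
  have pvc: "pv (?c (p, q)) = cat (pv p) q" and c0: "?c (p, q) 0 = p 0" and c1: "?c (p, q) (Suc 0) = p (Suc 0)"
    for p q by (auto simp: pv_def chart_pair_def cat_def fun_eq_iff Suc_diff_le)
  have Dc: "D (cat v q) = D v" and Jc: "J (cat v q) = J v" for v q
    by (auto simp: ap_def cat_def)
  have Ec: "E x (cat v q) = cat (E x v) q" if "v \<in> coord_space m" for x v q
  proof -
    have e: "E x w = w - ex (Suc 0) x (D w)" for w using D_ex1[of x w] E_D[of "Suc 0" x w] by (simp add: algebra_simps)
    have "ex (Suc 0) x (D v) \<in> coord_space m" by simp
    then show ?thesis unfolding e[of "cat v q"] e[of v] Dc by (auto simp: cat_def coord_space_iff fun_eq_iff)
  qed
  have cat_add: "cat v q + cat v' q' = cat (v + v') (q + q')" for v q v' q' by (auto simp: cat_def)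
  have cat_D: "cat v q + scl c (D w) = cat (v + scl c (D w)) q" for v q c w
    using in_space(1)[of w] by (auto simp: cat_def coord_space_iff fun_eq_iff)
  have ipJ: "ip (m + k) (J v) (cat w q) = J v \<cdot> w" for v w q
    by (subst ip_extend) (simp_all add: ip_def cat_def)
  have ipc: "ip (m + k) (cat v q) (cat w s) = v \<cdot> w + ip k q s" for v q w s
    unfolding ip_def sum_lessThan_add by (simp add: cat_def)
  have mult: "?c (pmul p p', q + q') = P.pmul (?c (p, q)) (?c (p', q'))"
    if "p \<in> coord_space (Suc (Suc m))" for p p' q q'
  proof (rule mk_eqI)
    have v: "pv p \<in> coord_space m" using that by simp
    show "?c (pmul p p', q + q') (Suc 0) = P.pmul (?c (p, q)) (?c (p', q')) (Suc 0)"
      by (simp add: c0 c1 pvc PD PJ Pex Ec[OF v] Jc ipJ)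
    show "pv (?c (pmul p p', q + q')) = pv (P.pmul (?c (p, q)) (?c (p', q')))"
      by (simp add: pvc c0 Pex Ec[OF v] cat_add add.commute[of q q'])
  qed (simp add: c0)
  have vel: "chart_velocity ?c \<alpha> = ?c (chart_velocity (\<lambda>x. x) (fst \<circ> \<alpha>), chart_velocity (\<lambda>x. x) (snd \<circ> \<alpha>))" for \<alpha>
    by (auto simp: chart_velocity_def chart_pair_def fun_eq_iff case_prod_beta)
  have metric: "mform p X Y + ip k X' Y' = P.mform (?c (p, q)) (?c (X, X')) (?c (Y, Y'))" for p q X X' Y Y'
  proof -
    have th: "P.\<theta> (?c (p, q)) (?c (X, X')) = cat (\<theta> p X) X'" for X X'
      by (simp add: P.\<theta>_def \<theta>_def pvc c0 PD Dc cat_D)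
    have si: "P.\<sigma> (?c (p, q)) (?c (X, X')) = \<sigma> p X" for X X'
      by (simp add: P.\<sigma>_def \<sigma>_def th pvc c1 PJ Jc ipJ)
    show ?thesis by (simp add: P.mform_def mform_def th si c0 ipc)
  qed
  show ?thesis
  proof
    show "global_chart (prod_manifold (std_manifold (Suc (Suc m))) (std_manifold k)) ?c"
      using global_chart_prod[OF global_chart_std global_chart_std, of "Suc (Suc m)" k] by simp
    show "?c \<one>\<^bsub>std_group \<times>\<times> eucl_group k\<^esub> = 0"
      by (auto simp: chart_pair_def std_group_def fun_eq_iff)
  next
    fix x y assume "x \<in> points (prod_manifold (std_manifold (Suc (Suc m))) (std_manifold k))"
      "y \<in> points (prod_manifold (std_manifold (Suc (Suc m))) (std_manifold k))"
    then obtain p q p' q' where "x = (p, q)" "y = (p', q')" "p \<in> coord_space (Suc (Suc m))"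
      by (cases x; cases y) (auto simp: prod_manifold_def)
    then show "?c (x \<otimes>\<^bsub>std_group \<times>\<times> eucl_group k\<^esub> y) = P.pmul (?c x) (?c y)"
      using mult by (simp add: std_group_def)
  next
    fix \<alpha> \<beta> :: "real \<Rightarrow> vec \<times> vec"
    have "?c (\<alpha> 0) = ?c (fst (\<alpha> 0), snd (\<alpha> 0))" by simp
    then show "product_metric std_metric (eucl_metric k) \<alpha> \<beta> = P.mform (?c (\<alpha> 0)) (chart_velocity ?c \<alpha>) (chart_velocity ?c \<beta>)"
      unfolding vel by (simp only: metric[symmetric]) (simp add: product_metric_def std_metric_def eucl_metric_def)
  qed (auto simp: prod_manifold_def std_group_def)
qed

end

section \<open>A nilpotent matrix of large index\<close>

text \<open>The block matrix with rows \<open>(\<sigma> (A - A\<^sup>T), A)\<close> and \<open>(\<rho> A\<^sup>T, 0)\<close>, where \<open>A\<close> is the nilpotent shift. The parameters let one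
  formula cover \<open>D\<close> (both \<open>1\<close>), \<open>J\<close> (\<open>\<rho> = -1\<close>) and \<open>D\<^sup>T\<close> (\<open>\<sigma> = -1\<close>).\<close>

definition block_matrix :: "nat \<Rightarrow> real \<Rightarrow> real \<Rightarrow> nat \<Rightarrow> nat \<Rightarrow> real" where
  "block_matrix n \<sigma> \<rho> i j = (let A = (\<lambda>i j. if j = Suc i \<and> j < n then 1 else 0) in
     if i < n \<and> j < n then \<sigma> * (A i j - A j i) else if i < n then A i (j - n) else if j < n then \<rho> * A j (i - n) else 0)"

text \<open>The actions of \<open>A\<close> and \<open>A\<^sup>T\<close>. They truncate at \<open>n\<close>, so they can be applied to a vector of both blocks and then
  see only the first one.\<close>

definition shift_up :: "nat \<Rightarrow> vec \<Rightarrow> vec" where "shift_up n x = (\<lambda>i. if Suc i < n then x (Suc i) else 0)"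
definition shift_down :: "nat \<Rightarrow> vec \<Rightarrow> vec" where "shift_down n x = (\<lambda>i. if 0 < i \<and> i < n then x (i - 1) else 0)"
definition second_block :: "nat \<Rightarrow> vec \<Rightarrow> vec" where "second_block n v = (\<lambda>i. v (n + i))"
definition join_blocks :: "nat \<Rightarrow> vec \<Rightarrow> vec \<Rightarrow> vec" where
  "join_blocks n a b = (\<lambda>i. if i < n then a i else if i < 2 * n then b (i - n) else 0)"

lemma shift_up_linear [simp]: "shift_up n (x + y) = shift_up n x + shift_up n y" "shift_up n (x - y) = shift_up n x - shift_up n y" "shift_up n (- x) = - shift_up n x"
    "shift_up n (scl c x) = scl c (shift_up n x)" "shift_up n 0 = 0"
  by (auto simp: shift_up_def)

lemma shift_down_linear [simp]: "shift_down n (x + y) = shift_down n x + shift_down n y" "shift_down n (x - y) = shift_down n x - shift_down n y" "shift_down n (- x) = - shift_down n x"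
    "shift_down n (scl c x) = scl c (shift_down n x)" "shift_down n 0 = 0"
  by (auto simp: shift_down_def)

lemma shift_up_join_blocks [simp]: "shift_up n (join_blocks n a b) = shift_up n a" and shift_down_join_blocks [simp]: "shift_down n (join_blocks n a b) = shift_down n a"
  by (auto simp: shift_up_def shift_down_def join_blocks_def fun_eq_iff)

lemma shift_up_second_block_join_blocks [simp]: "shift_up n (second_block n (join_blocks n a b)) = shift_up n b"
  by (auto simp: shift_up_def second_block_def join_blocks_def)

lemma join_blocks_linear: "join_blocks n a b + join_blocks n a' b' = join_blocks n (a + a') (b + b')" "join_blocks n a b - join_blocks n a' b' = join_blocks n (a - a') (b - b')"
    "- join_blocks n a b = join_blocks n (- a) (- b)" "scl c (join_blocks n a b) = join_blocks n (scl c a) (scl c b)" "join_blocks n 0 0 = 0"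
  by (auto simp: join_blocks_def)

lemma ap_block_matrix: "ap (2 * n) (block_matrix n \<sigma> \<rho>) v = join_blocks n (scl \<sigma> (shift_up n v - shift_down n v) + shift_up n (second_block n v)) (scl \<rho> (shift_down n v))"
proof
  fix i
  define A :: "nat \<Rightarrow> nat \<Rightarrow> real" where "A i j = (if j = Suc i \<and> j < n then 1 else 0)" for i j
  have K: "block_matrix n \<sigma> \<rho> i j = (if i < n \<and> j < n then \<sigma> * (A i j - A j i) else if i < n then A i (j - n)
      else if j < n then \<rho> * A j (i - n) else 0)" for j by (simp add: block_matrix_def A_def)
  have A1: "(\<Sum>j<n. A i j * x j) = shift_up n x i" for x :: vec and i
  proof -
    have "(\<Sum>j<n. A i j * x j) = (\<Sum>j<n. if j = Suc i then x j else 0)" by (intro sum.cong) (auto simp: A_def)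
    then show ?thesis by (simp add: shift_up_def)
  qed
  have A2: "(\<Sum>j<n. A j i * x j) = shift_down n x i" if "i < n" for x :: vec and i
  proof -
    have "(\<Sum>j<n. A j i * x j) = (\<Sum>j<n. if j = i - 1 then (if 0 < i then x j else 0) else 0)"
      by (intro sum.cong) (use that in \<open>auto simp: A_def\<close>)
    then show ?thesis using that by (auto simp: shift_down_def)
  qed
  have s: "ap (2 * n) (block_matrix n \<sigma> \<rho>) v i = (\<Sum>j<n. block_matrix n \<sigma> \<rho> i j * v j) + (\<Sum>j<n. block_matrix n \<sigma> \<rho> i (n + j) * v (n + j))"
    unfolding ap_def mult_2 by (rule sum_lessThan_add)
  show "ap (2 * n) (block_matrix n \<sigma> \<rho>) v i = join_blocks n (scl \<sigma> (shift_up n v - shift_down n v) + shift_up n (second_block n v)) (scl \<rho> (shift_down n v)) i"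
  proof (cases "i < n")
    case True
    have "(\<Sum>j<n. block_matrix n \<sigma> \<rho> i j * v j) = \<sigma> * ((\<Sum>j<n. A i j * v j) - (\<Sum>j<n. A j i * v j))"
      unfolding sum_subtractf[symmetric] sum_distrib_left by (intro sum.cong) (auto simp: K True algebra_simps)
    moreover have "(\<Sum>j<n. block_matrix n \<sigma> \<rho> i (n + j) * v (n + j)) = (\<Sum>j<n. A i j * second_block n v j)"
      by (intro sum.cong) (auto simp: K True second_block_def)
    ultimately show ?thesis unfolding s A1 A2[OF True] by (simp add: join_blocks_def True)
  next
    case False
    have "(\<Sum>j<n. block_matrix n \<sigma> \<rho> i j * v j) = \<rho> * (\<Sum>j<n. A j (i - n) * v j)"
      unfolding sum_distrib_left by (intro sum.cong) (auto simp: K False)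
    moreover have "(\<Sum>j<n. block_matrix n \<sigma> \<rho> i (n + j) * v (n + j)) = 0"
      by (intro sum.neutral) (auto simp: K False)
    moreover have "(\<Sum>j<n. A j (i - n) * v j) = 0" if "\<not> i < 2 * n"
      by (intro sum.neutral) (use that in \<open>auto simp: A_def\<close>)
    ultimately show ?thesis using False A2[of "i - n" v] unfolding s by (simp add: join_blocks_def)
  qed
qed

lemma block_matrix_D_funcs:
  defines "Dn n \<equiv> ap (2 * n) (block_matrix n 1 1)" and "Jn n \<equiv> ap (2 * n) (block_matrix n 1 (-1))" and "Tn n \<equiv> ap (2 * n) (\<lambda>i j. block_matrix n 1 1 j i)"
  shows "Dn n v = join_blocks n (shift_up n v - shift_down n v + shift_up n (second_block n v)) (shift_down n v)"
    and "Jn n v = join_blocks n (shift_up n v - shift_down n v + shift_up n (second_block n v)) (- shift_down n v)"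
    and "Tn n v = join_blocks n (shift_down n v - shift_up n v + shift_up n (second_block n v)) (shift_down n v)"
proof -
  show "Dn n v = join_blocks n (shift_up n v - shift_down n v + shift_up n (second_block n v)) (shift_down n v)"
    and "Jn n v = join_blocks n (shift_up n v - shift_down n v + shift_up n (second_block n v)) (- shift_down n v)"
    unfolding Dn_def Jn_def ap_block_matrix by simp_all
  have "(\<lambda>i j. block_matrix n 1 1 j i) = block_matrix n (-1) 1"
    by (intro ext) (auto simp: block_matrix_def Let_def)
  then show "Tn n v = join_blocks n (shift_down n v - shift_up n v + shift_up n (second_block n v)) (shift_down n v)"
    unfolding Tn_def ap_block_matrix by (simp only: ap_block_matrix) simp
qed

lemma shift_up_power: "(shift_up n ^^ Suc k) x i = (if i + Suc k < n then x (i + Suc k) else 0)"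
proof (induction k arbitrary: x)
  case (Suc k)
  have "(shift_up n ^^ Suc (Suc k)) x i = (shift_up n ^^ Suc k) (shift_up n x) i" by (simp only: funpow_Suc_right o_apply)
  also have "\<dots> = (if i + Suc k < n then shift_up n x (i + Suc k) else 0)" by (rule Suc)
  also have "\<dots> = (if i + Suc (Suc k) < n then x (i + Suc (Suc k)) else 0)" by (simp add: shift_up_def)
  finally show ?case .
qed (simp add: shift_up_def)

lemma shift_down_power: "(shift_down n ^^ Suc k) x i = (if Suc k \<le> i \<and> i < n then x (i - Suc k) else 0)"
proof (induction k arbitrary: x)
  case (Suc k)
  have "(shift_down n ^^ Suc (Suc k)) x i = (shift_down n ^^ Suc k) (shift_down n x) i" by (simp only: funpow_Suc_right o_apply)
  also have "\<dots> = (if Suc k \<le> i \<and> i < n then shift_down n x (i - Suc k) else 0)" by (rule Suc)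
  also have "\<dots> = (if Suc (Suc k) \<le> i \<and> i < n then x (i - Suc (Suc k)) else 0)" by (auto simp: shift_down_def)
  finally show ?case .
qed (auto simp: shift_down_def)

text \<open>In the coordinates \<open>s = u + w\<close> and \<open>u\<close> the matrix \<open>D\<close> is block triangular with nilpotent diagonal blocks: \<open>s\<close> is
  mapped to \<open>A s\<close>, and on the invariant subspace \<open>s = 0\<close> the vector \<open>u\<close> is mapped to \<open>- A\<^sup>T u\<close>.\<close>

abbreviation Dn :: "nat \<Rightarrow> vec \<Rightarrow> vec" where "Dn n \<equiv> ap (2 * n) (block_matrix n 1 1)"

definition block_sum :: "nat \<Rightarrow> vec \<Rightarrow> vec" where
  "block_sum n v = (\<lambda>i. if i < n then v i + v (n + i) else 0)"

lemma block_sum_Dn: "block_sum n (Dn n v) = shift_up n (block_sum n v)"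
  unfolding block_matrix_D_funcs(1) by (auto simp: block_sum_def join_blocks_def shift_up_def shift_down_def second_block_def fun_eq_iff)

lemma block_sum_Dn_power: "block_sum n ((Dn n ^^ k) v) = (shift_up n ^^ k) (block_sum n v)"
proof (induction k)
  case (Suc k)
  have "block_sum n ((Dn n ^^ Suc k) v) = shift_up n (block_sum n ((Dn n ^^ k) v))" using block_sum_Dn[of n "(Dn n ^^ k) v"] by simp
  then show ?case unfolding Suc by simp
qed simp

lemma Dn_on_kernel:
  assumes "block_sum n v = 0"
  shows "Dn n v = join_blocks n (- shift_down n v) (shift_down n v)"
proof -
  have "v i + v (n + i) = 0" if "i < n" for i using fun_cong[OF assms, of i] that by (simp add: block_sum_def)
  from this[of "Suc _"] have "shift_up n v + shift_up n (second_block n v) = 0" by (auto simp: shift_up_def second_block_def fun_eq_iff)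
  then have "(shift_up n v + shift_up n (second_block n v)) - shift_down n v = - shift_down n v" by (simp only: diff_0)
  then have eq: "shift_up n v - shift_down n v + shift_up n (second_block n v) = - shift_down n v" by (simp only: diff_add_eq)
  show ?thesis unfolding block_matrix_D_funcs(1) eq ..
qed

text \<open>After \<open>n\<close> steps the sum of the two blocks is zero. From then on \<open>D\<close> acts on \<open>u\<close> as \<open>- A\<^sup>T\<close>, whose \<open>n\<close>-th power is zero.\<close>

lemma Dn_nilpotent: "0 < n \<Longrightarrow> (Dn n ^^ (2 * n + 1)) v = 0"
proof -
  assume n: "0 < n"
  then obtain k where k: "n = Suc k" by (cases n) auto
  define w where "w = (Dn n ^^ n) v"
  have w: "block_sum n w = 0"
    unfolding w_def block_sum_Dn_power by (rule ext) (simp only: k shift_up_power, simp)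
  have z: "(shift_up n ^^ j) 0 = (0 :: vec)" for j by (induction j) (simp_all del: zero_fun_apply)
  have s: "block_sum n ((Dn n ^^ j) w) = 0" for j unfolding block_sum_Dn_power w by (rule z)
  have "shift_down n ((Dn n ^^ j) w) = scl ((-1) ^ j) ((shift_down n ^^ Suc j) w)" for j
  proof (induction j)
    case (Suc j)
    have "shift_down n ((Dn n ^^ Suc j) w) = shift_down n (join_blocks n (- shift_down n ((Dn n ^^ j) w)) (shift_down n ((Dn n ^^ j) w)))"
      using Dn_on_kernel[OF s[of j]] by simp
    also have "\<dots> = - shift_down n (shift_down n ((Dn n ^^ j) w))" by simp
    also have "\<dots> = - shift_down n (scl ((-1) ^ j) ((shift_down n ^^ Suc j) w))" unfolding Suc ..
    also have "\<dots> = scl ((-1) ^ Suc j) ((shift_down n ^^ Suc (Suc j)) w)" by (simp add: fun_eq_iff)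
    finally show ?case .
  qed simp
  then have "shift_down n ((Dn n ^^ n) w) = scl ((-1) ^ n) ((shift_down n ^^ Suc n) w)" .
  also have "(shift_down n ^^ Suc n) w = 0" by (rule ext) (simp only: shift_down_power, simp)
  finally have d: "shift_down n ((Dn n ^^ n) w) = 0" by (simp only: scl_simps)
  have "(Dn n ^^ (2 * n + 1)) v = Dn n ((Dn n ^^ n) w)"
    by (simp add: w_def mult_2 funpow_add)
  also have "\<dots> = 0" unfolding Dn_on_kernel[OF s] d by (simp add: join_blocks_linear)
  finally show ?thesis .
qed

text \<open>Seen through the sum of the blocks, \<open>D\<close> is the upward shift, which moves the last unit vector to the first in
  \<open>n - 1\<close> steps.\<close>

lemma Dn_power_nonzero:
  assumes "0 < n" shows "(Dn n ^^ (n - 1)) (unit_coord (n - 1)) \<noteq> 0"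
proof
  assume 0: "(Dn n ^^ (n - 1)) (unit_coord (n - 1)) = 0"
  have "block_sum n ((Dn n ^^ (n - 1)) (unit_coord (n - 1))) 0 = 0" unfolding 0 by (simp add: block_sum_def)
  then have "(shift_up n ^^ (n - 1)) (block_sum n (unit_coord (n - 1))) 0 = 0" unfolding block_sum_Dn_power .
  moreover have "(shift_up n ^^ (n - 1)) (block_sum n (unit_coord (n - 1))) 0 = 1"
  proof (cases "n - 1")
    case 0
    then show ?thesis using assms by (simp add: block_sum_def unit_coord_def)
  next
    case (Suc k)
    then show ?thesis using assms by (simp only: shift_up_power) (auto simp: block_sum_def unit_coord_def)
  qed
  ultimately show False by simp
qed

lemma block_matrix_data: "0 < n \<Longrightarrow> nil_data (2 * n) (block_matrix n 1 1) (block_matrix n 1 (-1)) (2 * n + 1)"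
proof
  show "block_matrix n 1 (-1) i j = - block_matrix n 1 (-1) j i" for i j by (auto simp: block_matrix_def Let_def)
  show "block_matrix n 1 1 i j = 0" if "2 * n \<le> i" for i j using that by (auto simp: block_matrix_def Let_def)
  show "block_matrix n 1 1 i j = 0" if "2 * n \<le> j" for i j using that by (auto simp: block_matrix_def Let_def)
  show "block_matrix n 1 (-1) i j = 0" if "2 * n \<le> i" for i j using that by (auto simp: block_matrix_def Let_def)
  show "ap (2 * n) (block_matrix n 1 (- 1)) (ap (2 * n) (block_matrix n 1 1) v) =
      - ap (2 * n) (\<lambda>i j. block_matrix n 1 1 j i) (ap (2 * n) (block_matrix n 1 (- 1)) v)" for v
    unfolding block_matrix_D_funcs by (simp add: join_blocks_linear algebra_simps)
  show "ap (2 * n) (block_matrix n 1 (- 1)) w + ap (2 * n) (\<lambda>i j. block_matrix n 1 1 j i) w = 0"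
    if "w = ap (2 * n) (block_matrix n 1 (- 1)) v + ap (2 * n) (\<lambda>i j. block_matrix n 1 1 j i) v" for v w
  proof -
    have w: "w = join_blocks n (scl 2 (shift_up n (second_block n v))) 0"
      unfolding that block_matrix_D_funcs join_blocks_linear by (auto simp: join_blocks_def fun_eq_iff)
    show ?thesis unfolding block_matrix_D_funcs join_blocks_linear by (simp add: w join_blocks_linear)
  qed
qed (rule Dn_nilpotent)

text \<open>A skew map \<open>B\<close> that commutes with \<open>D\<close> and \<open>J\<close> up to the factor \<open>\<mu>\<close> does so with \<open>T = D - J\<close> and its adjoint
  \<open>S\<close>, hence up to \<open>2 \<mu>\<close> with \<open>S T / 4\<close>, the projection onto the unit vectors \<open>e 0, \<dots>, e (n - 2)\<close>. The diagonal of
  \<open>B\<close> vanishes, so \<open>\<mu> = 0\<close>. Then \<open>B\<close> also commutes with the tridiagonal map \<open>K = A - A\<^sup>T\<close> of the first block.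
  The vector \<open>B (e (n - 1))\<close> lies in the first block and in the kernel of the projection, so it is a multiple of
  \<open>e (n - 1)\<close>, hence zero. Recursion with \<open>K\<close> goes down to \<open>e 0\<close>, and \<open>T\<close> carries the result to the second block except for its first
  unit vector \<open>e n\<close>, for which skewness suffices.\<close>

lemma block_matrix_rigid:
  assumes n: "3 \<le> n" shows "rigid_data (2 * n) (block_matrix n 1 1) (block_matrix n 1 (-1)) (2 * n + 1)"
proof -
  interpret nil_data "2 * n" "block_matrix n 1 1" "block_matrix n 1 (-1)" "2 * n + 1" by (rule block_matrix_data) (use n in simp)
  define e where "e = (unit_coord :: nat \<Rightarrow> vec)"
  have e_in: "e i \<in> coord_space (2 * n)" if "i < 2 * n" for i unfolding e_def by (rule unit_coord_in[OF that])
  have ip_e: "ip (2 * n) v (e i) = v i" if "i < 2 * n" for v i unfolding e_def by (rule ip_unit[OF that])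
  define T where "T v = D v - J v" for v
  have T: "T v = join_blocks n 0 (scl 2 (shift_down n v))" for v
    unfolding T_def block_matrix_D_funcs join_blocks_linear by (auto simp: join_blocks_def fun_eq_iff)
  have S: "S v = join_blocks n (scl 2 (shift_up n (second_block n v))) 0" for v
    unfolding S_def block_matrix_D_funcs join_blocks_linear by (auto simp: join_blocks_def fun_eq_iff)
  have ST_adj: "ip (2 * n) (S v) w = ip (2 * n) v (T w)" for v w
    using S_ip[of v w] J_skew[of v w] by (simp add: T_def ip_commute)
  have T_in: "T v \<in> coord_space (2 * n)" for v by (simp add: T_def)
  define Pr where "Pr v = scl (1/4) (S (T v))" for v
  have Pr: "Pr v i = (if Suc i < n then v i else 0)" for v i
    unfolding Pr_def S T by (auto simp: join_blocks_def shift_up_def shift_down_def second_block_def)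
  define K where "K v = J v - scl (1/2) (S v) + scl (1/2) (T v)" for v
  have K: "K v = join_blocks n (shift_up n v - shift_down n v) 0" for v
    unfolding K_def S T block_matrix_D_funcs join_blocks_linear by (auto simp: join_blocks_def fun_eq_iff)
  show ?thesis
  proof
    show "\<exists>v\<in>coord_space (2 * n). \<exists>w\<in>coord_space (2 * n). ip (2 * n) (J v) w \<noteq> 0"
    proof (intro bexI)
      have "J (e 1) 0 = 1" unfolding block_matrix_D_funcs using n by (simp add: join_blocks_def shift_up_def shift_down_def second_block_def e_def unit_coord_def)
      then show "ip (2 * n) (J (e 1)) (e 0) \<noteq> 0" using n by (simp add: ip_e)
    qed (use n e_in in auto)
    fix B :: "vec \<Rightarrow> vec" and \<mu> v
    assume add: "\<And>v w. v \<in> coord_space (2 * n) \<Longrightarrow> w \<in> coord_space (2 * n) \<Longrightarrow> B (v + w) = B v + B w"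
      and scl: "\<And>c v. v \<in> coord_space (2 * n) \<Longrightarrow> B (scl c v) = scl c (B v)"
      and B_in: "\<And>v. v \<in> coord_space (2 * n) \<Longrightarrow> B v \<in> coord_space (2 * n)"
      and skew: "\<And>v w. v \<in> coord_space (2 * n) \<Longrightarrow> w \<in> coord_space (2 * n) \<Longrightarrow> ip (2 * n) (B v) w = - (ip (2 * n) v (B w))"
      and BD: "\<And>v. v \<in> coord_space (2 * n) \<Longrightarrow> B (D v) - D (B v) = scl \<mu> (D v)"
      and BJ: "\<And>v. v \<in> coord_space (2 * n) \<Longrightarrow> B (J v) - J (B v) = scl \<mu> (J v)"
      and v: "v \<in> coord_space (2 * n)"
    have diff: "B (x - y) = B x - B y" if "x \<in> coord_space (2 * n)" "y \<in> coord_space (2 * n)" for x y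
    proof -
      have "x - y = x + scl (-1) y" by (simp add: fun_eq_iff)
      then show ?thesis using add[OF that(1), of "scl (-1) y"] scl[OF that(2), of "-1"] that(2) by simp
    qed
    have BT: "B (T v) - T (B v) = scl \<mu> (T v)" if "v \<in> coord_space (2 * n)" for v
    proof -
      have "B (T v) = B (D v) - B (J v)" unfolding T_def by (rule diff) simp_all
      then have "B (T v) - T (B v) = (B (D v) - D (B v)) - (B (J v) - J (B v))" by (simp add: T_def)
      then show ?thesis unfolding BD[OF that] BJ[OF that] by (simp add: T_def scl_add)
    qed
    have BS: "B (S v) - S (B v) = scl \<mu> (S v)" if "v \<in> coord_space (2 * n)" for v
    proof (rule vec_eq_ipI[of _ "2 * n"])
      fix w :: vec assume w: "w \<in> coord_space (2 * n)"
      have "ip (2 * n) (B (S v)) w = - (ip (2 * n) (S v) (B w))" "ip (2 * n) (B v) (T w) = - (ip (2 * n) v (B (T w)))" by (rule skew; use that w T_in in simp)+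
      moreover have "ip (2 * n) v (B (T w)) = ip (2 * n) v (T (B w)) + \<mu> * (ip (2 * n) v (T w))"
        using arg_cong[OF BT[OF w], of "\<lambda>x. ip (2 * n) v x"] by simp
      ultimately show "ip (2 * n) (B (S v) - S (B v)) w = ip (2 * n) (scl \<mu> (S v)) w" by (simp add: ST_adj)
    qed (use that B_in in simp_all)
    have BPr: "B (Pr v) - Pr (B v) = scl (2 * \<mu>) (Pr v)" if "v \<in> coord_space (2 * n)" for v
    proof -
      have "B (S (T v)) = S (B (T v)) + scl \<mu> (S (T v))" using BS[OF T_in, of v] by (simp add: algebra_simps)
      also have "B (T v) = T (B v) + scl \<mu> (T v)" using BT[OF that] by (simp add: algebra_simps)
      finally have "B (S (T v)) = S (T (B v)) + scl (2 * \<mu>) (S (T v))"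
        by (simp only: S_linear mult_2[of \<mu>] scl_add add.assoc)
      note BST = this
      have "B (Pr v) = scl (1/4) (B (S (T v)))" unfolding Pr_def by (rule scl) simp
      then show ?thesis unfolding BST by (simp add: Pr_def scl_add)
    qed
    have e0: "e 0 \<in> coord_space (2 * n)" using n e_in by simp
    have Bii: "B (e i) i = 0" if "i < 2 * n" for i
      using skew[OF e_in[OF that] e_in[OF that]] ip_commute[of "2 * n" "e i" "B (e i)"] ip_e[OF that, of "B (e i)"] by simp
    have Pr_e: "Pr (e i) = e i" if "Suc i < n" for i using that by (auto simp: Pr e_def unit_coord_def fun_eq_iff)
    have \<mu>0: "\<mu> = 0"
    proof -
      have "B (e 0) 0 - Pr (B (e 0)) 0 = 2 * \<mu> * e 0 0"
        using fun_cong[OF BPr[OF e0], of 0] Pr_e[of 0] n by simp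
      then show ?thesis using n by (simp add: Pr e_def unit_coord_def)
    qed
    have BK: "B (K v) = K (B v)" if "v \<in> coord_space (2 * n)" for v
      using BJ[OF that] BS[OF that] BT[OF that] that B_in T_in \<mu>0
      by (simp add: K_def diff add scl)
    have K_e: "K (e (Suc j)) = e j - (if Suc (Suc j) < n then e (Suc (Suc j)) else 0)" if "Suc j < n" for j
      unfolding K using that by (auto simp: join_blocks_def shift_up_def shift_down_def e_def unit_coord_def fun_eq_iff)
    have last: "B (e (n - 1)) = 0"
    proof -
      have lt: "n - 1 < 2 * n" "n - 2 < 2 * n" "n - 3 < 2 * n" using n by auto
      have "K (e (n - 2)) = e (n - 3) - e (n - 1)"
        using K_e[of "n - 3"] n by (simp add: numeral_eq_Suc Suc_diff_Suc)
      \<comment> \<open>Here \<open>n \<ge> 3\<close> is used. The right-hand side shows that the image under \<open>B\<close> has no entries in the second block.\<close>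
      then have en: "e (n - 1) = e (n - 3) - K (e (n - 2))" by (simp add: algebra_simps)
      have "K (e (n - 2)) \<in> coord_space (2 * n)" by (simp add: K_def T_in)
      then have en1: "B (e (n - 1)) = B (e (n - 3)) - K (B (e (n - 2)))"
        using diff[OF e_in[OF lt(3)]] BK[OF e_in[OF lt(2)]] en by metis
      have e3: "B (e (n - 3)) = Pr (B (e (n - 3)))"
        using BPr[OF e_in[OF lt(3)]] Pr_e[of "n - 3"] n \<mu>0 by simp
      have hi: "B (e (n - 1)) i = 0" if "n \<le> i" for i
      proof -
        have "B (e (n - 3)) i = Pr (B (e (n - 3))) i" using e3 by (rule fun_cong)
        also have "\<dots> = 0" using that by (simp add: Pr)
        finally show ?thesis using en1 that by (simp add: K join_blocks_def)
      qed
      have "Pr (e (n - 1)) = 0" using n by (auto simp: Pr e_def unit_coord_def fun_eq_iff)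
      moreover have "B 0 = 0" using scl[OF e0, of 0] by simp
      ultimately have "Pr (B (e (n - 1))) = 0" using BPr[OF e_in[OF lt(1)]] \<mu>0 by simp
      then have lo: "B (e (n - 1)) i = 0" if "Suc i < n" for i using Pr[of "B (e (n - 1))" i] that by simp
      show ?thesis
      proof
        fix i
        consider "n \<le> i" | "Suc i < n" | "i = n - 1" by linarith
        then show "B (e (n - 1)) i = 0 i" using hi lo Bii[OF lt(1)] by cases simp_all
      qed
    qed
    \<comment> \<open>Two consecutive vectors are carried along, as \<open>K (e (i + 1)) = e i - e (i + 2)\<close>. The truncated difference
    \<open>j - 1\<close> repeats the last vector at the start.\<close>
    have first: "B (e (n - 1 - j)) = 0 \<and> B (e (n - 1 - (j - 1))) = 0" for j
    proof (induction j)
      case (Suc j)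
      show ?case
      proof (cases "Suc j \<le> n - 1")
        case True
        define i where "i = n - 1 - Suc j"
        have i: "Suc i < n" "n - 1 - j = Suc i" using True by (auto simp: i_def)
        have lt: "Suc i < 2 * n" "i < 2 * n" using i by auto
        have Bi: "B (e (Suc i)) = 0" using conjunct1[OF Suc] unfolding i(2) .
        have K0: "K (B (e (Suc i))) = 0" unfolding Bi by (simp add: K_def T_def)
        have Ki: "B (K (e (Suc i))) = 0" using BK[OF e_in[OF lt(1)]] K0 by simp
        have "B (e i) = 0"
        proof (cases "Suc (Suc i) < n")
          case True
          then have "n - 1 - (j - 1) = Suc (Suc i)" using i by auto
          then have "B (e (Suc (Suc i))) = 0" using conjunct2[OF Suc] by (simp only:)
          moreover have "B (e i) - B (e (Suc (Suc i))) = 0"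
            using Ki K_e[OF i(1)] True diff[OF e_in e_in, of i "Suc (Suc i)"] by simp
          ultimately show ?thesis by simp
        qed (use Ki K_e[OF i(1)] in simp)
        moreover have "n - 1 - (Suc j - 1) = Suc i" using i(2) by simp
        ultimately show ?thesis using Bi by (simp only: i_def)
      next
        case False
        then have "n - 1 - Suc j = n - 1 - j" by simp
        then show ?thesis using Suc by (simp only: diff_Suc_1)
      qed
    qed (use last in \<open>simp del: zero_fun_apply\<close>)
    have U: "B (e i) = 0" if "i < n" for i using first[of "n - 1 - i"] that by simp
    have W: "B (e (n + Suc i)) = 0" if "Suc i < n" for i
    proof -
      have "e (n + Suc i) = scl (1/2) (T (e i))"
        unfolding T using that by (auto simp: join_blocks_def shift_down_def e_def unit_coord_def fun_eq_iff)
      moreover have "B (T (e i)) = T (B (e i))" using BT[OF e_in, of i] that \<mu>0 by simp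
      ultimately show ?thesis using scl[OF T_in] U[of i] that by (simp add: T_def)
    qed
    have off: "B (e i) = 0" if "i < 2 * n" "i \<noteq> n" for i
      using U[of i] W[of "i - n - 1"] that by (cases "i < n") simp_all
    have comp: "B x i = 0" if "x \<in> coord_space (2 * n)" "i < 2 * n" "i \<noteq> n" for x i
      using skew[OF that(1) e_in[OF that(2)]] off[OF that(2,3)] ip_e[OF that(2)] by simp
    have "B (e n) = 0"
    proof
      fix i
      have n2: "n < 2 * n" using n by simp
      show "B (e n) i = 0 i"
        using comp[OF e_in[OF n2], of i] Bii[OF n2] B_in[OF e_in[OF n2]]
        by (cases "i < 2 * n"; cases "i = n") (simp_all add: coord_space_iff)
    qed
    then have "B (e i) = 0" if "i < 2 * n" for i using off that by blast
    then have "B v i = 0" if "i < 2 * n" for i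
      using skew[OF v e_in[OF that]] ip_e[OF that] that by simp
    then show "B v = 0" using B_in[OF v] by (auto simp: coord_space_iff fun_eq_iff not_less[symmetric])
  qed
qed


section \<open>Existence\<close>

theorem theorem4:
  fixes d :: nat
  assumes "d > 1"
  shows "(\<exists>(N :: (nat \<Rightarrow> real) monoid) M g s.
            lorentz_nilmanifold N M g \<and> naturally_reductive N M g \<and> geodesic_orbit N M g \<and>
            nilpotent_of_step N s \<and> s \<ge> d \<and> mdim M = 2 * d + 4)
       \<and> (\<exists>(N1 :: (nat \<Rightarrow> real) monoid) M1 g1 (N2 :: (nat \<Rightarrow> real) monoid) M2 g2 d'.
            pseudo_riemannian_nilmanifold N1 M1 g1 \<and> mdim M1 > 0 \<and>
            pseudo_riemannian_nilmanifold N2 M2 g2 \<and> mdim M2 > 0 \<and>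
            lorentz_nilmanifold (N1 \<times>\<times> N2) (prod_manifold M1 M2) (product_metric g1 g2) \<and>
            geodesic_orbit (N1 \<times>\<times> N2) (prod_manifold M1 M2) (product_metric g1 g2) \<and>
            mdim (prod_manifold M1 M2) = 2 * d + 10 \<and>
            nilpotent_of_step (N1 \<times>\<times> N2) d' \<and> d' \<ge> d)"
proof -
  \<comment> \<open>\<open>D\<^sup>d \<noteq> 0\<close> gives a step greater than \<open>d\<close>, and the dimension is \<open>2 n + 2 = 2 d + 4\<close>.\<close>
  define n where "n = d + 1"
  have n: "3 \<le> n" "0 < n" using assms by (simp_all add: n_def)
  interpret R: rigid_data "2 * n" "block_matrix n 1 1" "block_matrix n 1 (-1)" "2 * n + 1" by (rule block_matrix_rigid[OF n(1)])
  let ?M = "std_manifold (Suc (Suc (2 * n)))"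
  interpret X: nil_model "2 * n" "block_matrix n 1 1" "block_matrix n 1 (-1)" "2 * n + 1" ?M "\<lambda>x. x" R.std_group R.std_metric
    by (rule R.std_model)
  interpret XR: rigid_model "2 * n" "block_matrix n 1 1" "block_matrix n 1 (-1)" "2 * n + 1" ?M "\<lambda>x. x" R.std_group R.std_metric ..
  interpret Y: nil_model "2 * n + 6" "block_matrix n 1 1" "block_matrix n 1 (-1)" "2 * n + 1" "prod_manifold ?M (std_manifold 6)"
    "chart_pair (Suc (Suc (2 * n))) (\<lambda>x. x) (\<lambda>x. x)" "R.std_group \<times>\<times> eucl_group 6" "product_metric R.std_metric (eucl_metric 6)"
    by (rule R.product_model)
  have u: "unit_coord (n - 1) \<in> coord_space (2 * n)" "unit_coord (n - 1) \<in> coord_space (2 * n + 6)"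
    by (rule unit_coord_in; use n in simp)+
  have ap6: "ap (2 * n + 6) (block_matrix n 1 1) = ap (2 * n) (block_matrix n 1 1)"
    by (rule ext) (rule R.ap_extend[OF R.Dm_zero(2)])
  obtain s where s: "n - 1 < s" "nilpotent_of_step R.std_group s"
    using X.nilpotent_step[OF u(1) Dn_power_nonzero[OF n(2)]] by blast
  obtain s' where s': "n - 1 < s'" "nilpotent_of_step (R.std_group \<times>\<times> eucl_group 6) s'"
    using Y.nilpotent_step[OF u(2), unfolded ap6, OF Dn_power_nonzero[OF n(2)]] by blast
  show ?thesis
  proof (intro conjI)
    show "\<exists>(N :: (nat \<Rightarrow> real) monoid) M g s.
            lorentz_nilmanifold N M g \<and> naturally_reductive N M g \<and> geodesic_orbit N M g \<and>
            nilpotent_of_step N s \<and> s \<ge> d \<and> mdim M = 2 * d + 4"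
      using X.lorentz_nilmanifold_N XR.naturally_reductive_N X.geodesic_orbit_N s
      by (intro exI[of _ R.std_group] exI[of _ ?M] exI[of _ R.std_metric] exI[of _ s]) (simp add: n_def)
    show "\<exists>(N1 :: (nat \<Rightarrow> real) monoid) M1 g1 (N2 :: (nat \<Rightarrow> real) monoid) M2 g2 d'.
            pseudo_riemannian_nilmanifold N1 M1 g1 \<and> mdim M1 > 0 \<and>
            pseudo_riemannian_nilmanifold N2 M2 g2 \<and> mdim M2 > 0 \<and>
            lorentz_nilmanifold (N1 \<times>\<times> N2) (prod_manifold M1 M2) (product_metric g1 g2) \<and>
            geodesic_orbit (N1 \<times>\<times> N2) (prod_manifold M1 M2) (product_metric g1 g2) \<and>
            mdim (prod_manifold M1 M2) = 2 * d + 10 \<and>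
            nilpotent_of_step (N1 \<times>\<times> N2) d' \<and> d' \<ge> d"
      using X.lorentz_nilmanifold_N eucl_nilmanifold[of 6] Y.lorentz_nilmanifold_N Y.geodesic_orbit_N s'
      by (intro exI[of _ R.std_group] exI[of _ ?M] exI[of _ R.std_metric] exI[of _ "eucl_group 6"]
          exI[of _ "std_manifold 6"] exI[of _ "eucl_metric 6"] exI[of _ s'])
        (simp add: n_def lorentz_nilmanifold_def prod_manifold_def)
  qed
qed

end
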